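(* Let $q$ be a prime power, let $k,m$ be positive integers, and let $\mathcal Y$ be a class of endomorphisms over $\mathbb{F}_q$. Then $$\kappa_{(k)}^{k+m}(\mathcal Y)=\sum_{j=0}^{k} c(k-j,\mathcal Y)\sum_{\lambda\in\mathcal P_j^m}\kappa_\lambda^m(\mathcal Y).$$ In particular, taking $\mathcal Y$ to be the class of nilpotent endomorphisms, $$\rho_{(k,m)}(q)=\sum_{j=0}^{k}p(k-j)\sum_{\lambda\in\mathcal P_j^m}\nu_\lambda^m(q).$$
   Context: For a finite set $X$ acted on by a group $G$, $\gamma(G,X)$ denotes the number of $G$-orbits on $X$. For a tuple $\mathbf l=(l_1,\dots,l_s)$ of nonnegative integers with $l_1+\dots+l_s=N$, $M^{\mathbf l}(q)$ is the set of $N\times N$ matrices over $\mathbb{F}_q$ that are block upper triangular with diagonal blocks of sizes $l_1,\dots,l_s$ (blocks of size $0$ are empty); $P^{\mathbf l}(q)$ is the group of invertible elements of $M^{\mathbf l}(q)$ and $N^{\mathbf l}(q)$ the set of nilpotent elements of $M^{\mathbf l}(q)$; $P^{\mathbf l}(q)$ acts on $M^{\mathbf l}(q)$ by conjugation, and $\rho_{\mathbf l}(q)=\gamma(P^{\mathbf l}(q),N^{\mathbf l}(q))$. A partition is a (possibly empty) non-increasing sequence $\lambda=(\lambda_1,\dots,\lambda_r)$ of positive integers, $|\lambda|=\sum\lambda_i$; $\mathcal P_j^m$ is the set of partitions $\lambda$ with $|\lambda|=j$ and $\lambda_1\le m$ (so $\mathcal P_0^m$ contains only the empty partition); $p(j)$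 is the number of partitions of $j$ ($p(0)=1$). For $\lambda=(\lambda_1,\dots,\lambda_r)$ with $\lambda_1\le m$, set $\delta(m,\lambda)=(\lambda_r,\lambda_{r-1}-\lambda_r,\dots,\lambda_1-\lambda_2,m-\lambda_1)$ (for $\lambda$ empty, $\delta(m,\lambda)=(m)$). A class of endomorphisms over $\mathbb{F}_q$: fix a subset $F$ of the algebraic closure $\overline{\mathbb{F}}_q$; $\mathcal Y=\mathcal Y_F$ is the family of all linear endomorphisms $T$ of finite-dimensional $\mathbb{F}_q$-vector spaces such that all eigenvalues of $T$ in $\overline{\mathbb{F}}_q$ lie in $F$ (e.g. nilpotent endomorphisms: $F=\{0\}$). $c(j,\mathcal Y)$ is the number of $\mathrm{GL}_j(\mathbb{F}_q)$-conjugacy orbits on the set of $j\times j$ matrices over $\mathbb{F}_q$ lying in $\mathcal Y$ (with $\mathrm{GL}_0$ trivial and $c(0,\mathcal Y)=1$); for nilpotents, $c(j,\mathcal Y)=p(j)$. Define $\kappa^m_\lambda(\mathcal Y)=\gamma\big(P^{\delta(m,\lambda)}(q),\,M^{\delta(m,\lambda)}(q)\cap\mathcal Y\big)$ and $\nu^m_\lambda(q)=\rho_{\delta(m,\lambda)}(q)$. Note $\kappa_{(k)}^{k+m}(\mathcal Y)=\gamma(P^{(k,m)}(q),M^{(k,m)}(q)\cap\mathcal Y)$. *)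

theory Defs
  imports "Jordan_Normal_Form.Char_Poly" "HOL-Computational_Algebra.Polynomial_Factorial"
begin

definition blk :: "nat list \<Rightarrow> nat \<Rightarrow> nat" where
  "blk ls i = card {b. b < length ls \<and> sum_list (take (Suc b) ls) \<le> i}"

definition Mblk :: "nat list \<Rightarrow> 'a :: field mat set" where
  "Mblk ls = {A \<in> carrier_mat (sum_list ls) (sum_list ls).
      \<forall>i < sum_list ls. \<forall>j < sum_list ls. blk ls j < blk ls i \<longrightarrow> A $$ (i, j) = 0}"

definition Pblk :: "nat list \<Rightarrow> 'a :: field mat set" where
  "Pblk ls = {A \<in> Mblk ls. invertible_mat A}"

definition nilpotent_mat :: "'a :: field mat \<Rightarrow> bool" where
  "nilpotent_mat A \<longleftrightarrow> (\<exists>e. A ^\<^sub>m e = 0\<^sub>m (dim_row A) (dim_col A))"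

definition Nblk :: "nat list \<Rightarrow> 'a :: field mat set" where
  "Nblk ls = {A \<in> Mblk ls. nilpotent_mat A}"

definition conj_orbits :: "'a :: field mat set \<Rightarrow> 'a mat set \<Rightarrow> nat" where
  "conj_orbits G X = card ((\<lambda>A. {B \<in> X. \<exists>P \<in> G. P * A = B * P}) ` X)"

(* The class Y_F.  An irreducible factor of the characteristic polynomial has all its roots
   among the eigenvalues, so "all eigenvalues lie in F" is determined by the set S_F of monic
   irreducible polynomials over F_q all of whose roots lie in F; every set S of monic
   irreducibles arises this way.  We parametrise the class by such a set S. *)
definition in_class :: "'a :: field poly set \<Rightarrow> 'a mat \<Rightarrow> bool" where
  "in_class S A \<longleftrightarrow> (\<forall>p. monic p \<and> irreducible p \<and> p dvd char_poly A \<longrightarrow> p \<in> S)"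

definition class_mats :: "'a :: field poly set \<Rightarrow> 'a mat set" where
  "class_mats S = {A. in_class S A}"

definition c_count :: "nat \<Rightarrow> 'a :: field poly set \<Rightarrow> nat" where
  "c_count j S = conj_orbits {P \<in> carrier_mat j j. invertible_mat P} (carrier_mat j j \<inter> class_mats S)"

definition is_partition :: "nat list \<Rightarrow> bool" where
  "is_partition lam \<longleftrightarrow> sorted_wrt (\<ge>) lam \<and> (\<forall>x \<in> set lam. 0 < x)"

definition partitions_bounded :: "nat \<Rightarrow> nat \<Rightarrow> nat list set" where
  "partitions_bounded j m = {lam. is_partition lam \<and> sum_list lam = j \<and> (\<forall>x \<in> set lam. x \<le> m)}"

definition partition_count :: "nat \<Rightarrow> nat" where
  "partition_count j = card {lam. is_partition lam \<and> sum_list lam = j}"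

definition delta :: "nat \<Rightarrow> nat list \<Rightarrow> nat list" where
  "delta m lam = rev (map2 (-) (m # lam) (lam @ [0]))"

definition kappa :: "nat \<Rightarrow> nat list \<Rightarrow> 'a :: field poly set \<Rightarrow> nat" where
  "kappa m lam S = conj_orbits (Pblk (delta m lam)) (Mblk (delta m lam) \<inter> class_mats S)"

definition rho :: "'a :: field itself \<Rightarrow> nat list \<Rightarrow> nat" where
  "rho _ ls = conj_orbits (Pblk ls :: 'a mat set) (Nblk ls)"

definition nu :: "'a :: field itself \<Rightarrow> nat \<Rightarrow> nat list \<Rightarrow> nat" where
  "nu t m lam = rho t (delta m lam)"

end

theory Submission
  imports Defs "Jordan_Normal_Form.Jordan_Normal_Form_Existence"
    "Jordan_Normal_Form.Jordan_Normal_Form_Uniqueness"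
begin

text \<open>
  Consider a flag \<open>W\<^sub>1 \<subseteq> \<dots> \<subseteq> W\<close> stable under \<open>D\<close>, an endomorphism \<open>A\<close> of a \<open>k\<close>-dimensional space \<open>U\<close>,
  and an extension of \<open>(W\<^sub>1, D)\<close> by \<open>(U, A)\<close>, up to isomorphism of all the data. By Burnside's lemma the
  number of such classes equals the number of classes of triples \<open>(D, A, F)\<close>, where \<open>F : U \<rightarrow> W\<^sub>1\<close>
  intertwines \<open>A\<close> and \<open>D\<close>: for commuting automorphisms the fixed extensions and the fixed maps are the
  kernels of two linear maps that are adjoint for the trace pairing. Sorting the triples by the rank \<open>i\<close>
  of \<open>F\<close>, a triple of rank \<open>i\<close> amounts to the finer flag \<open>F U \<subseteq> W\<^sub>1 \<subseteq> \<dots> \<subseteq> W\<close> together with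
  an extension of \<open>F U\<close> by the \<open>(k - i)\<close>-dimensional kernel of \<open>F\<close>. Iterating until the rank is zero yields a
  partition formed by the successive ranks, and an endomorphism of the last kernel without
  constraints.
\<close>

section \<open>Counting orbits\<close>

text \<open>An endomorphism is a module over the polynomial ring in one variable. There
  \<open>Ext(W, U)\<close> and \<open>Hom(U, W)\<close> are dual spaces, so they have equal size,
  but no bijection compatible with the automorphisms is at hand to match extensions with maps one by
  one. What can be compared is the number of fixed points of each commuting pair of automorphisms:
  the two counts differ by the number of \<open>k\<close> by \<open>l\<close> matrices. The group
  acting on extensions exceeds the one acting on triples by this same factor, since it contains the
  shears by a free corner block, and the factors cancel in Burnside's lemma. The class passes
  through every step because an extension lies in it exactly when its sub and its quotient do.
  Extensions are coded as matrices intertwined with the flag by a fixed surjection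
  \<open>Phi\<close>; triples of a given rank, once their map is normalised, have the same shape,
  and this is what closes the recursion. A rank \<open>i\<close> splits the first block
  \<open>l\<close> of the flag into \<open>i\<close> and \<open>l - i\<close>, which is the origin
  of the consecutive differences in \<open>delta\<close>.\<close>

definition norb :: "('x \<Rightarrow> 'x \<Rightarrow> bool) \<Rightarrow> 'x set \<Rightarrow> nat" where
  "norb R X = card ((\<lambda>x. {y \<in> X. R x y}) ` X)"

definition equiv_on :: "'x set \<Rightarrow> ('x \<Rightarrow> 'x \<Rightarrow> bool) \<Rightarrow> bool" where
  "equiv_on X R \<longleftrightarrow> (\<forall>x\<in>X. R x x) \<and> (\<forall>x\<in>X. \<forall>y\<in>X. R x y \<longrightarrow> R y x) \<and>
     (\<forall>x\<in>X. \<forall>y\<in>X. \<forall>z\<in>X. R x y \<longrightarrow> R y z \<longrightarrow> R x z)"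

lemma equiv_onI:
  assumes "\<And>x. x \<in> X \<Longrightarrow> R x x"
    and "\<And>x y. x \<in> X \<Longrightarrow> y \<in> X \<Longrightarrow> R x y \<Longrightarrow> R y x"
    and "\<And>x y z. x \<in> X \<Longrightarrow> y \<in> X \<Longrightarrow> z \<in> X \<Longrightarrow> R x y \<Longrightarrow> R y z \<Longrightarrow> R x z"
  shows "equiv_on X R"
  unfolding equiv_on_def using assms by blast

lemma equiv_onD:
  assumes "equiv_on X R"
  shows "x \<in> X \<Longrightarrow> R x x"
    and "x \<in> X \<Longrightarrow> y \<in> X \<Longrightarrow> R x y \<Longrightarrow> R y x"
    and "x \<in> X \<Longrightarrow> y \<in> X \<Longrightarrow> z \<in> X \<Longrightarrow> R x y \<Longrightarrow> R y z \<Longrightarrow> R x z"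
  using assms unfolding equiv_on_def by blast+

lemma class_eq_iff:
  assumes "equiv_on X R" "x \<in> X" "y \<in> X"
  shows "{z \<in> X. R x z} = {z \<in> X. R y z} \<longleftrightarrow> R x y"
  using equiv_onD[OF assms(1)] assms(2,3) by blast

text \<open>An image is the quotient of the domain by the kernel of the map, so equal kernels give
  equal sizes. This compares sets of classes that live inside different sets.\<close>

lemma card_image_eq_kernel:
  assumes "\<And>x y. x \<in> X \<Longrightarrow> y \<in> X \<Longrightarrow> g x = g y \<longleftrightarrow> h x = h y"
  shows "card (g ` X) = card (h ` X)"
proof -
  define F where "F = (\<lambda>c. h (inv_into X g c))"
  have F: "F (g x) = h x" if "x \<in> X" for x
    using assms[of "inv_into X g (g x)" x] that
    by (simp add: F_def inv_into_into f_inv_into_f)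
  have "inj_on F (g ` X)"
    by (rule inj_onI) (use F assms in auto)
  moreover have "F ` g ` X = h ` X"
    using F by force
  ultimately show ?thesis
    by (metis card_image)
qed

text \<open>\<open>f\<close> need not be a bijection: like an equivalence of groupoids, it preserves
  and reflects the relation and meets every class, and this suffices for a bijection between
  classes.\<close>

lemma norb_transfer:
  assumes S: "equiv_on Y S" and f: "\<And>x. x \<in> X \<Longrightarrow> f x \<in> Y"
    and R: "\<And>x y. x \<in> X \<Longrightarrow> y \<in> X \<Longrightarrow> R x y \<longleftrightarrow> S (f x) (f y)"
    and ex: "\<And>y. y \<in> Y \<Longrightarrow> \<exists>x\<in>X. S (f x) y"
  shows "norb R X = norb S Y"
proof -
  have R': "equiv_on X R"
  proof (rule equiv_onI)
    show "R x x" if "x \<in> X" for x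
      using R[of x x] f[of x] equiv_onD(1)[OF S, of "f x"] that by simp
    show "R y x" if "x \<in> X" "y \<in> X" "R x y" for x y
      using R[of x y] R[of y x] f[of x] f[of y] equiv_onD(2)[OF S, of "f x" "f y"] that by simp
    show "R x z" if "x \<in> X" "y \<in> X" "z \<in> X" "R x y" "R y z" for x y z
      using R[of x y] R[of y z] R[of x z] f[of x] f[of y] f[of z]
        equiv_onD(3)[OF S, of "f x" "f y" "f z"] that by simp
  qed
  have "card ((\<lambda>x. {y \<in> X. R x y}) ` X) = card ((\<lambda>x. {y \<in> Y. S (f x) y}) ` X)"
    by (rule card_image_eq_kernel) (simp add: class_eq_iff[OF R'] class_eq_iff[OF S] f R)
  also have "(\<lambda>x. {y \<in> Y. S (f x) y}) ` X = (\<lambda>x. {y \<in> Y. S x y}) ` Y" (is "?A = ?B")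
  proof
    show "?A \<subseteq> ?B" using f by blast
    show "?B \<subseteq> ?A"
    proof
      fix c assume "c \<in> ?B"
      then obtain y where y: "y \<in> Y" "c = {z \<in> Y. S y z}" by blast
      from ex[OF y(1)] obtain x where "x \<in> X" "S (f x) y" by blast
      then show "c \<in> ?A" using class_eq_iff[OF S f[of x] y(1)] y by auto
    qed
  qed
  finally show ?thesis unfolding norb_def .
qed

lemma norb_cong:
  assumes "\<And>x y. x \<in> X \<Longrightarrow> y \<in> X \<Longrightarrow> R x y \<longleftrightarrow> S x y"
  shows "norb R X = norb S X"
  unfolding norb_def by (intro arg_cong[of _ _ card] image_cong) (use assms in auto)

lemma norb_UN:
  assumes I: "finite I" and fin: "\<And>i. i \<in> I \<Longrightarrow> finite (X i)"
    and reflR: "\<And>i x. i \<in> I \<Longrightarrow> x \<in> X i \<Longrightarrow> R x x"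
    and sep: "\<And>i j x y. i \<in> I \<Longrightarrow> j \<in> I \<Longrightarrow> x \<in> X i \<Longrightarrow> y \<in> X j \<Longrightarrow> R x y \<Longrightarrow> i = j"
  shows "norb R (\<Union>i\<in>I. X i) = (\<Sum>i\<in>I. norb R (X i))"
proof -
  have c: "{y \<in> (\<Union>i\<in>I. X i). R x y} = {y \<in> X i. R x y}" if "i \<in> I" "x \<in> X i" for i x
    using sep that by blast
  have "(\<lambda>x. {y \<in> (\<Union>i\<in>I. X i). R x y}) ` (\<Union>i\<in>I. X i) = (\<Union>i\<in>I. (\<lambda>x. {y \<in> X i. R x y}) ` X i)"
    unfolding image_UN by (intro SUP_cong[OF refl] image_cong) (use c in auto)
  moreover have "card (\<Union>i\<in>I. (\<lambda>x. {y \<in> X i. R x y}) ` X i) = (\<Sum>i\<in>I. norb R (X i))"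
    unfolding norb_def
  proof (rule card_UN_disjoint[OF I])
    show "\<forall>i\<in>I. finite ((\<lambda>x. {y \<in> X i. R x y}) ` X i)" using fin by blast
    show "\<forall>i\<in>I. \<forall>j\<in>I. i \<noteq> j \<longrightarrow>
      (\<lambda>x. {y \<in> X i. R x y}) ` X i \<inter> (\<lambda>x. {y \<in> X j. R x y}) ` X j = {}"
    proof (intro ballI impI equals0I)
      fix i j c assume ij: "i \<in> I" "j \<in> I" "i \<noteq> j"
        and "c \<in> (\<lambda>x. {y \<in> X i. R x y}) ` X i \<inter> (\<lambda>x. {y \<in> X j. R x y}) ` X j"
      then obtain x y where "x \<in> X i" "y \<in> X j" "{z \<in> X i. R x z} = {z \<in> X j. R y z}" by auto
      then show False using reflR[of i x] sep[of j i y x] ij by blast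
    qed
  qed
  ultimately show ?thesis unfolding norb_def by simp
qed

text \<open>A class of the product relation is a rectangle of classes. Reflexivity keeps both sides
  nonempty, so the rectangle determines its sides.\<close>

lemma norb_Times:
  assumes R: "\<And>x. x \<in> X \<Longrightarrow> R x x" and S: "\<And>y. y \<in> Y \<Longrightarrow> S y y"
  shows "norb (\<lambda>(x,y) (x',y'). R x x' \<and> S y y') (X \<times> Y) = norb R X * norb S Y"
proof -
  let ?cR = "\<lambda>x. {x' \<in> X. R x x'}" and ?cS = "\<lambda>y. {y' \<in> Y. S y y'}"
  have cl: "{p \<in> X \<times> Y. (case xy of (x,y) \<Rightarrow> \<lambda>(x',y'). R x x' \<and> S y y') p}
      = ?cR (fst xy) \<times> ?cS (snd xy)" for xy
    by (cases xy) auto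
  have "norb (\<lambda>(x,y) (x',y'). R x x' \<and> S y y') (X \<times> Y) = card ((\<lambda>(c,d). c \<times> d) ` (?cR ` X \<times> ?cS ` Y))"
    unfolding norb_def
  proof (rule arg_cong[of _ _ card])
    have "(\<lambda>xy. ?cR (fst xy) \<times> ?cS (snd xy)) ` (X \<times> Y) = (\<lambda>(c,d). c \<times> d) ` map_prod ?cR ?cS ` (X \<times> Y)"
      unfolding image_image by (rule image_cong) (auto simp only: split_beta fst_map_prod snd_map_prod)
    then show "(\<lambda>xy. {p \<in> X \<times> Y. (case xy of (x,y) \<Rightarrow> \<lambda>(x',y'). R x x' \<and> S y y') p}) ` (X \<times> Y)
        = (\<lambda>(c,d). c \<times> d) ` (?cR ` X \<times> ?cS ` Y)"
      unfolding cl by (simp only: map_prod_surj_on[OF refl refl])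
  qed
  also have "\<dots> = card (?cR ` X \<times> ?cS ` Y)"
  proof (rule card_image, rule inj_onI, clarify)
    fix x y x' y'
    assume *: "x \<in> X" "y \<in> Y" "x' \<in> X" "y' \<in> Y" "?cR x \<times> ?cS y = ?cR x' \<times> ?cS y'"
    have "?cR x \<noteq> {}" "?cS y \<noteq> {}" using R S * by auto
    with iffD1[OF times_eq_iff *(5)] show "?cR x = ?cR x' \<and> ?cS y = ?cS y'" by argo
  qed
  also have "\<dots> = norb R X * norb S Y" by (simp add: norb_def card_cartesian_product)
  finally show ?thesis .
qed

text \<open>A group action is encoded by the ternary relation \<open>act g x y\<close> for \<open>g \<cdot> x = y\<close>, so that
  conjugation \<open>P * A * P\<inverse> = B\<close> can be written without inverses as \<open>P * A = B * P\<close>.\<close>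

locale relational_action =
  fixes G :: "'g set" and X :: "'x set" and act :: "'g \<Rightarrow> 'x \<Rightarrow> 'x \<Rightarrow> bool" and mul :: "'g \<Rightarrow> 'g \<Rightarrow> 'g"
  assumes finG: "finite G" and finX: "finite X"
    and total: "\<And>g x. g \<in> G \<Longrightarrow> x \<in> X \<Longrightarrow> \<exists>y\<in>X. act g x y"
    and unique: "\<And>g x y z. g \<in> G \<Longrightarrow> x \<in> X \<Longrightarrow> y \<in> X \<Longrightarrow> z \<in> X \<Longrightarrow> act g x y \<Longrightarrow> act g x z \<Longrightarrow> y = z"
    and neutral: "\<exists>e\<in>G. \<forall>x\<in>X. act e x x"
    and mul_closed: "\<And>g h. g \<in> G \<Longrightarrow> h \<in> G \<Longrightarrow> mul g h \<in> G"
    and mul_act: "\<And>g h x y z. g \<in> G \<Longrightarrow> h \<in> G \<Longrightarrow> x \<in> X \<Longrightarrow> y \<in> X \<Longrightarrow> z \<in> X \<Longrightarrow>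
        act h x y \<Longrightarrow> act g y z \<Longrightarrow> act (mul g h) x z"
    and cancel: "\<And>g h h'. g \<in> G \<Longrightarrow> h \<in> G \<Longrightarrow> h' \<in> G \<Longrightarrow> mul g h = mul g h' \<Longrightarrow> h = h'"
    and inverse: "\<And>g. g \<in> G \<Longrightarrow> \<exists>h\<in>G. \<forall>x\<in>X. \<forall>y\<in>X. act g x y \<longrightarrow> act h y x"
begin

abbreviation orel :: "'x \<Rightarrow> 'x \<Rightarrow> bool" where "orel x y \<equiv> \<exists>g\<in>G. act g x y"

lemma orel_equiv: "equiv_on X orel"
proof (rule equiv_onI)
  show "orel x x" if "x \<in> X" for x using neutral that by blast
  show "orel y x" if "x \<in> X" "y \<in> X" "orel x y" for x y using inverse that by blast
  show "orel x z" if xyz: "x \<in> X" "y \<in> X" "z \<in> X" and "orel x y" "orel y z" for x y z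
  proof -
    from that obtain h g where "h \<in> G" "act h x y" "g \<in> G" "act g y z" by blast
    then show ?thesis using mul_act[OF _ _ xyz] mul_closed by blast
  qed
qed

text \<open>Left multiplication by an element carrying \<open>y\<close> back to \<open>x\<close>
  injects the transporter into the stabilizer; an element carrying \<open>x\<close> to
  \<open>y\<close> injects the stabilizer into the transporter.\<close>

lemma card_transporter:
  assumes x: "x \<in> X" and y: "y \<in> X" and xy: "orel x y"
  shows "card {g \<in> G. act g x y} = card {g \<in> G. act g x x}"
proof (rule antisym)
  obtain h where h: "h \<in> G" "act h x y" using xy by blast
  obtain h' where h': "h' \<in> G" "act h' y x" using inverse[OF h(1)] h x y by blast
  show "card {g \<in> G. act g x y} \<le> card {g \<in> G. act g x x}"
  proof (rule card_inj_on_le[of "mul h'"])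
    show "inj_on (mul h') {g \<in> G. act g x y}"
      by (rule inj_onI) (use cancel[OF h'(1)] in blast)
    show "mul h' ` {g \<in> G. act g x y} \<subseteq> {g \<in> G. act g x x}"
      using mul_closed[OF h'(1)] mul_act[OF h'(1) _ x y x _ h'(2)] by blast
  qed (use finG in simp)
  show "card {g \<in> G. act g x x} \<le> card {g \<in> G. act g x y}"
  proof (rule card_inj_on_le[of "mul h"])
    show "inj_on (mul h) {g \<in> G. act g x x}"
      by (rule inj_onI) (use cancel[OF h(1)] in blast)
    show "mul h ` {g \<in> G. act g x x} \<subseteq> {g \<in> G. act g x y}"
      using mul_closed[OF h(1)] mul_act[OF h(1) _ x x y _ h(2)] by blast
  qed (use finG in simp)
qed

lemma orbit_stabilizer:
  assumes x: "x \<in> X"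
  shows "card {y \<in> X. orel x y} * card {g \<in> G. act g x x} = card G"
proof -
  have "G = (\<Union>y\<in>{y \<in> X. orel x y}. {g \<in> G. act g x y})"
    using total[OF _ x] by blast
  then have "card G = card (\<Union>y\<in>{y \<in> X. orel x y}. {g \<in> G. act g x y})" by simp
  also have "\<dots> = (\<Sum>y\<in>{y \<in> X. orel x y}. card {g \<in> G. act g x y})"
    by (rule card_UN_disjoint) (use finG finX unique[OF _ x] in auto)
  also have "\<dots> = (\<Sum>y\<in>{y \<in> X. orel x y}. card {g \<in> G. act g x x})"
    by (rule sum.cong) (use card_transporter[OF x] in auto)
  finally show ?thesis by simp
qed

text \<open>Counting fixed pairs by points gives the sum of all stabilizer sizes, and the stabilizer
  sizes along a single orbit add up to \<open>card G\<close>.\<close>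

theorem burnside: "norb orel X * card G = card {(g,x). g \<in> G \<and> x \<in> X \<and> act g x x}"
proof -
  let ?cl = "\<lambda>x. {y \<in> X. orel x y}" and ?st = "\<lambda>x. card {g \<in> G. act g x x}"
  have "{(g,x). g \<in> G \<and> x \<in> X \<and> act g x x} = (\<lambda>(x,g). (g,x)) ` (SIGMA x:X. {g \<in> G. act g x x})"
    by auto
  moreover have "inj_on (\<lambda>(x,g). (g,x)) (SIGMA x:X. {g \<in> G. act g x x})"
    by (auto intro: inj_onI)
  ultimately have "card {(g,x). g \<in> G \<and> x \<in> X \<and> act g x x} = (\<Sum>x\<in>X. ?st x)"
    using finX finG by (simp add: card_image card_SigmaI)
  also have "\<dots> = (\<Sum>c\<in>?cl ` X. \<Sum>x\<in>{x \<in> X. ?cl x = c}. ?st x)"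
    by (rule sum.group[symmetric]) (use finX in auto)
  also have "\<dots> = (\<Sum>c\<in>?cl ` X. card G)"
  proof (rule sum.cong[OF refl])
    fix c assume "c \<in> ?cl ` X"
    then obtain x where x: "x \<in> X" and c: "c = ?cl x" by blast
    have eq: "{y \<in> X. ?cl y = c} = ?cl x"
    proof (rule Collect_cong, rule conj_cong[OF refl])
      fix y assume y: "y \<in> X"
      show "?cl y = c \<longleftrightarrow> orel x y"
        unfolding c class_eq_iff[OF orel_equiv y x]
        using equiv_onD(2)[OF orel_equiv x y] equiv_onD(2)[OF orel_equiv y x] by argo
    qed
    have pos: "card c > 0"
      unfolding c using finX x equiv_onD(1)[OF orel_equiv x] by (auto simp: card_gt_0_iff)
    \<comment> \<open>The stabilizer size is constant on the class \<open>c\<close>; the quotient of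
      natural numbers is exact by \<open>dvd\<close> below.\<close>
    have st: "?st y = card G div card c" if "y \<in> {y \<in> X. ?cl y = c}" for y
    proof -
      have y: "y \<in> X" and yc: "?cl y = c" using that by blast+
      have "card G = card c * ?st y" using orbit_stabilizer[OF y] unfolding yc by simp
      then show ?thesis using pos by simp
    qed
    have dvd: "card c dvd card G" using orbit_stabilizer[OF x] unfolding c[symmetric] by (rule dvdI[OF sym])
    have "(\<Sum>y\<in>{y \<in> X. ?cl y = c}. ?st y) = (\<Sum>y\<in>{y \<in> X. ?cl y = c}. card G div card c)"
      by (rule sum.cong[OF refl st])
    also have "\<dots> = card c * (card G div card c)" unfolding eq c[symmetric] by simp
    also have "\<dots> = card G" using dvd by (rule dvd_mult_div_cancel)
    finally show "(\<Sum>y\<in>{y \<in> X. ?cl y = c}. ?st y) = card G" .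
  qed
  finally show ?thesis by (simp add: norb_def)
qed

end

section \<open>Adjoint linear maps over a finite field\<close>

lemma finite_carrier_mat: "finite (carrier_mat m n :: 'a :: finite mat set)"
proof (rule finite_subset)
  let ?S = "{..<m} \<times> {..<n}"
  show "carrier_mat m n \<subseteq> mat m n ` (?S \<rightarrow>\<^sub>E (UNIV :: 'a set))"
  proof
    fix A :: "'a mat" assume A: "A \<in> carrier_mat m n"
    have "A = mat m n (restrict (($$) A) ?S)" by (rule eq_matI) (use A in auto)
    then show "A \<in> mat m n ` (?S \<rightarrow>\<^sub>E UNIV)" by (rule image_eqI[where f = "mat m n"]) auto
  qed
qed (intro finite_imageI finite_PiE, auto)

text \<open>Carrier sets with explicit operations, so that matrices of a fixed shape and pairs of
  them are both instances. Cancellation makes translations injective.\<close>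

locale finite_space =
  fixes V :: "'v set" and add :: "'v \<Rightarrow> 'v \<Rightarrow> 'v" and scale :: "'a :: {field,finite} \<Rightarrow> 'v \<Rightarrow> 'v"
  assumes finV: "finite V"
    and add_closed: "\<And>x y. x \<in> V \<Longrightarrow> y \<in> V \<Longrightarrow> add x y \<in> V"
    and scale_closed: "\<And>c x. x \<in> V \<Longrightarrow> scale c x \<in> V"
    and add_cancel: "\<And>x y z. x \<in> V \<Longrightarrow> y \<in> V \<Longrightarrow> z \<in> V \<Longrightarrow> add x y = add x z \<Longrightarrow> y = z"
begin

definition functional :: "('v \<Rightarrow> 'a) \<Rightarrow> bool" where
  "functional f \<longleftrightarrow> (\<forall>x\<in>V. \<forall>y\<in>V. f (add x y) = f x + f y) \<and> (\<forall>c. \<forall>x\<in>V. f (scale c x) = c * f x)"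

text \<open>Translation by a vector of value \<open>b - a\<close> injects the level set of
  \<open>a\<close> into that of \<open>b\<close>. So all level sets of a nonzero functional are
  equally large, and there is one for each field element.\<close>

lemma card_zeros:
  assumes f: "functional f" and ne: "\<exists>w\<in>V. f w \<noteq> 0"
  shows "card (UNIV :: 'a set) * card {w \<in> V. f w = 0} = card V"
proof -
  from ne obtain u where u: "u \<in> V" "f u \<noteq> 0" by blast
  define w where "w = (\<lambda>c. scale (c / f u) u)"
  have w: "w c \<in> V" "f (w c) = c" for c
    using u f scale_closed by (auto simp: w_def functional_def)
  have le: "card {x \<in> V. f x = a} \<le> card {x \<in> V. f x = b}" for a b
  proof (rule card_inj_on_le[of "add (w (b - a))"])
    show "inj_on (add (w (b - a))) {x \<in> V. f x = a}"
      by (rule inj_onI) (use add_cancel[OF w(1)] in blast)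
    show "add (w (b - a)) ` {x \<in> V. f x = a} \<subseteq> {x \<in> V. f x = b}"
      using add_closed[OF w(1)] f w by (auto simp: functional_def)
  qed (use finV in simp)
  have eq: "card {x \<in> V. f x = a} = card {x \<in> V. f x = 0}" for a
    using le[of a 0] le[of 0 a] by simp
  have "card V = (\<Sum>a\<in>UNIV. \<Sum>x\<in>{x \<in> V. f x = a}. 1)"
    by (subst sum.group) (use finV in auto)
  also have "\<dots> = (\<Sum>a\<in>(UNIV :: 'a set). card {x \<in> V. f x = 0})"
    unfolding card_eq_sum[symmetric] by (intro sum.cong refl eq)
  finally show ?thesis by simp
qed

lemma card_zeros_if:
  assumes "functional f"
  shows "card (UNIV :: 'a set) * card {w \<in> V. f w = 0} = (if \<forall>w\<in>V. f w = 0 then card (UNIV :: 'a set) * card V else card V)"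
proof (cases "\<forall>w\<in>V. f w = 0")
  case True
  then have "{w \<in> V. f w = 0} = V" by blast
  with True show ?thesis by simp
qed (use card_zeros[OF assms] in auto)

end

lemma two_le_card_field: "2 \<le> card (UNIV :: 'a :: {field,finite} set)"
proof -
  have "card {0, 1 :: 'a} \<le> card (UNIV :: 'a set)" by (rule card_mono) auto
  then show ?thesis by simp
qed

text \<open>Both sides arise from counting the pairs \<open>(v, w)\<close> with \<open>\<beta> v w = 0\<close>.\<close>

lemma card_radicals:
  fixes \<beta> :: "'v \<Rightarrow> 'w \<Rightarrow> 'a :: {field,finite}"
  assumes V: "finite_space V addV (scaleV :: 'a \<Rightarrow> _)" and W: "finite_space W addW (scaleW :: 'a \<Rightarrow> _)"
    and fV: "\<And>w. w \<in> W \<Longrightarrow> finite_space.functional V addV scaleV (\<lambda>v. \<beta> v w)"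
    and fW: "\<And>v. v \<in> V \<Longrightarrow> finite_space.functional W addW scaleW (\<beta> v)"
  shows "card {v \<in> V. \<forall>w\<in>W. \<beta> v w = 0} * card W = card {w \<in> W. \<forall>v\<in>V. \<beta> v w = 0} * card V"
proof -
  interpret V: finite_space V addV scaleV by (rule V)
  interpret W: finite_space W addW scaleW by (rule W)
  let ?q = "card (UNIV :: 'a set)"
  let ?KV = "{v \<in> V. \<forall>w\<in>W. \<beta> v w = 0}" and ?KW = "{w \<in> W. \<forall>v\<in>V. \<beta> v w = 0}"
  have q: "?q = Suc (?q - 1)" "?q - 1 > 0" using two_le_card_field[where 'a = 'a] by auto
  \<comment> \<open>Writing \<open>?q\<close> as \<open>1 + (?q - 1)\<close> separates the
    contribution common to all \<open>x\<close> from the surplus of those in the radical. In both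
    counts below the common part is \<open>card V * card W\<close>, so the surpluses must
    agree.\<close>
  have aux: "(\<Sum>x\<in>X. if P x then ?q * n else n) = card X * n + (?q - 1) * (card {x \<in> X. P x} * n)"
    if "finite X" for X :: "'x set" and P n
  proof -
    have "(\<Sum>x\<in>X. if P x then ?q * n else n) = (\<Sum>x\<in>X. n + (if P x then (?q - 1) * n else 0))"
      by (rule sum.cong) (use q(1) in \<open>auto simp: algebra_simps simp flip: mult_Suc\<close>)
    also have "\<dots> = card X * n + (\<Sum>x\<in>X. if P x then (?q - 1) * n else 0)"
      by (simp add: sum.distrib)
    also have "(\<Sum>x\<in>X. if P x then (?q - 1) * n else 0) = (?q - 1) * (card {x \<in> X. P x} * n)"
      using that by (simp flip: sum.inter_filter)
    finally show ?thesis .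
  qed
  have "?q * card (SIGMA v:V. {w \<in> W. \<beta> v w = 0}) = (\<Sum>v\<in>V. ?q * card {w \<in> W. \<beta> v w = 0})"
    using V.finV W.finV by (simp add: card_SigmaI sum_distrib_left)
  also have "\<dots> = (\<Sum>v\<in>V. if \<forall>w\<in>W. \<beta> v w = 0 then ?q * card W else card W)"
    by (rule sum.cong[OF refl W.card_zeros_if[OF fW]])
  also have "\<dots> = card V * card W + (?q - 1) * (card ?KV * card W)" by (rule aux[OF V.finV])
  finally have 1: "?q * card (SIGMA v:V. {w \<in> W. \<beta> v w = 0}) = card V * card W + (?q - 1) * (card ?KV * card W)" .
  have "?q * card (SIGMA w:W. {v \<in> V. \<beta> v w = 0}) = (\<Sum>w\<in>W. ?q * card {v \<in> V. \<beta> v w = 0})"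
    using V.finV W.finV by (simp add: card_SigmaI sum_distrib_left)
  also have "\<dots> = (\<Sum>w\<in>W. if \<forall>v\<in>V. \<beta> v w = 0 then ?q * card V else card V)"
    by (rule sum.cong[OF refl V.card_zeros_if[OF fV]])
  also have "\<dots> = card W * card V + (?q - 1) * (card ?KW * card V)" by (rule aux[OF W.finV])
  finally have 2: "?q * card (SIGMA w:W. {v \<in> V. \<beta> v w = 0}) = card W * card V + (?q - 1) * (card ?KW * card V)" .
  have "card (SIGMA w:W. {v \<in> V. \<beta> v w = 0}) = card (SIGMA v:V. {w \<in> W. \<beta> v w = 0})"
    by (rule bij_betw_same_card[of prod.swap]) (auto intro!: bij_betwI[of _ _ _ prod.swap])
  with 1 2 have "(?q - 1) * (card ?KV * card W) = (?q - 1) * (card ?KW * card V)" by (simp add: mult.commute)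
  then show ?thesis using q(2) by simp
qed

section \<open>The trace pairing between matrices of transposed shapes\<close>

definition tr :: "'a :: comm_ring_1 mat \<Rightarrow> 'a" where
  "tr A = (\<Sum>i<dim_row A. A $$ (i, i))"

lemma tr_add: "A \<in> carrier_mat n n \<Longrightarrow> B \<in> carrier_mat n n \<Longrightarrow> tr (A + B) = tr A + tr B"
  by (auto simp: tr_def sum.distrib intro!: sum.cong)

lemma tr_minus: "A \<in> carrier_mat n n \<Longrightarrow> B \<in> carrier_mat n n \<Longrightarrow> tr (A - B) = tr A - tr B"
  by (auto simp: tr_def sum_subtractf intro!: sum.cong)

lemma tr_smult: "A \<in> carrier_mat n n \<Longrightarrow> tr (c \<cdot>\<^sub>m A) = c * tr A"
  by (auto simp: tr_def sum_distrib_left intro!: sum.cong)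

lemma tr_mult:
  assumes "A \<in> carrier_mat m n" "B \<in> carrier_mat n m"
  shows "tr (A * B) = (\<Sum>i<m. \<Sum>j<n. A $$ (i,j) * B $$ (j,i))"
  unfolding tr_def
  by (rule sum.cong) (use assms in \<open>auto simp: scalar_prod_def lessThan_atLeast0 intro!: sum.cong\<close>)

lemma tr_mult_commute:
  assumes "A \<in> carrier_mat m n" "B \<in> carrier_mat n m"
  shows "tr (A * B) = tr (B * A)"
  unfolding tr_mult[OF assms] tr_mult[OF assms(2,1)]
  by (subst sum.swap) (simp add: mult.commute)

text \<open>Pairing with the elementary matrix whose 1 stands at \<open>(j, i)\<close> reads off the
  entry \<open>(i, j)\<close>.\<close>

lemma tr_nondegenerate:
  assumes Y: "Y \<in> carrier_mat k l" and z: "\<And>F. F \<in> carrier_mat l k \<Longrightarrow> tr (F * Y) = 0"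
  shows "Y = 0\<^sub>m k l"
proof (rule eq_matI)
  fix i j assume ij: "i < dim_row (0\<^sub>m k l)" "j < dim_col (0\<^sub>m k l)"
  define F :: "'a mat" where "F = mat l k (\<lambda>(a,b). if a = j \<and> b = i then 1 else 0)"
  have F: "F \<in> carrier_mat l k" by (simp add: F_def)
  have "tr (F * Y) = (\<Sum>a<l. \<Sum>b<k. if a = j then (if b = i then Y $$ (b,a) else 0) else 0)"
    unfolding tr_mult[OF F Y] by (intro sum.cong refl) (auto simp: F_def)
  also have "\<dots> = (\<Sum>a<l. if a = j then Y $$ (i,a) else 0)"
    by (rule sum.cong) (use ij in auto)
  also have "\<dots> = Y $$ (i,j)" using ij by simp
  finally show "Y $$ (i,j) = 0\<^sub>m k l $$ (i,j)" using z[OF F] ij by simp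
qed (use Y in auto)

lemma mat_eq_if_minus_zero:
  fixes Y Z :: "'a :: ab_group_add mat"
  assumes "Y \<in> carrier_mat m n" "Z \<in> carrier_mat m n" and z: "Y - Z = 0\<^sub>m m n"
  shows "Y = Z"
proof (rule eq_matI)
  fix i j assume "i < dim_row Z" "j < dim_col Z"
  moreover have "(Y - Z) $$ (i,j) = 0\<^sub>m m n $$ (i,j)" by (simp only: z)
  ultimately show "Y $$ (i,j) = Z $$ (i,j)" using assms(1,2) by simp
qed (use assms in auto)

lemma finite_space_mat: "finite_space (carrier_mat m n :: 'a :: {field,finite} mat set) (+) (\<cdot>\<^sub>m)"
proof
  fix x y z :: "'a mat"
  assume *: "x \<in> carrier_mat m n" "y \<in> carrier_mat m n" "z \<in> carrier_mat m n" "x + y = x + z"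
  show "y = z"
  proof (rule eq_matI)
    fix i j assume "i < dim_row z" "j < dim_col z"
    moreover have "(x + y) $$ (i,j) = (x + z) $$ (i,j)" by (simp only: *(4))
    ultimately show "y $$ (i,j) = z $$ (i,j)" using *(1-3) by simp
  qed (use * in auto)
qed (auto simp: finite_carrier_mat)

lemma finite_space_Times:
  assumes "finite_space V addV (scaleV :: 'a :: {field,finite} \<Rightarrow> _)" "finite_space W addW (scaleW :: 'a \<Rightarrow> _)"
  shows "finite_space (V \<times> W) (\<lambda>(x,y) (x',y'). (addV x x', addW y y')) (\<lambda>c (x,y). (scaleV c x, scaleW c y))"
proof -
  interpret V: finite_space V addV scaleV by (rule assms(1))
  interpret W: finite_space W addW scaleW by (rule assms(2))
  show ?thesis
    by unfold_locales
      (auto simp: V.finV W.finV V.add_closed W.add_closed V.scale_closed W.scale_closed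
        dest: V.add_cancel W.add_cancel)
qed

lemma card_carrier_mat_transpose:
  "card (carrier_mat l k :: 'a mat set) = card (carrier_mat k l :: 'a mat set)"
  by (rule bij_betw_same_card[of transpose_mat]) (auto intro!: bij_betwI[of _ _ _ transpose_mat])

text \<open>The linear maps \<open>(X, B) \<mapsto> Q B + X d - A X - B p\<close> and \<open>F \<mapsto> (F Q - p F, d F - F A)\<close> are adjoint
  with respect to the trace pairing.\<close>

lemma card_adjoint_kernels:
  fixes Q A p d :: "'a :: {field,finite} mat"
  assumes Q: "Q \<in> carrier_mat k k" and A: "A \<in> carrier_mat k k"
    and p: "p \<in> carrier_mat l l" and d: "d \<in> carrier_mat l l"
  shows "card {(X,B). X \<in> carrier_mat k l \<and> B \<in> carrier_mat k l \<and> Q * B + X * d = A * X + B * p}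
    = card (carrier_mat k l :: 'a mat set) * card {F \<in> carrier_mat l k. d * F = F * A \<and> p * F = F * Q}"
proof -
  let ?M = "carrier_mat k l :: 'a mat set" and ?W = "carrier_mat l k :: 'a mat set"
  let ?V = "?M \<times> ?M"
  define L where "L = (\<lambda>(X,B). (Q * B + X * d) - (A * X + B * p))"
  define \<beta> where "\<beta> = (\<lambda>v F. tr (F * L v))"
  have L: "L v \<in> ?M" if "v \<in> ?V" for v
    using that Q A p d by (auto simp: L_def)
  note VW = finite_space_Times[OF finite_space_mat[of k l, where 'a='a] finite_space_mat[of k l, where 'a='a]]
    finite_space_mat[of l k, where 'a='a]
  \<comment> \<open>This identity exhibits the adjoint: cyclicity of the trace brings
    \<open>d\<close> and \<open>p\<close> to the left of \<open>F\<close>, so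
    \<open>F * Q - p * F\<close> is the coefficient of \<open>B\<close> and
    \<open>d * F - F * A\<close> that of \<open>X\<close>.\<close>
  have \<beta>: "\<beta> (X,B) F = tr ((F * Q - p * F) * B) + tr ((d * F - F * A) * X)"
    if "X \<in> ?M" "B \<in> ?M" "F \<in> ?W" for X B F
  proof -
    note c = that Q A p d
    have 1: "tr (F * (Q * B)) = tr ((F * Q) * B)" 
      using c by (subst assoc_mult_mat[of _ l k _ k _ l]) auto
    have 2: "tr (F * (A * X)) = tr ((F * A) * X)" 
      using c by (subst assoc_mult_mat[of _ l k _ k _ l]) auto
    have 3: "tr (F * (X * d)) = tr ((d * F) * X)"
    proof -
      have "tr (F * (X * d)) = tr ((F * X) * d)" using c by (subst assoc_mult_mat[of _ l k _ l _ l]) auto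
      also have "\<dots> = tr (d * (F * X))" using c by (intro tr_mult_commute[of _ l l]) auto
      also have "\<dots> = tr ((d * F) * X)" using c by (subst assoc_mult_mat[of _ l l _ k _ l]) auto
      finally show ?thesis .
    qed
    have 4: "tr (F * (B * p)) = tr ((p * F) * B)"
    proof -
      have "tr (F * (B * p)) = tr ((F * B) * p)" using c by (subst assoc_mult_mat[of _ l k _ l _ l]) auto
      also have "\<dots> = tr (p * (F * B))" using c by (intro tr_mult_commute[of _ l l]) auto
      also have "\<dots> = tr ((p * F) * B)" using c by (subst assoc_mult_mat[of _ l l _ k _ l]) auto
      finally show ?thesis .
    qed
    have "F * L (X,B) = (F * (Q * B) + F * (X * d)) - (F * (A * X) + F * (B * p))"
      unfolding L_def using c
      by (simp add: mult_minus_distrib_mat[of _ l k _ l] mult_add_distrib_mat[of _ l k _ l])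
    then have "\<beta> (X,B) F = tr (F * (Q * B)) + tr (F * (X * d)) - (tr (F * (A * X)) + tr (F * (B * p)))"
      unfolding \<beta>_def using c by (simp add: tr_minus[of _ l] tr_add[of _ l])
    also have "\<dots> = tr ((F * Q - p * F) * B) + tr ((d * F - F * A) * X)"
      unfolding 1 2 3 4 using c
      by (simp add: minus_mult_distrib_mat[of _ l k _ _ l] tr_minus[of _ l])
    finally show ?thesis .
  qed
  have fV: "finite_space.functional ?V (\<lambda>(x,y) (x',y'). (x + x', y + y')) (\<lambda>c (x,y). (c \<cdot>\<^sub>m x, c \<cdot>\<^sub>m y)) (\<lambda>v. \<beta> v F)"
    if F: "F \<in> ?W" for F
  proof -
    have c: "F * Q - p * F \<in> ?W" "d * F - F * A \<in> ?W" using F Q A p d by auto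
    show ?thesis
      unfolding finite_space.functional_def[OF VW(1)]
      using F c
      by (auto simp: \<beta> mult_add_distrib_mat[of _ l k _ l] tr_add[of _ l] mult_smult_distrib[of _ l k _ l]
          tr_smult[of _ l] algebra_simps)
  qed
  have fW: "finite_space.functional ?W (+) (\<cdot>\<^sub>m) (\<beta> v)" if v: "v \<in> ?V" for v
    unfolding finite_space.functional_def[OF VW(2)] \<beta>_def
    using L[OF v] by (auto simp: add_mult_distrib_mat[of _ l k _ _ l] tr_add[of _ l]
        mult_smult_assoc_mat[of _ l k _ l] tr_smult[of _ l])
  have KV: "{v \<in> ?V. \<forall>F\<in>?W. \<beta> v F = 0} = {(X,B). X \<in> ?M \<and> B \<in> ?M \<and> Q * B + X * d = A * X + B * p}"
  proof -
    have "(\<forall>F\<in>?W. \<beta> (X,B) F = 0) \<longleftrightarrow> Q * B + X * d = A * X + B * p" if XB: "X \<in> ?M" "B \<in> ?M" for X B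
    proof
      have c: "Q * B + X * d \<in> ?M" "A * X + B * p \<in> ?M" using XB Q A p d by auto
      assume "\<forall>F\<in>?W. \<beta> (X,B) F = 0"
      then have "L (X,B) = 0\<^sub>m k l" using L XB by (intro tr_nondegenerate) (auto simp: \<beta>_def)
      then have z: "(Q * B + X * d) - (A * X + B * p) = 0\<^sub>m k l" by (simp add: L_def)
      show "Q * B + X * d = A * X + B * p" by (rule mat_eq_if_minus_zero[OF c z])
    next
      assume "Q * B + X * d = A * X + B * p"
      then have "L (X,B) = 0\<^sub>m k l" using XB A p by (auto simp: L_def)
      then show "\<forall>F\<in>?W. \<beta> (X,B) F = 0" by (auto simp: \<beta>_def tr_def)
    qed
    then show ?thesis by auto
  qed
  have KW: "{F \<in> ?W. \<forall>v\<in>?V. \<beta> v F = 0} = {F \<in> ?W. d * F = F * A \<and> p * F = F * Q}"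
  proof (rule Collect_cong, rule conj_cong[OF refl])
    fix F assume F: "F \<in> ?W"
    have c: "F * Q - p * F \<in> ?W" "d * F - F * A \<in> ?W" "F * Q \<in> ?W" "p * F \<in> ?W" "d * F \<in> ?W" "F * A \<in> ?W"
      using F Q A p d by auto
    have eqI: "Y = Z" if YZ: "Y \<in> ?W" "Z \<in> ?W" and 0: "\<And>X. X \<in> ?M \<Longrightarrow> tr ((Y - Z) * X) = 0" for Y Z
    proof -
      have "Y - Z = 0\<^sub>m l k"
      proof (rule tr_nondegenerate)
        show "tr (X * (Y - Z)) = 0" if "X \<in> ?M" for X
          using 0[OF that] that YZ by (subst tr_mult_commute[of _ k l]) auto
      qed (use YZ in auto)
      then show ?thesis by (rule mat_eq_if_minus_zero[OF YZ])
    qed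
    show "(\<forall>v\<in>?V. \<beta> v F = 0) \<longleftrightarrow> d * F = F * A \<and> p * F = F * Q"
    proof
      assume 0: "\<forall>v\<in>?V. \<beta> v F = 0"
      have z: "tr ((0\<^sub>m l l) :: 'a mat) = 0" by (simp add: tr_def)
      \<comment> \<open>Evaluating at a pair with one zero component isolates one of the two
        summands.\<close>
      have "tr ((d * F - F * A) * X) = 0" if "X \<in> ?M" for X
        using 0[rule_format, of "(X, 0\<^sub>m k l)"] that F c \<beta>[of X "0\<^sub>m k l" F]
        by (simp add: z right_mult_zero_mat[OF c(1)])
      then have 1: "d * F = F * A" using eqI c by blast
      have "tr ((F * Q - p * F) * B) = 0" if "B \<in> ?M" for B
        using 0[rule_format, of "(0\<^sub>m k l, B)"] that F c \<beta>[of "0\<^sub>m k l" B F]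
        by (simp add: z right_mult_zero_mat[OF c(2)])
      then have "F * Q = p * F" using eqI c by blast
      with 1 show "d * F = F * A \<and> p * F = F * Q" by simp
    next
      assume e: "d * F = F * A \<and> p * F = F * Q"
      have "d * F - F * A = 0\<^sub>m l k" "F * Q - p * F = 0\<^sub>m l k" using e c by auto
      then show "\<forall>v\<in>?V. \<beta> v F = 0"
        using F by (auto simp: \<beta> tr_def)
    qed
  qed
  let ?c = "card ?M"
  have "card {v \<in> ?V. \<forall>F\<in>?W. \<beta> v F = 0} * card ?W = card {F \<in> ?W. \<forall>v\<in>?V. \<beta> v F = 0} * card ?V"
    by (rule card_radicals[OF VW fV fW])
  \<comment> \<open>\<open>?V\<close> has \<open>?c * ?c\<close> elements and \<open>?W\<close> has
    \<open>?c\<close>, so after cancelling one factor \<open>?c\<close> survives on the side of the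
    intertwiners.\<close>
  then have "card {v \<in> ?V. \<forall>F\<in>?W. \<beta> v F = 0} * ?c = (?c * card {F \<in> ?W. \<forall>v\<in>?V. \<beta> v F = 0}) * ?c"
    unfolding card_carrier_mat_transpose[of l k] card_cartesian_product by (simp add: ac_simps)
  moreover have "?c > 0"
    using finite_carrier_mat[of k l, where 'a='a] zero_carrier_mat[of k l] by (metis card_gt_0_iff empty_iff)
  ultimately have "card {v \<in> ?V. \<forall>F\<in>?W. \<beta> v F = 0} = ?c * card {F \<in> ?W. \<forall>v\<in>?V. \<beta> v F = 0}" by simp
  then show ?thesis unfolding KV KW .
qed

section \<open>Block upper triangular matrices\<close>

definition GL :: "nat \<Rightarrow> 'a :: field mat set" where
  "GL n = {P \<in> carrier_mat n n. invertible_mat P}"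

lemma GL_carrier: "P \<in> GL n \<Longrightarrow> P \<in> carrier_mat n n"
  by (simp add: GL_def)

lemma GL_I:
  assumes "P \<in> carrier_mat n n" "P' \<in> carrier_mat n n" "P * P' = 1\<^sub>m n"
  shows "P \<in> GL n"
  using assms mat_mult_left_right_inverse[OF assms]
  unfolding GL_def invertible_mat_def inverts_mat_def by auto

lemma GL_det: "P \<in> GL n \<longleftrightarrow> P \<in> carrier_mat n n \<and> det P \<noteq> 0"
proof
  assume "P \<in> GL n"
  then obtain B where P: "P \<in> carrier_mat n n" and 1: "P * B = 1\<^sub>m n" and 2: "B * P = 1\<^sub>m (dim_row B)"
    unfolding GL_def invertible_mat_def inverts_mat_def by auto
  have B: "B \<in> carrier_mat n n"
    using arg_cong[OF 1, of dim_col] arg_cong[OF 2, of dim_col] P by auto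
  have "det P * det B = 1" using det_mult[OF P B] unfolding 1 by simp
  with P show "P \<in> carrier_mat n n \<and> det P \<noteq> 0" by auto
next
  assume "P \<in> carrier_mat n n \<and> det P \<noteq> 0"
  then obtain B where "P \<in> carrier_mat n n" "B \<in> carrier_mat n n" "P * B = 1\<^sub>m n"
    using det_non_zero_imp_unit[of P n "()"] unfolding Units_def ring_mat_simps by blast
  then show "P \<in> GL n" by (rule GL_I)
qed

lemma GL_inverse:
  assumes "P \<in> GL n"
  shows "\<exists>P'\<in>GL n. P * P' = 1\<^sub>m n \<and> P' * P = 1\<^sub>m n"
proof -
  from assms obtain B where P: "P \<in> carrier_mat n n" and B: "B \<in> carrier_mat n n" "P * B = 1\<^sub>m n" "B * P = 1\<^sub>m n"
    using det_non_zero_imp_unit[of P n "()"] unfolding Units_def ring_mat_simps GL_det by blast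
  with GL_I[OF B(1) P B(3)] show ?thesis by blast
qed

lemma GL_one: "1\<^sub>m n \<in> GL n"
  by (rule GL_I[of _ _ "1\<^sub>m n"]) auto

lemma GL_mult: "P \<in> GL n \<Longrightarrow> Q \<in> GL n \<Longrightarrow> P * Q \<in> GL n"
  unfolding GL_det using det_mult[of P n Q] by auto

lemma GL_cancel:
  assumes "P \<in> GL n" "A \<in> carrier_mat n m" "B \<in> carrier_mat n m" "P * A = P * B"
  shows "A = B"
proof -
  from GL_inverse[OF assms(1)] obtain P' where P': "P' \<in> carrier_mat n n" "P' * P = 1\<^sub>m n"
    using GL_carrier by blast
  have "P' * (P * A) = P' * (P * B)" by (simp only: assms(4))
  then show ?thesis using P' GL_carrier[OF assms(1)] assms(2,3)
    by (simp flip: assoc_mult_mat[of _ n n _ n _ m])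
qed

lemma finite_GL: "finite (GL n :: 'a :: {field,finite} mat set)"
  by (rule finite_subset[OF _ finite_carrier_mat[of n n]]) (auto simp: GL_def)

lemma GL_cancel_right:
  assumes "P \<in> GL n" "A \<in> carrier_mat m n" "B \<in> carrier_mat m n" "A * P = B * P"
  shows "A = B"
proof -
  from GL_inverse[OF assms(1)] obtain P' where P': "P' \<in> carrier_mat n n" "P * P' = 1\<^sub>m n"
    using GL_carrier by blast
  have "(A * P) * P' = (B * P) * P'" by (simp only: assms(4))
  then show ?thesis using P' GL_carrier[OF assms(1)] assms(2,3)
    by (simp add: assoc_mult_mat[of _ m n _ n _ n])
qed

text \<open>Pasting of two commuting squares. Conjugations are the case \<open>Q = P\<close>,
  \<open>Q' = P'\<close>, so endomorphisms and maps between different spaces are treated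
  alike.\<close>

lemma intertwine_mult:
  assumes "P \<in> carrier_mat n n" "P' \<in> carrier_mat n n" "Q \<in> carrier_mat m m" "Q' \<in> carrier_mat m m"
    and "X \<in> carrier_mat n m" "Y \<in> carrier_mat n m" "Z \<in> carrier_mat n m"
    and PX: "P * X = Y * Q" and PY: "P' * Y = Z * Q'"
  shows "(P' * P) * X = Z * (Q' * Q)"
proof -
  have "(P' * P) * X = P' * (P * X)" by (rule assoc_mult_mat[OF assms(2,1,5)])
  also have "\<dots> = (P' * Y) * Q" unfolding PX by (rule assoc_mult_mat[OF assms(2,6,3), symmetric])
  also have "\<dots> = Z * (Q' * Q)" unfolding PY by (rule assoc_mult_mat[OF assms(7,4,3)])
  finally show ?thesis .
qed

lemma intertwine_inverse:
  fixes P :: "'a :: semiring_1 mat"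
  assumes "P \<in> carrier_mat n n" "P' \<in> carrier_mat n n" "Q \<in> carrier_mat m m" "Q' \<in> carrier_mat m m"
    and "X \<in> carrier_mat n m" "Y \<in> carrier_mat n m"
    and P: "P' * P = 1\<^sub>m n" and Q: "Q * Q' = 1\<^sub>m m" and PX: "P * X = Y * Q"
  shows "P' * Y = X * Q'"
proof -
  have "P' * Y = P' * (Y * (Q * Q'))" unfolding Q right_mult_one_mat[OF assms(6)] ..
  also have "Y * (Q * Q') = P * X * Q'"
    unfolding PX by (rule assoc_mult_mat[OF assms(6,3,4), symmetric])
  also have "P' * (P * X * Q') = P' * (P * (X * Q'))"
    unfolding assoc_mult_mat[OF assms(1,5,4)] ..
  also have "\<dots> = (P' * P) * (X * Q')"
    by (rule assoc_mult_mat[OF assms(2,1) mult_carrier_mat[OF assms(5,4)], symmetric])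
  also have "\<dots> = X * Q'" unfolding P by (rule left_mult_one_mat[OF mult_carrier_mat[OF assms(5,4)]])
  finally show ?thesis .
qed

section \<open>Stabilizers of flags of coordinate subspaces\<close>

text \<open>Matrices that preserve the span of the first \<open>s\<close> coordinate vectors, for
  the dimensions \<open>s\<close> in \<open>T\<close>. A set of dimensions, unlike a list of block
  sizes, does not see empty blocks, and refining the flag is an \<open>insert\<close>.\<close>

definition flag :: "nat \<Rightarrow> nat set \<Rightarrow> 'a :: field mat set" where
  "flag N T = {D \<in> carrier_mat N N. \<forall>s\<in>T. \<forall>i<N. \<forall>j<s. s \<le> i \<longrightarrow> D $$ (i,j) = 0}"

lemma flag_carrier: "D \<in> flag N T \<Longrightarrow> D \<in> carrier_mat N N"
  by (simp add: flag_def)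

lemma flag_zero: "D \<in> flag N T \<Longrightarrow> s \<in> T \<Longrightarrow> i < N \<Longrightarrow> j < s \<Longrightarrow> s \<le> i \<Longrightarrow> D $$ (i,j) = 0"
  by (simp add: flag_def)

lemma finite_flag: "finite (flag N T :: 'a :: {field,finite} mat set)"
  by (rule finite_subset[OF _ finite_carrier_mat[of N N]]) (auto simp: flag_def)

lemma mat_mult_index_sum:
  assumes "A \<in> carrier_mat m n" "B \<in> carrier_mat n k" "i < m" "j < k"
  shows "(A * B) $$ (i,j) = (\<Sum>c<n. A $$ (i,c) * B $$ (c,j))"
  using assms by (auto simp: scalar_prod_def lessThan_atLeast0 intro!: sum.cong)

lemma flag_mult:
  assumes D: "D \<in> flag N T" and E: "E \<in> flag N T"
  shows "D * E \<in> flag N T"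
  unfolding flag_def
proof (rule CollectI, intro conjI ballI allI impI)
  fix s i j assume *: "s \<in> T" "i < N" "j < s" "s \<le> i"
  have "(D * E) $$ (i,j) = (\<Sum>c<N. D $$ (i,c) * E $$ (c,j))"
    using * by (intro mat_mult_index_sum[OF flag_carrier[OF D] flag_carrier[OF E]]) auto
  also have "\<dots> = 0"
  proof (rule sum.neutral, rule ballI)
    fix c assume "c \<in> {..<N}"
    then show "D $$ (i,c) * E $$ (c,j) = 0"
      using flag_zero[OF D *(1,2), of c] flag_zero[OF E *(1), of c j] * by (cases "c < s") auto
  qed
  finally show "(D * E) $$ (i,j) = 0" .
qed (rule mult_carrier_mat[OF flag_carrier[OF D] flag_carrier[OF E]])

lemma flag_one: "1\<^sub>m N \<in> flag N T"
  by (auto simp: flag_def)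

text \<open>Left multiplication by \<open>P\<close> is an injective map of the finite set
  \<open>flag N T\<close> into itself, hence surjective, so the identity is hit.\<close>

lemma flag_inverse:
  fixes P :: "'a :: {field,finite} mat"
  assumes P: "P \<in> flag N T" "P \<in> GL N"
  shows "\<exists>P'\<in>flag N T \<inter> GL N. P * P' = 1\<^sub>m N \<and> P' * P = 1\<^sub>m N"
proof -
  have "inj_on ((*) P) (flag N T)"
    by (rule inj_onI, rule GL_cancel[OF P(2)]) (auto dest: flag_carrier)
  moreover have "(*) P ` flag N T \<subseteq> flag N T" using flag_mult[OF P(1)] by blast
  ultimately have "(*) P ` flag N T = flag N T"
    by (intro endo_inj_surj finite_flag)
  then obtain P' where P': "P' \<in> flag N T" "P * P' = 1\<^sub>m N"
    using flag_one[of N T] by (metis (no_types, lifting) imageE)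
  have "P' * P = 1\<^sub>m N"
    by (rule mat_mult_left_right_inverse[OF flag_carrier[OF P(1)] flag_carrier[OF P'(1)] P'(2)])
  with P' GL_I[OF flag_carrier[OF P'(1)] flag_carrier[OF P(1)]] show ?thesis by blast
qed

text \<open>When \<open>l\<close> is a dimension of the flag, this is the restriction of the
  endomorphism to the corresponding subspace, and therefore multiplicative.\<close>

definition lead :: "nat \<Rightarrow> 'a mat \<Rightarrow> 'a mat" where
  "lead l D = mat l l (\<lambda>ij. D $$ ij)"

lemma lead_carrier[simp]: "lead l D \<in> carrier_mat l l"
  by (simp add: lead_def)

lemma lead_mult:
  assumes "D \<in> flag N T" "E \<in> flag N T" "l \<in> T" "l \<le> N"
  shows "lead l (D * E) = lead l D * lead l E"
proof (rule eq_matI)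
  fix i j assume "i < dim_row (lead l D * lead l E)" "j < dim_col (lead l D * lead l E)"
  then have ij: "i < l" "j < l" by (auto simp: lead_def)
  have "lead l (D * E) $$ (i,j) = (\<Sum>c<N. D $$ (i,c) * E $$ (c,j))"
    using mat_mult_index_sum[OF flag_carrier[OF assms(1)] flag_carrier[OF assms(2)], of i j] ij assms(4)
    by (simp add: lead_def)
  also have "\<dots> = (\<Sum>c<l. D $$ (i,c) * E $$ (c,j))"
    by (rule sum.mono_neutral_right) (use assms ij flag_zero[OF assms(2,3)] in auto)
  also have "\<dots> = (lead l D * lead l E) $$ (i,j)"
    by (subst mat_mult_index_sum[of _ l l _ l]) (use ij in \<open>auto simp: lead_def\<close>)
  finally show "lead l (D * E) $$ (i,j) = (lead l D * lead l E) $$ (i,j)" .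
qed (auto simp: lead_def)

lemma lead_one: "l \<le> N \<Longrightarrow> lead l (1\<^sub>m N) = 1\<^sub>m l"
  by (rule eq_matI) (auto simp: lead_def)

lemma lead_GL:
  fixes P :: "'a :: {field,finite} mat"
  assumes P: "P \<in> flag N T" "P \<in> GL N" and l: "l \<in> T" "l \<le> N"
  shows "lead l P \<in> GL l"
proof -
  from flag_inverse[OF P] obtain P' where P': "P' \<in> flag N T" "P * P' = 1\<^sub>m N" by blast
  show ?thesis
    by (rule GL_I[of _ _ "lead l P'"])
      (use lead_mult[OF P(1) P'(1) l] P'(2) in \<open>auto simp: lead_one[OF l(2)]\<close>)
qed

lemma flag_lead_block:
  assumes D: "D \<in> flag N T" and l: "l \<in> T" "l \<le> N"
  obtains U V where "U \<in> carrier_mat l (N - l)" "V \<in> carrier_mat (N - l) (N - l)"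
    "D = four_block_mat (lead l D) U (0\<^sub>m (N - l) l) V"
proof
  let ?U = "mat l (N - l) (\<lambda>(i,j). D $$ (i, l + j))"
  let ?V = "mat (N - l) (N - l) (\<lambda>(i,j). D $$ (l + i, l + j))"
  show "D = four_block_mat (lead l D) ?U (0\<^sub>m (N - l) l) ?V"
    by (rule eq_matI) (use flag_carrier[OF D] flag_zero[OF D l(1)] l in \<open>auto simp: lead_def\<close>)
qed auto

section \<open>The class and block triangular matrices\<close>

lemma char_poly_four_block_lower_left_zero:
  fixes A :: "'a :: idom mat"
  assumes A: "A \<in> carrier_mat n n" and B: "B \<in> carrier_mat n m" and D: "D \<in> carrier_mat m m"
  shows "char_poly (four_block_mat A B (0\<^sub>m m n) D) = char_poly A * char_poly D"
proof -
  have "char_poly_matrix (four_block_mat A B (0\<^sub>m m n) D)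
    = four_block_mat (char_poly_matrix A) (map_mat (\<lambda>a. [:- a:]) B) (0\<^sub>m m n) (char_poly_matrix D)"
    by (rule eq_matI) (use A B D in \<open>auto simp: char_poly_matrix_def\<close>)
  then show ?thesis
    unfolding char_poly_def
    using A B D by (simp add: det_four_block_mat_lower_left_zero[of _ n _ m])
qed

text \<open>The characteristic polynomial is the product of those of the diagonal blocks, and
  irreducible polynomials over a field are prime, so each irreducible factor comes from one of the
  blocks.\<close>

lemma in_class_four_block:
  assumes A: "A \<in> carrier_mat n n" and B: "B \<in> carrier_mat n m" and D: "D \<in> carrier_mat m m"
  shows "in_class S (four_block_mat A B (0\<^sub>m m n) D) \<longleftrightarrow> in_class S A \<and> in_class S D"
proof -
  have "p dvd char_poly A * char_poly D \<longleftrightarrow> p dvd char_poly A \<or> p dvd char_poly D" if "irreducible p" for p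
    using prime_elem_dvd_mult_iff[OF field_poly_irreducible_imp_prime[OF that]] .
  then show ?thesis
    unfolding in_class_def char_poly_four_block_lower_left_zero[OF assms] by blast
qed

lemma in_class_lead:
  assumes "D \<in> flag N T" "l \<in> T" "l \<le> N" "in_class S D"
  shows "in_class S (lead l D)"
  using flag_lead_block[OF assms(1-3)] assms(4) in_class_four_block lead_carrier by metis

lemma in_class_conj:
  assumes P: "P \<in> GL n" and D: "D \<in> carrier_mat n n" "D' \<in> carrier_mat n n" and eq: "P * D = D' * P"
  shows "in_class S D \<longleftrightarrow> in_class S D'"
proof -
  from GL_inverse[OF P] obtain P' where P': "P' \<in> carrier_mat n n" "P * P' = 1\<^sub>m n" "P' * P = 1\<^sub>m n"
    using GL_carrier by blast
  have "D' = D' * (P * P')" using D P' by simp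
  also have "\<dots> = P * D * P'" unfolding eq using D P' GL_carrier[OF P] by (simp add: assoc_mult_mat[of _ n n _ n _ n])
  finally have "similar_mat D' D"
    by (intro similar_matI[of _ _ P P' n]) (use D P' GL_carrier[OF P] in auto)
  from char_poly_similar[OF this] show ?thesis unfolding in_class_def by simp
qed

section \<open>From block indices to flags\<close>

text \<open>\<open>blk\<close> counts the blocks that end at or before an index. For two indices
  these sets of blocks are nested, so comparing the counts amounts to finding a block that ends
  between the indices.\<close>

lemma card_less_iff_nested:
  assumes "finite A" "finite B" "A \<subseteq> B \<or> B \<subseteq> A"
  shows "card A < card B \<longleftrightarrow> (\<exists>b\<in>B. b \<notin> A)"
  using assms by (metis card_mono linorder_not_less psubsetI psubset_card_mono subset_iff)

definition prefix_sums :: "nat list \<Rightarrow> nat set" where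
  "prefix_sums ls = (\<lambda>b. sum_list (take b ls)) ` {..length ls}"

lemma prefix_sums_Nil [simp]: "prefix_sums [] = {0}"
  by (simp add: prefix_sums_def)

lemma prefix_sums_Cons [simp]: "prefix_sums (l # ls) = insert 0 ((+) l ` prefix_sums ls)"
proof -
  have "{..length (l # ls)} = insert 0 (Suc ` {..length ls})"
    by (simp add: atMost_Suc_eq_insert_0)
  then show ?thesis by (auto simp: prefix_sums_def image_image)
qed

lemma blk_less_iff: "blk ls j < blk ls i \<longleftrightarrow> (\<exists>s\<in>prefix_sums ls. j < s \<and> s \<le> i)"
proof -
  let ?B = "\<lambda>i. {b. b < length ls \<and> sum_list (take (Suc b) ls) \<le> i}"
  have "?B j \<subseteq> ?B i \<or> ?B i \<subseteq> ?B j"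
    by (rule disjE[OF linear[of i j]]) auto
  then have "blk ls j < blk ls i \<longleftrightarrow> (\<exists>b\<in>?B i. b \<notin> ?B j)"
    unfolding blk_def by (intro card_less_iff_nested) auto
  also have "\<dots> \<longleftrightarrow> (\<exists>b<length ls. j < sum_list (take (Suc b) ls) \<and> sum_list (take (Suc b) ls) \<le> i)"
    by auto
  also have "\<dots> \<longleftrightarrow> (\<exists>b\<le>length ls. j < sum_list (take b ls) \<and> sum_list (take b ls) \<le> i)" (is "?L \<longleftrightarrow> ?R")
  proof
    assume ?R
    then obtain b where b: "b \<le> length ls" "j < sum_list (take b ls)" "sum_list (take b ls) \<le> i" by blast
    then obtain b' where "b = Suc b'" by (cases b) auto
    with b show ?L by (intro exI[of _ b']) auto
  qed (meson Suc_leI)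
  finally show ?thesis by (auto simp: prefix_sums_def)
qed

lemma Mblk_eq_flag: "Mblk ls = flag (sum_list ls) (prefix_sums ls)"
proof -
  have "(\<forall>i<sum_list ls. \<forall>j<sum_list ls. blk ls j < blk ls i \<longrightarrow> A $$ (i,j) = 0)
    \<longleftrightarrow> (\<forall>s\<in>prefix_sums ls. \<forall>i<sum_list ls. \<forall>j<s. s \<le> i \<longrightarrow> A $$ (i,j) = 0)" for A :: "'a mat"
    unfolding blk_less_iff by (meson less_le_trans less_trans)
  then show ?thesis unfolding Mblk_def flag_def by simp
qed

lemma Pblk_eq_flag: "Pblk ls = flag (sum_list ls) (prefix_sums ls) \<inter> GL (sum_list ls)"
  unfolding Pblk_def Mblk_eq_flag GL_def by (auto dest: flag_carrier)

section \<open>Conjugation of intertwined pairs and triples\<close>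

text \<open>The normal form of a map of rank \<open>i\<close>: it kills the first
  \<open>k - i\<close> coordinates and sends the last \<open>i\<close> ones to the first
  \<open>i\<close>. Kernel and image are both initial coordinate subspaces, so stability of either
  one is a block triangular shape.\<close>

definition Phi :: "nat \<Rightarrow> nat \<Rightarrow> nat \<Rightarrow> 'a :: field mat" where
  "Phi i l k = mat l k (\<lambda>(x,y). if x < i \<and> y = k - i + x then 1 else 0)"

lemma Phi_carrier[simp]: "Phi i l k \<in> carrier_mat l k"
  by (simp add: Phi_def)

lemma Phi_mult_index:
  assumes A: "A \<in> carrier_mat k n" and i: "i \<le> k" and x: "x < l" and y: "y < n"
  shows "(Phi i l k * A) $$ (x,y) = (if x < i then A $$ (k - i + x, y) else 0)"
proof -
  have "(Phi i l k * A) $$ (x,y) = (\<Sum>c<k. if c = k - i + x then (if x < i then A $$ (c,y) else 0) else 0)"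
    unfolding mat_mult_index_sum[OF Phi_carrier A x y]
    by (rule sum.cong[OF refl]) (use x in \<open>simp add: Phi_def\<close>)
  then show ?thesis using i by (auto simp: sum.delta)
qed

lemma mult_Phi_index:
  assumes d: "d \<in> carrier_mat n l" and i: "i \<le> l" "i \<le> k" and x: "x < n" and y: "y < k"
  shows "(d * Phi i l k) $$ (x,y) = (if y < k - i then 0 else d $$ (x, y - (k - i)))"
proof -
  have "(d * Phi i l k) $$ (x,y) = (\<Sum>c<l. if c = y - (k - i) then (if y < k - i then 0 else d $$ (x,c)) else 0)"
    unfolding mat_mult_index_sum[OF d Phi_carrier x y]
    by (rule sum.cong[OF refl]) (use i y in \<open>auto simp: Phi_def\<close>)
  then show ?thesis using i y by (auto simp: sum.delta)
qed

lemma Phi_intertwine_iff: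
  assumes d: "d \<in> carrier_mat l l" and A: "A \<in> carrier_mat k k" and i: "i \<le> l" "i \<le> k"
  shows "d * Phi i l k = Phi i l k * A \<longleftrightarrow>
    (\<forall>x<l. \<forall>y<k. (if y < k - i then 0 else d $$ (x, y - (k - i))) = (if x < i then A $$ (k - i + x, y) else 0))"
proof -
  have "d * Phi i l k = Phi i l k * A \<longleftrightarrow> (\<forall>x<l. \<forall>y<k. (d * Phi i l k) $$ (x,y) = (Phi i l k * A) $$ (x,y))"
    using d A by (auto simp: mat_eq_iff Phi_def simp del: index_mult_mat(1))
  then show ?thesis
    by (simp add: Phi_mult_index[OF A i(2)] mult_Phi_index[OF d i] del: index_mult_mat(1))
qed

text \<open>The algebra of pairs of endomorphisms compatible with the flag and with
  \<open>F\<close>. Its units \<open>upairs\<close> are the acting group, its members in the class,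
  \<open>cpairs\<close>, the set acted on.\<close>

definition ipairs :: "nat \<Rightarrow> nat set \<Rightarrow> nat \<Rightarrow> nat \<Rightarrow> 'a :: field mat \<Rightarrow> ('a mat \<times> 'a mat) set" where
  "ipairs N T l n F = {(D,E). D \<in> flag N T \<and> E \<in> carrier_mat n n \<and> lead l D * F = F * E}"

definition upairs :: "nat \<Rightarrow> nat set \<Rightarrow> nat \<Rightarrow> nat \<Rightarrow> 'a :: field mat \<Rightarrow> ('a mat \<times> 'a mat) set" where
  "upairs N T l n F = ipairs N T l n F \<inter> GL N \<times> GL n"

definition cpairs :: "'a :: field poly set \<Rightarrow> nat \<Rightarrow> nat set \<Rightarrow> nat \<Rightarrow> nat \<Rightarrow> 'a mat \<Rightarrow> ('a mat \<times> 'a mat) set" where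
  "cpairs S N T l n F = ipairs N T l n F \<inter> class_mats S \<times> class_mats S"

definition pair_act :: "'a :: field mat \<times> 'a mat \<Rightarrow> 'a mat \<times> 'a mat \<Rightarrow> 'a mat \<times> 'a mat \<Rightarrow> bool" where
  "pair_act = (\<lambda>(P,R) (D,E) (D',E'). P * D = D' * P \<and> R * E = E' * R)"

lemma pair_act_simp:
  "pair_act (P,R) (D,E) (D',E') \<longleftrightarrow> P * D = D' * P \<and> R * E = E' * R"
  by (simp add: pair_act_def)

definition pair_orbits :: "'a :: field poly set \<Rightarrow> nat \<Rightarrow> nat set \<Rightarrow> nat \<Rightarrow> nat \<Rightarrow> 'a mat \<Rightarrow> nat" where
  "pair_orbits S N T l n F = norb (\<lambda>x y. \<exists>g\<in>upairs N T l n F. pair_act g x y) (cpairs S N T l n F)"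

abbreviation pair_mult :: "'a :: field mat \<times> 'a mat \<Rightarrow> 'a mat \<times> 'a mat \<Rightarrow> 'a mat \<times> 'a mat" where
  "pair_mult \<equiv> \<lambda>(P,R) (P',R'). (P * P', R * R')"

lemma ipairs_mult:
  assumes l: "l \<in> T" "l \<le> N" and F: "F \<in> carrier_mat l n"
    and "(P,R) \<in> ipairs N T l n F" "(P',R') \<in> ipairs N T l n F"
  shows "(P * P', R * R') \<in> ipairs N T l n F"
proof -
  have 1: "P \<in> flag N T" "P' \<in> flag N T" "R \<in> carrier_mat n n" "R' \<in> carrier_mat n n"
    "lead l P * F = F * R" "lead l P' * F = F * R'" using assms(4,5) by (auto simp: ipairs_def)
  have "(lead l P * lead l P') * F = F * (R * R')"
    by (rule intertwine_mult[OF lead_carrier lead_carrier 1(4,3) F F F 1(6,5)])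
  then show ?thesis using 1 flag_mult[OF 1(1,2)] by (simp add: ipairs_def lead_mult[OF 1(1,2) l])
qed

lemma upairs_inverse:
  fixes F :: "'a :: {field,finite} mat"
  assumes l: "l \<in> T" "l \<le> N" and F: "F \<in> carrier_mat l n" and PR: "(P,R) \<in> upairs N T l n F"
  obtains P' R' where "(P',R') \<in> upairs N T l n F"
    "P * P' = 1\<^sub>m N" "P' * P = 1\<^sub>m N" "R * R' = 1\<^sub>m n" "R' * R = 1\<^sub>m n"
proof -
  have 1: "P \<in> flag N T" "P \<in> GL N" "R \<in> GL n" "lead l P * F = F * R"
    using PR by (auto simp: upairs_def ipairs_def)
  from flag_inverse[OF 1(1,2)] obtain P' where P': "P' \<in> flag N T" "P' \<in> GL N" "P * P' = 1\<^sub>m N" "P' * P = 1\<^sub>m N"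
    by blast
  from GL_inverse[OF 1(3)] obtain R' where R': "R' \<in> GL n" "R * R' = 1\<^sub>m n" "R' * R = 1\<^sub>m n" by blast
  have "lead l P' * lead l P = 1\<^sub>m l"
    unfolding lead_mult[OF P'(1) 1(1) l, symmetric] P'(4) by (rule lead_one[OF l(2)])
  from intertwine_inverse[OF lead_carrier lead_carrier GL_carrier[OF 1(3)] GL_carrier[OF R'(1)] F F this R'(2) 1(4)]
  have "(P',R') \<in> upairs N T l n F"
    using P' R' GL_carrier[OF R'(1)] by (simp add: upairs_def ipairs_def)
  with P' R' that show ?thesis by blast
qed

lemma conj_exists:
  fixes P :: "'a :: semiring_1 mat"
  assumes "P \<in> carrier_mat n n" "P' \<in> carrier_mat n n" "D \<in> carrier_mat n n" "P' * P = 1\<^sub>m n"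
  shows "(P * D * P') * P = P * D"
  unfolding assoc_mult_mat[OF mult_carrier_mat[OF assms(1,3)] assms(2,1)] assms(4)
  by (rule right_mult_one_mat[OF mult_carrier_mat[OF assms(1,3)]])

lemma conj_inverse:
  fixes P :: "'a :: semiring_1 mat"
  assumes "P \<in> carrier_mat n n" "P' \<in> carrier_mat n n" "D \<in> carrier_mat n n" "D' \<in> carrier_mat n n"
    "P * P' = 1\<^sub>m n" "P' * P = 1\<^sub>m n" "P * D = D' * P"
  shows "P' * D' = D * P'"
  by (rule intertwine_inverse[OF assms(1,2,1,2,3,4,6,5,7)])

lemma conj_mult:
  fixes P :: "'a :: semiring_0 mat"
  assumes "P \<in> carrier_mat n n" "P' \<in> carrier_mat n n"
    and "D \<in> carrier_mat n n" "D' \<in> carrier_mat n n" "D'' \<in> carrier_mat n n"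
    and "P * D = D' * P" "P' * D' = D'' * P'"
  shows "(P' * P) * D = D'' * (P' * P)"
  by (rule intertwine_mult[OF assms(1,2,1,2,3,4,5,6,7)])

lemma pair_action:
  fixes F :: "'a :: {field,finite} mat"
  assumes l: "l \<in> T" "l \<le> N" and F: "F \<in> carrier_mat l n"
  shows "relational_action (upairs N T l n F) (cpairs S N T l n F) pair_act pair_mult"
proof
  have ip: "ipairs N T l n F \<subseteq> flag N T \<times> carrier_mat n n" by (auto simp: ipairs_def)
  have fin: "finite (ipairs N T l n F)"
    by (rule finite_subset[OF ip]) (intro finite_cartesian_product finite_flag finite_carrier_mat)
  show "finite (upairs N T l n F)" "finite (cpairs S N T l n F)"
    using fin by (simp_all add: upairs_def cpairs_def)
  have ucar: "P \<in> carrier_mat N N" "R \<in> carrier_mat n n" "P \<in> GL N" "R \<in> GL n" "P \<in> flag N T"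
    if "(P,R) \<in> upairs N T l n F" for P R
    using that by (auto simp: upairs_def ipairs_def dest: GL_carrier)
  have ccar: "D \<in> carrier_mat N N" "E \<in> carrier_mat n n" "D \<in> flag N T"
    if "(D,E) \<in> cpairs S N T l n F" for D E
    using that by (auto simp: cpairs_def ipairs_def dest: flag_carrier)
  show "\<exists>e\<in>upairs N T l n F. \<forall>x\<in>cpairs S N T l n F. pair_act e x x"
  proof (rule bexI[of _ "(1\<^sub>m N, 1\<^sub>m n)"])
    show "(1\<^sub>m N, 1\<^sub>m n) \<in> upairs N T l n F"
      using F by (simp add: upairs_def ipairs_def flag_one GL_one lead_one[OF l(2)])
    show "\<forall>x\<in>cpairs S N T l n F. pair_act (1\<^sub>m N, 1\<^sub>m n) x x"
    proof
      fix x assume x: "x \<in> cpairs S N T l n F"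
      obtain D E where xDE: "x = (D,E)" by force
      note c = ccar[OF x[unfolded xDE]]
      show "pair_act (1\<^sub>m N, 1\<^sub>m n) x x"
        using c(1,2) unfolding xDE by (simp add: pair_act_simp)
    qed
  qed
  fix g assume g: "g \<in> upairs N T l n F"
  obtain P R where gPR: "g = (P,R)" by force
  note PR = ucar[OF g[unfolded gPR]]
  from upairs_inverse[OF l F g[unfolded gPR]] obtain P' R' where
    PR': "(P',R') \<in> upairs N T l n F" "P * P' = 1\<^sub>m N" "P' * P = 1\<^sub>m N" "R * R' = 1\<^sub>m n" "R' * R = 1\<^sub>m n" .
  note PR'c = ucar[OF PR'(1)]
  show "\<exists>y\<in>cpairs S N T l n F. pair_act g x y" if x: "x \<in> cpairs S N T l n F" for x
  proof -
    obtain D E where xDE: "x = (D,E)" by force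
    note DE = ccar[OF x[unfolded xDE]]
    have eq: "(P * D * P') * P = P * D" "(R * E * R') * R = R * E"
      using conj_exists PR PR'c PR' DE by blast+
    then have act: "pair_act g x (P * D * P', R * E * R')" by (simp add: pair_act_def gPR xDE)
    \<comment> \<open>The conjugate remains intertwined by \<open>F\<close> because it is a product
      of three members of the algebra.\<close>
    have "(P * D * P', R * E * R') \<in> ipairs N T l n F"
      by (intro ipairs_mult[OF l F]) (use g x PR'(1) in \<open>auto simp: upairs_def cpairs_def gPR xDE\<close>)
    moreover have "in_class S (P * D * P')" "in_class S (R * E * R')"
      using in_class_conj[OF PR(3) DE(1) _ eq(1)[symmetric], of S] in_class_conj[OF PR(4) DE(2) _ eq(2)[symmetric], of S]
        x PR PR'c DE by (auto simp: cpairs_def class_mats_def xDE)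
    ultimately have "(P * D * P', R * E * R') \<in> cpairs S N T l n F"
      by (simp add: cpairs_def class_mats_def)
    with act show ?thesis by blast
  qed
  show "y = z" if x: "x \<in> cpairs S N T l n F" and that: "y \<in> cpairs S N T l n F" "z \<in> cpairs S N T l n F"
      "pair_act g x y" "pair_act g x z" for x y z
  proof -
    obtain D E where xDE: "x = (D,E)" by force
    obtain D1 E1 D2 E2 where yz: "y = (D1,E1)" "z = (D2,E2)" by force
    note c = ccar[OF that(1)[unfolded yz]] ccar[OF that(2)[unfolded yz]]
    have e: "P * D = D1 * P" "P * D = D2 * P" "R * E = E1 * R" "R * E = E2 * R"
      using that(3,4) unfolding yz gPR xDE pair_act_simp by blast+
    show ?thesis unfolding yz
      using GL_cancel_right[OF PR(3) c(1,4) trans[OF e(1)[symmetric] e(2)]]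
        GL_cancel_right[OF PR(4) c(2,5) trans[OF e(3)[symmetric] e(4)]] by simp
  qed
  show "\<exists>h\<in>upairs N T l n F. \<forall>x\<in>cpairs S N T l n F. \<forall>y\<in>cpairs S N T l n F. pair_act g x y \<longrightarrow> pair_act h y x"
  proof (rule bexI[OF _ PR'(1)], intro ballI impI)
    fix x y assume xy: "x \<in> cpairs S N T l n F" "y \<in> cpairs S N T l n F" "pair_act g x y"
    obtain D1 E1 D2 E2 where yz: "x = (D1,E1)" "y = (D2,E2)" by force
    note c = ccar[OF xy(1)[unfolded yz]] ccar[OF xy(2)[unfolded yz]]
    have e: "P * D1 = D2 * P" "R * E1 = E2 * R"
      using xy(3) unfolding yz gPR pair_act_simp by blast+
    show "pair_act (P',R') y x" unfolding yz pair_act_simp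
      using conj_inverse[OF PR(1) PR'c(1) c(1,4) PR'(2,3) e(1)]
        conj_inverse[OF PR(2) PR'c(2) c(2,5) PR'(4,5) e(2)] by blast
  qed
  show "pair_mult g h \<in> upairs N T l n F" if h: "h \<in> upairs N T l n F" for h
    using g h ipairs_mult[OF l F, of P R] GL_mult by (cases h) (auto simp: upairs_def gPR)
  show "pair_act (pair_mult g h) x z"
    if h: "h \<in> upairs N T l n F" and x: "x \<in> cpairs S N T l n F" and
      that: "y \<in> cpairs S N T l n F" "z \<in> cpairs S N T l n F" "pair_act h x y" "pair_act g y z" for h x y z
  proof -
    obtain P2 R2 where hPR: "h = (P2,R2)" by force
    obtain D E where xDE: "x = (D,E)" by force
    note PR2 = ucar[OF h[unfolded hPR]] and DE = ccar[OF x[unfolded xDE]]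
    obtain D1 E1 D2 E2 where yz: "y = (D1,E1)" "z = (D2,E2)" by force
    note c = ccar[OF that(1)[unfolded yz]] ccar[OF that(2)[unfolded yz]]
    have e: "P2 * D = D1 * P2" "P * D1 = D2 * P" "R2 * E = E1 * R2" "R * E1 = E2 * R"
      using that(3,4) unfolding yz gPR hPR xDE pair_act_simp by blast+
    show ?thesis unfolding yz gPR hPR xDE prod.case pair_act_simp
      using conj_mult[OF PR2(1) PR(1) DE(1) c(1,4) e(1,2)]
        conj_mult[OF PR2(2) PR(2) DE(2) c(2,5) e(3,4)] by blast
  qed
  show "h = h'" if h: "h \<in> upairs N T l n F" and that: "h' \<in> upairs N T l n F" "pair_mult g h = pair_mult g h'" for h h'
  proof -
    obtain P2 R2 where hPR: "h = (P2,R2)" by force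
    note PR2 = ucar[OF h[unfolded hPR]]
    obtain P3 R3 where h': "h' = (P3,R3)" by force
    have e: "P * P2 = P * P3" "R * R2 = R * R3" using that(2) by (simp_all add: gPR hPR h')
    note c = ucar[OF that(1)[unfolded h']]
    show ?thesis unfolding hPR h'
      using GL_cancel[OF PR(3) PR2(1) c(1) e(1)] GL_cancel[OF PR(4) PR2(2) c(2) e(2)] by simp
  qed
qed

section \<open>Triples with a varying intertwiner\<close>

definition triples :: "'a :: field poly set \<Rightarrow> nat \<Rightarrow> nat set \<Rightarrow> nat \<Rightarrow> nat \<Rightarrow> ('a mat \<times> 'a mat \<times> 'a mat) set" where
  "triples S N T l k = {(D,A,F). D \<in> flag N T \<and> A \<in> carrier_mat k k \<and> F \<in> carrier_mat l k \<and>
     lead l D * F = F * A \<and> in_class S D \<and> in_class S A}"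

definition triple_act :: "nat \<Rightarrow> 'a :: field mat \<times> 'a mat \<Rightarrow> 'a mat \<times> 'a mat \<times> 'a mat \<Rightarrow> 'a mat \<times> 'a mat \<times> 'a mat \<Rightarrow> bool" where
  "triple_act l = (\<lambda>(P,Q) (D,A,F) (D',A',F'). P * D = D' * P \<and> Q * A = A' * Q \<and> lead l P * F = F' * Q)"

lemma triple_act_simp:
  "triple_act l (P,Q) (D,A,F) (D',A',F') \<longleftrightarrow> P * D = D' * P \<and> Q * A = A' * Q \<and> lead l P * F = F' * Q"
  by (simp add: triple_act_def)

lemma triple_action:
  fixes S :: "'a :: {field,finite} poly set"
  assumes l: "l \<in> T" "l \<le> N"
  shows "relational_action ((flag N T \<inter> GL N) \<times> GL k) (triples S N T l k) (triple_act l) pair_mult"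
proof
  let ?G = "(flag N T \<inter> GL N) \<times> GL k :: ('a mat \<times> 'a mat) set" and ?X = "triples S N T l k"
  show "finite ?G" by (simp add: finite_flag finite_GL)
  have "?X \<subseteq> flag N T \<times> carrier_mat k k \<times> carrier_mat l k" by (auto simp: triples_def)
  then show "finite ?X"
    by (rule finite_subset) (intro finite_cartesian_product finite_flag finite_carrier_mat)
  have ccar: "D \<in> carrier_mat N N" "A \<in> carrier_mat k k" "F \<in> carrier_mat l k" "D \<in> flag N T"
      "lead l D * F = F * A" "in_class S D" "in_class S A"
    if "(D,A,F) \<in> ?X" for D A F
    using that by (auto simp: triples_def dest: flag_carrier)
  show "\<exists>e\<in>?G. \<forall>x\<in>?X. triple_act l e x x"
  proof (rule bexI[of _ "(1\<^sub>m N, 1\<^sub>m k)"])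
    show "(1\<^sub>m N, 1\<^sub>m k) \<in> ?G" by (simp add: flag_one GL_one)
    show "\<forall>x\<in>?X. triple_act l (1\<^sub>m N, 1\<^sub>m k) x x"
    proof
      fix x assume x: "x \<in> ?X"
      obtain D A F where xD: "x = (D,A,F)" by (cases x) auto
      note c = ccar[OF x[unfolded xD]]
      show "triple_act l (1\<^sub>m N, 1\<^sub>m k) x x"
        using c(1-3) unfolding xD by (simp add: triple_act_simp lead_one[OF l(2)])
    qed
  qed
  fix g assume g: "g \<in> ?G"
  obtain P Q where gPQ: "g = (P,Q)" by force
  have PQ: "P \<in> carrier_mat N N" "Q \<in> carrier_mat k k" "P \<in> GL N" "Q \<in> GL k" "P \<in> flag N T"
    using g GL_carrier by (auto simp: gPQ)
  from flag_inverse[OF PQ(5,3)] obtain P' where P': "P' \<in> flag N T" "P' \<in> GL N" "P * P' = 1\<^sub>m N" "P' * P = 1\<^sub>m N"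
    by blast
  from GL_inverse[OF PQ(4)] obtain Q' where Q': "Q' \<in> GL k" "Q * Q' = 1\<^sub>m k" "Q' * Q = 1\<^sub>m k" by blast
  note c' = GL_carrier[OF P'(2)] GL_carrier[OF Q'(1)]
  have lP: "lead l P' * lead l P = 1\<^sub>m l" 
    unfolding lead_mult[OF P'(1) PQ(5) l, symmetric] P'(4) by (rule lead_one[OF l(2)])
  show "\<exists>y\<in>?X. triple_act l g x y" if x: "x \<in> ?X" for x
  proof -
    obtain D A F where xD: "x = (D,A,F)" by (cases x) auto
    note DA = ccar[OF x[unfolded xD]]
    let ?D = "P * D * P'" and ?A = "Q * A * Q'" and ?F = "lead l P * F * Q'"
    have fl: "?D \<in> flag N T" by (intro flag_mult PQ P' DA)
    have car: "?A \<in> carrier_mat k k" "?F \<in> carrier_mat l k"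
      using PQ DA c' by (auto intro!: mult_carrier_mat)
    have eq: "?D * P = P * D" "?A * Q = Q * A"
      using conj_exists PQ c' P' Q' DA by blast+
    have eqF: "?F * Q = lead l P * F"
      unfolding assoc_mult_mat[OF mult_carrier_mat[OF lead_carrier DA(3)] c'(2) PQ(2)] Q'(3)
      by (rule right_mult_one_mat[OF mult_carrier_mat[OF lead_carrier DA(3)]])
    have act: "triple_act l g x (?D, ?A, ?F)" by (simp add: triple_act_def gPQ xD eq eqF)
    have leq: "lead l ?D * lead l P = lead l P * lead l D"
      unfolding lead_mult[OF fl PQ(5) l, symmetric] lead_mult[OF PQ(5) DA(4) l, symmetric] eq(1) ..
    \<comment> \<open>The relation for the transported triple is checked after multiplication by
      \<open>Q\<close> on the right, where \<open>eq\<close>, \<open>eqF\<close> and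
      \<open>leq\<close> remove all inverses; then \<open>Q\<close> is cancelled.\<close>
    have "(lead l ?D * ?F) * Q = lead l ?D * (lead l P * F)"
      using assoc_mult_mat[OF lead_carrier car(2) PQ(2)] unfolding eqF .
    also have "\<dots> = (lead l P * lead l D) * F"
      using assoc_mult_mat[OF lead_carrier lead_carrier DA(3), of "P * D * P'" P] unfolding leq by (rule sym)
    also have "\<dots> = lead l P * (F * A)"
      using assoc_mult_mat[OF lead_carrier lead_carrier DA(3), of P D] unfolding DA(5) .
    also have "\<dots> = (?F * Q) * A"
      unfolding eqF by (rule assoc_mult_mat[OF lead_carrier DA(3,2), symmetric])
    also have "\<dots> = ?F * (?A * Q)"
      unfolding eq by (rule assoc_mult_mat[OF car(2) PQ(2) DA(2)])
    also have "\<dots> = (?F * ?A) * Q"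
      by (rule assoc_mult_mat[OF car(2,1) PQ(2), symmetric])
    finally have "lead l ?D * ?F = ?F * ?A"
      by (rule GL_cancel_right[OF PQ(4) mult_carrier_mat[OF lead_carrier car(2)] mult_carrier_mat[OF car(2,1)]])
    moreover have "in_class S ?D" "in_class S ?A"
      using in_class_conj[OF PQ(3) DA(1) flag_carrier[OF fl] eq(1)[symmetric], of S]
        in_class_conj[OF PQ(4) DA(2) car(1) eq(2)[symmetric], of S] DA(6,7) by simp_all
    ultimately have "(?D, ?A, ?F) \<in> ?X" using fl car by (simp add: triples_def)
    with act show ?thesis by blast
  qed
  show "y = z" if x: "x \<in> ?X" and that: "y \<in> ?X" "z \<in> ?X" "triple_act l g x y" "triple_act l g x z" for x y z
  proof -
    obtain D A F where xD: "x = (D,A,F)" by (cases x) auto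
    obtain D1 A1 F1 D2 A2 F2 where yz: "y = (D1,A1,F1)" "z = (D2,A2,F2)" by (cases y; cases z) auto
    note c1 = ccar[OF that(1)[unfolded yz]] and c2 = ccar[OF that(2)[unfolded yz]]
    have e: "P * D = D1 * P" "P * D = D2 * P" "Q * A = A1 * Q" "Q * A = A2 * Q"
        "lead l P * F = F1 * Q" "lead l P * F = F2 * Q"
      using that(3,4) unfolding yz gPQ xD triple_act_simp by blast+
    show ?thesis unfolding yz
      using GL_cancel_right[OF PQ(3) c1(1) c2(1) trans[OF e(1)[symmetric] e(2)]]
        GL_cancel_right[OF PQ(4) c1(2) c2(2) trans[OF e(3)[symmetric] e(4)]]
        GL_cancel_right[OF PQ(4) c1(3) c2(3) trans[OF e(5)[symmetric] e(6)]] by simp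
  qed
  show "\<exists>h\<in>?G. \<forall>x\<in>?X. \<forall>y\<in>?X. triple_act l g x y \<longrightarrow> triple_act l h y x"
  proof (rule bexI[of _ "(P',Q')"], intro ballI impI)
    show "(P',Q') \<in> ?G" using P' Q' by simp
    fix x y assume xy: "x \<in> ?X" "y \<in> ?X" "triple_act l g x y"
    obtain D1 A1 F1 D2 A2 F2 where yz: "x = (D1,A1,F1)" "y = (D2,A2,F2)" by (cases x; cases y) auto
    note c1 = ccar[OF xy(1)[unfolded yz]] and c2 = ccar[OF xy(2)[unfolded yz]]
    have e: "P * D1 = D2 * P" "Q * A1 = A2 * Q" "lead l P * F1 = F2 * Q"
      using xy(3) unfolding yz gPQ triple_act_simp by blast+
    show "triple_act l (P',Q') y x" unfolding yz triple_act_simp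
      using conj_inverse[OF PQ(1) c'(1) c1(1) c2(1) P'(3,4) e(1)]
        conj_inverse[OF PQ(2) c'(2) c1(2) c2(2) Q'(2,3) e(2)]
        intertwine_inverse[OF lead_carrier lead_carrier PQ(2) c'(2) c1(3) c2(3) lP Q'(2) e(3)] by blast
  qed
  show "pair_mult g h \<in> ?G" if h: "h \<in> ?G" for h
    using g h flag_mult[of P N T] GL_mult by (cases h) (auto simp: gPQ)
  show "triple_act l (pair_mult g h) x z"
    if h: "h \<in> ?G" and x: "x \<in> ?X" and that: "y \<in> ?X" "z \<in> ?X" "triple_act l h x y" "triple_act l g y z" for h x y z
  proof -
    obtain P2 Q2 where hPQ: "h = (P2,Q2)" by force
    have PQ2: "P2 \<in> carrier_mat N N" "Q2 \<in> carrier_mat k k" "P2 \<in> GL N" "Q2 \<in> GL k" "P2 \<in> flag N T"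
      using h GL_carrier by (auto simp: hPQ)
    obtain D A F where xD: "x = (D,A,F)" by (cases x) auto
    note DA = ccar[OF x[unfolded xD]]
    obtain D1 A1 F1 D2 A2 F2 where yz: "y = (D1,A1,F1)" "z = (D2,A2,F2)" by (cases y; cases z) auto
    note c1 = ccar[OF that(1)[unfolded yz]] and c2 = ccar[OF that(2)[unfolded yz]]
    have e: "P2 * D = D1 * P2" "P * D1 = D2 * P" "Q2 * A = A1 * Q2" "Q * A1 = A2 * Q"
        "lead l P2 * F = F1 * Q2" "lead l P * F1 = F2 * Q"
      using that(3,4) unfolding yz gPQ hPQ xD triple_act_simp by blast+
    show ?thesis unfolding yz gPQ hPQ xD prod.case triple_act_simp lead_mult[OF PQ(5) PQ2(5) l]
      using conj_mult[OF PQ2(1) PQ(1) DA(1) c1(1) c2(1) e(1,2)]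
        conj_mult[OF PQ2(2) PQ(2) DA(2) c1(2) c2(2) e(3,4)]
        intertwine_mult[OF lead_carrier lead_carrier PQ2(2) PQ(2) DA(3) c1(3) c2(3) e(5,6)] by blast
  qed
  show "h = h'" if h: "h \<in> ?G" and that: "h' \<in> ?G" "pair_mult g h = pair_mult g h'" for h h'
  proof -
    obtain P2 Q2 where hPQ: "h = (P2,Q2)" by force
    have PQ2: "P2 \<in> carrier_mat N N" "Q2 \<in> carrier_mat k k" "P2 \<in> GL N" "Q2 \<in> GL k" "P2 \<in> flag N T"
      using h GL_carrier by (auto simp: hPQ)
    obtain P3 Q3 where h': "h' = (P3,Q3)" by force
    have e: "P * P2 = P * P3" "Q * Q2 = Q * Q3" using that(2) by (simp_all add: gPQ hPQ h')
    have c: "P3 \<in> carrier_mat N N" "Q3 \<in> carrier_mat k k" using that(1) GL_carrier by (auto simp: h')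
    show ?thesis unfolding hPQ h'
      using GL_cancel[OF PQ(3) PQ2(1) c(1) e(1)] GL_cancel[OF PQ(4) PQ2(2) c(2) e(2)] by simp
  qed
qed

section \<open>Extensions versus intertwiners\<close>

lemma lead_dim[simp]: "dim_row (lead l D) = l" "dim_col (lead l D) = l"
  by (simp_all add: lead_def)

definition upper_right :: "nat \<Rightarrow> nat \<Rightarrow> 'a mat \<Rightarrow> 'a mat" where
  "upper_right k l E = mat k l (\<lambda>(i,j). E $$ (i, k + j))"

lemma upper_right_carrier[simp]: "upper_right k l E \<in> carrier_mat k l"
  by (simp add: upper_right_def)

text \<open>An extension: \<open>A\<close> acts on the sub spanned by the first coordinates,
  \<open>d\<close> on the quotient, and \<open>B\<close> is the cocycle gluing them.\<close>

definition upper_block :: "'a :: zero mat \<Rightarrow> 'a mat \<Rightarrow> 'a mat \<Rightarrow> 'a mat" where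
  "upper_block A B d = four_block_mat A B (0\<^sub>m (dim_row d) (dim_col A)) d"

lemma upper_block_carrier[simp]:
  "A \<in> carrier_mat k k \<Longrightarrow> d \<in> carrier_mat l l \<Longrightarrow> upper_block A B d \<in> carrier_mat (k + l) (k + l)"
  by (simp add: upper_block_def)

lemma upper_block_parts:
  assumes "A \<in> carrier_mat k k" "B \<in> carrier_mat k l" "d \<in> carrier_mat l l"
  shows "lead k (upper_block A B d) = A" "upper_right k l (upper_block A B d) = B"
  using assms by (auto simp: upper_block_def lead_def upper_right_def intro!: eq_matI)

lemma upper_block_eq_iff:
  assumes "A \<in> carrier_mat k k" "B \<in> carrier_mat k l" "d \<in> carrier_mat l l"
    and "A' \<in> carrier_mat k k" "B' \<in> carrier_mat k l" "d \<in> carrier_mat l l"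
  shows "upper_block A B d = upper_block A' B' d \<longleftrightarrow> A = A' \<and> B = B'"
  using upper_block_parts[OF assms(1-3)] upper_block_parts[OF assms(4-6)] by metis

lemma upper_block_mult:
  assumes "A \<in> carrier_mat k k" "B \<in> carrier_mat k l" "d \<in> carrier_mat l l"
    and "A' \<in> carrier_mat k k" "B' \<in> carrier_mat k l" "d' \<in> carrier_mat l l"
  shows "upper_block A B d * upper_block A' B' d' = upper_block (A * A') (A * B' + B * d') (d * d')"
proof -
  have "0\<^sub>m l k * A' + d * 0\<^sub>m l k = 0\<^sub>m l k" "0\<^sub>m l k * B' + d * d' = d * d'" "A * A' + B * 0\<^sub>m l k = A * A'"
    using assms by auto
  then show ?thesis
    using mult_four_block_mat[OF assms(1,2) zero_carrier_mat[of l k] assms(3) assms(4,5) zero_carrier_mat[of l k] assms(6)]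
      assms by (simp add: upper_block_def)
qed

text \<open>\<open>Phi l l (k + l)\<close> is the projection to the last \<open>l\<close>
  coordinates, so the relation prescribes the last \<open>l\<close> rows of \<open>E\<close>: zeros,
  then \<open>d\<close>.\<close>

lemma Phi_block_iff:
  assumes E: "E \<in> carrier_mat (k + l) (k + l)" and d: "d \<in> carrier_mat l l"
  shows "d * Phi l l (k + l) = Phi l l (k + l) * E \<longleftrightarrow> E = upper_block (lead k E) (upper_right k l E) d"
proof -
  have "d * Phi l l (k + l) = Phi l l (k + l) * E \<longleftrightarrow>
    (\<forall>x<l. \<forall>y<k + l. (if y < k then 0 else d $$ (x, y - k)) = E $$ (k + x, y))"
    unfolding Phi_intertwine_iff[OF d E le_refl le_add2] by simp
  also have "\<dots> \<longleftrightarrow> E = upper_block (lead k E) (upper_right k l E) d" (is "?L \<longleftrightarrow> E = ?R")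
  proof
    assume L: ?L
    show "E = ?R"
    proof (rule eq_matI)
      fix i j assume "i < dim_row ?R" "j < dim_col ?R"
      then have ij: "i < k + l" "j < k + l" using d by (auto simp: upper_block_def lead_def)
      show "E $$ (i,j) = ?R $$ (i,j)"
        using L[rule_format, of "i - k" j] ij d by (auto simp: upper_block_def lead_def upper_right_def)
    qed (use E d in \<open>auto simp: upper_block_def lead_def\<close>)
  next
    assume e: "E = ?R"
    show ?L
    proof (intro allI impI)
      fix x y assume "x < l" "y < k + l"
      then have "?R $$ (k + x, y) = (if y < k then 0 else d $$ (x, y - k))"
        using d by (auto simp: upper_block_def lead_def upper_right_def)
      then show "(if y < k then 0 else d $$ (x, y - k)) = E $$ (k + x, y)" using e by simp
    qed
  qed
  finally show ?thesis .
qed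

lemma ipairs_Phi_iff:
  "(D,E) \<in> ipairs N T l (k + l) (Phi l l (k + l)) \<longleftrightarrow>
    D \<in> flag N T \<and> (\<exists>A\<in>carrier_mat k k. \<exists>B\<in>carrier_mat k l. E = upper_block A B (lead l D))"
proof
  assume "(D,E) \<in> ipairs N T l (k + l) (Phi l l (k + l))"
  then show "D \<in> flag N T \<and> (\<exists>A\<in>carrier_mat k k. \<exists>B\<in>carrier_mat k l. E = upper_block A B (lead l D))"
    using Phi_block_iff[OF _ lead_carrier, of E k l D] lead_carrier[of k E] upper_right_carrier[of k l E]
    unfolding ipairs_def by blast
next
  assume "D \<in> flag N T \<and> (\<exists>A\<in>carrier_mat k k. \<exists>B\<in>carrier_mat k l. E = upper_block A B (lead l D))"
  then obtain A B where *: "D \<in> flag N T" "A \<in> carrier_mat k k" "B \<in> carrier_mat k l" "E = upper_block A B (lead l D)"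
    by blast
  have "E = upper_block (lead k E) (upper_right k l E) (lead l D)"
    using upper_block_parts[OF *(2,3) lead_carrier[of l D]] *(4) by simp
  moreover have "E \<in> carrier_mat (k + l) (k + l)" using * by simp
  ultimately show "(D,E) \<in> ipairs N T l (k + l) (Phi l l (k + l))"
    using * Phi_block_iff[OF _ lead_carrier, of E k l D] by (simp add: ipairs_def)
qed

text \<open>The block \<open>lead l P\<close> is invertible as soon as \<open>P\<close> is, so
  invertibility of the extended matrix is a condition on \<open>Q\<close> alone.\<close>

lemma upairs_Phi_iff:
  fixes P :: "'a :: {field,finite} mat"
  assumes l: "l \<in> T" "l \<le> N"
  shows "(P,R) \<in> upairs N T l (k + l) (Phi l l (k + l)) \<longleftrightarrow>
    P \<in> flag N T \<inter> GL N \<and> (\<exists>Q\<in>GL k. \<exists>X\<in>carrier_mat k l. R = upper_block Q X (lead l P))"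
proof -
  have "upper_block Q X (lead l P) \<in> GL (k + l) \<longleftrightarrow> Q \<in> GL k"
    if "P \<in> flag N T" "P \<in> GL N" "Q \<in> carrier_mat k k" "X \<in> carrier_mat k l" for Q X
    using lead_GL[OF that(1,2) l] that(3,4)
      det_four_block_mat_lower_left_zero[OF that(3,4) refl lead_carrier[of l P]]
    by (auto simp: GL_det upper_block_def)
  then show ?thesis
    unfolding upairs_def Int_iff mem_Sigma_iff ipairs_Phi_iff by (blast dest: GL_carrier)
qed

lemma cpairs_Phi_iff:
  fixes D :: "'a :: field mat"
  assumes l: "l \<in> T" "l \<le> N"
  shows "(D,E) \<in> cpairs S N T l (k + l) (Phi l l (k + l)) \<longleftrightarrow>
    D \<in> flag N T \<and> in_class S D \<and>
      (\<exists>A\<in>carrier_mat k k. \<exists>B\<in>carrier_mat k l. in_class S A \<and> E = upper_block A B (lead l D))"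
proof -
  have "in_class S (upper_block A B (lead l D)) \<longleftrightarrow> in_class S A"
    if "D \<in> flag N T" "in_class S D" "A \<in> carrier_mat k k" "B \<in> carrier_mat k l" for A B
    using in_class_four_block[OF that(3,4) lead_carrier[of l D], of S] in_class_lead[OF that(1) l that(2)] that(3)
      lead_carrier[of l D] by (auto simp: upper_block_def)
  then show ?thesis
    unfolding cpairs_def Int_iff mem_Sigma_iff ipairs_Phi_iff class_mats_def mem_Collect_eq by blast
qed

text \<open>The corner \<open>X\<close> is free. This accounts for the factor that cancels the one
  in \<open>card_adjoint_kernels\<close>.\<close>

lemma card_upairs_Phi:
  fixes T :: "nat set"
  assumes l: "l \<in> T" "l \<le> N"
  shows "card (upairs N T l (k + l) (Phi l l (k + l)) :: ('a :: {field,finite} mat \<times> 'a mat) set)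
    = card ((flag N T \<inter> GL N) \<times> GL k :: ('a mat \<times> 'a mat) set) * card (carrier_mat k l :: 'a mat set)"
proof -
  let ?G = "(flag N T \<inter> GL N) \<times> GL k :: ('a mat \<times> 'a mat) set"
  let ?f = "\<lambda>((P,Q),X). (P, upper_block Q X (lead l P))"
  have "upairs N T l (k + l) (Phi l l (k + l)) = ?f ` (?G \<times> carrier_mat k l)"
  proof (intro Set.set_eqI iffI)
    fix g :: "'a mat \<times> 'a mat" assume g: "g \<in> upairs N T l (k + l) (Phi l l (k + l))"
    obtain P R where gPR: "g = (P,R)" by force
    from g[unfolded gPR upairs_Phi_iff[OF l]] obtain Q X where
      "P \<in> flag N T \<inter> GL N" "Q \<in> GL k" "X \<in> carrier_mat k l" "R = upper_block Q X (lead l P)" by blast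
    then show "g \<in> ?f ` (?G \<times> carrier_mat k l)" unfolding gPR by (intro image_eqI[of _ _ "((P,Q),X)"]) auto
  next
    fix g :: "'a mat \<times> 'a mat" assume "g \<in> ?f ` (?G \<times> carrier_mat k l)"
    then obtain P Q X where "g = (P, upper_block Q X (lead l P))" "P \<in> flag N T \<inter> GL N" "Q \<in> GL k" "X \<in> carrier_mat k l"
      by auto
    then show "g \<in> upairs N T l (k + l) (Phi l l (k + l))" using upairs_Phi_iff[OF l] by blast
  qed
  moreover have "inj_on ?f (?G \<times> carrier_mat k l)"
  proof (rule inj_onI)
    fix a b assume ab: "a \<in> ?G \<times> carrier_mat k l" "b \<in> ?G \<times> carrier_mat k l" "?f a = ?f b"
    obtain P Q X P' Q' X' where e: "a = ((P,Q),X)" "b = ((P',Q'),X')" by (metis surj_pair)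
    have c: "Q \<in> carrier_mat k k" "X \<in> carrier_mat k l" "Q' \<in> carrier_mat k k" "X' \<in> carrier_mat k l"
      using ab(1,2) unfolding e by (auto dest: GL_carrier)
    have "P = P'" "upper_block Q X (lead l P) = upper_block Q' X' (lead l P)" using ab(3) unfolding e by auto
    then show "a = b" unfolding e using upper_block_eq_iff[OF c(1,2) lead_carrier c(3,4) lead_carrier] by blast
  qed
  ultimately show ?thesis by (simp add: card_image card_cartesian_product)
qed

text \<open>Burnside's lemma on both sides; over a commuting quadruple \<open>(P, Q, D, A)\<close> the two sets of
  fixed points are kernels of adjoint linear maps.\<close>

theorem pair_orbits_eq_triple_orbits:
  fixes S :: "'a :: {field,finite} poly set"
  assumes l: "l \<in> T" "l \<le> N"
  shows "pair_orbits S N T l (k + l) (Phi l l (k + l)) =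
    norb (\<lambda>x y. \<exists>g\<in>(flag N T \<inter> GL N) \<times> GL k. triple_act l g x y) (triples S N T l k)"
proof -
  let ?U = "upairs N T l (k + l) (Phi l l (k + l)) :: ('a mat \<times> 'a mat) set"
  let ?X = "cpairs S N T l (k + l) (Phi l l (k + l))"
  let ?G = "(flag N T \<inter> GL N) \<times> GL k :: ('a mat \<times> 'a mat) set" and ?Y = "triples S N T l k"
  let ?M = "carrier_mat k l :: 'a mat set"
  interpret A: relational_action ?U ?X pair_act pair_mult by (rule pair_action[OF l Phi_carrier])
  interpret B: relational_action ?G ?Y "triple_act l" pair_mult by (rule triple_action[OF l])
  \<comment> \<open>\<open>C\<close> is the commuting data shared by both fixed point counts. Over a
    point of \<open>C\<close>, \<open>K\<close> holds the corners \<open>X\<close>, \<open>B\<close>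
    completing it to a fixed extension and \<open>L\<close> the maps completing it to a fixed
    triple.\<close>
  define C where "C = {((P,Q),(D,A)). (P,Q) \<in> ?G \<and> D \<in> flag N T \<and> A \<in> carrier_mat k k \<and> in_class S D \<and> in_class S A \<and>
    P * D = D * P \<and> Q * A = A * Q}"
  define K where "K = (\<lambda>((P,Q),(D,A)). {(X,B). X \<in> ?M \<and> B \<in> ?M \<and> Q * B + X * lead l D = A * X + B * lead l P})"
  define L where "L = (\<lambda>((P,Q),(D,A)). {F \<in> (carrier_mat l k :: 'a mat set). lead l D * F = F * A \<and> lead l P * F = F * Q})"
  have KL: "card (K c) = card ?M * card (L c)" if "c \<in> C" for c
  proof -
    obtain P Q D A where c: "c = ((P,Q),(D,A))" by (metis surj_pair)
    show ?thesis using that unfolding c C_def K_def L_def prod.case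
      by (intro card_adjoint_kernels) (auto dest: GL_carrier)
  qed
  have "C \<subseteq> ?G \<times> (flag N T \<times> carrier_mat k k)" by (auto simp: C_def)
  then have finC: "finite C" by (rule finite_subset) (simp add: finite_flag finite_GL finite_carrier_mat)
  have "K c \<subseteq> ?M \<times> ?M" for c by (auto simp: K_def)
  then have finK: "finite (K c)" for c by (rule finite_subset) (simp add: finite_carrier_mat)
  have "L c \<subseteq> carrier_mat l k" for c by (auto simp: L_def)
  then have finL: "finite (L c)" for c by (rule finite_subset) (simp add: finite_carrier_mat)
  let ?f = "\<lambda>(((P,Q),(D,A)),(X,B)). ((P, upper_block Q X (lead l P)), (D, upper_block A B (lead l D)))"
  let ?CG = "{(g,x). g \<in> ?U \<and> x \<in> ?X \<and> pair_act g x x}"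
  \<comment> \<open>The lower right blocks commute since \<open>lead\<close> is multiplicative on
    the flag, so beyond \<open>Q * A = A * Q\<close> only the upper right corner imposes a
    condition, and it is linear in \<open>(X, B)\<close>.\<close>
  have comm: "upper_block Q X (lead l P) * upper_block A B (lead l D) = upper_block A B (lead l D) * upper_block Q X (lead l P)
      \<longleftrightarrow> Q * A = A * Q \<and> Q * B + X * lead l D = A * X + B * lead l P"
    if "P \<in> flag N T" "D \<in> flag N T" "P * D = D * P" and c: "Q \<in> carrier_mat k k" "A \<in> carrier_mat k k" "X \<in> ?M" "B \<in> ?M"
    for P Q D A X B
  proof -
    have e: "lead l P * lead l D = lead l D * lead l P"
      using lead_mult[OF that(1,2) l] lead_mult[OF that(2,1) l] that(3) by simp
    show ?thesis
      unfolding upper_block_mult[OF c(1,3) lead_carrier c(2,4) lead_carrier]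
        upper_block_mult[OF c(2,4) lead_carrier c(1,3) lead_carrier] e
      by (rule upper_block_eq_iff) (use c in \<open>auto intro!: mult_carrier_mat add_carrier_mat\<close>)
  qed
  have "?CG = ?f ` (SIGMA c:C. K c)"
  proof (intro Set.set_eqI iffI)
    fix gx assume gx: "gx \<in> ?CG"
    obtain P R D E where e: "gx = ((P,R),(D,E))" by (metis surj_pair)
    from gx have 1: "(P,R) \<in> ?U" "(D,E) \<in> ?X" "P * D = D * P" "R * E = E * R"
      unfolding e by (auto simp: pair_act_simp)
    from 1(1)[unfolded upairs_Phi_iff[OF l]] obtain Q X where
      2: "P \<in> flag N T \<inter> GL N" "Q \<in> GL k" "X \<in> ?M" "R = upper_block Q X (lead l P)" by blast
    from 1(2)[unfolded cpairs_Phi_iff[OF l]] obtain A B where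
      3: "D \<in> flag N T" "in_class S D" "A \<in> carrier_mat k k" "B \<in> ?M" "in_class S A" "E = upper_block A B (lead l D)" by blast
    have 4: "Q * A = A * Q \<and> Q * B + X * lead l D = A * X + B * lead l P"
      using comm[OF _ 3(1) 1(3) GL_carrier[OF 2(2)] 3(3) 2(3) 3(4)] 2(1) 1(4) unfolding 2(4) 3(6) by simp
    show "gx \<in> ?f ` (SIGMA c:C. K c)"
      unfolding e 2(4) 3(6)
      by (rule image_eqI[of _ _ "(((P,Q),(D,A)),(X,B))"]) (use 1(3) 2(1-3) 3(1-5) 4 in \<open>auto simp: C_def K_def\<close>)
  next
    fix gx assume "gx \<in> ?f ` (SIGMA c:C. K c)"
    then obtain P Q D A X B where e: "gx = ((P, upper_block Q X (lead l P)), (D, upper_block A B (lead l D)))"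
      and 1: "P \<in> flag N T \<inter> GL N" "Q \<in> GL k" "D \<in> flag N T" "A \<in> carrier_mat k k" "in_class S D" "in_class S A"
        "P * D = D * P" "Q * A = A * Q" "X \<in> ?M" "B \<in> ?M" "Q * B + X * lead l D = A * X + B * lead l P"
      by (auto simp: C_def K_def)
    have "(P, upper_block Q X (lead l P)) \<in> ?U" using 1 upairs_Phi_iff[OF l] by blast
    moreover have "(D, upper_block A B (lead l D)) \<in> ?X" using 1 cpairs_Phi_iff[OF l] by blast
    moreover have "upper_block Q X (lead l P) * upper_block A B (lead l D) = upper_block A B (lead l D) * upper_block Q X (lead l P)"
      using comm[OF _ 1(3,7) GL_carrier[OF 1(2)] 1(4,9,10)] 1(1,8,11) by blast
    ultimately show "gx \<in> ?CG" unfolding e using 1(7) by (simp add: pair_act_simp)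
  qed
  moreover have "inj_on ?f (SIGMA c:C. K c)"
  proof (rule inj_onI)
    fix a b assume ab: "a \<in> (SIGMA c:C. K c)" "b \<in> (SIGMA c:C. K c)" "?f a = ?f b"
    obtain P Q D A X B where a: "a = (((P,Q),(D,A)),(X,B))" by (metis surj_pair)
    obtain P' Q' D' A' X' B' where b: "b = (((P',Q'),(D',A')),(X',B'))" by (metis surj_pair)
    have c: "Q \<in> carrier_mat k k" "X \<in> ?M" "A \<in> carrier_mat k k" "B \<in> ?M"
      using ab(1) unfolding a by (auto simp: C_def K_def dest: GL_carrier)
    have c': "Q' \<in> carrier_mat k k" "X' \<in> ?M" "A' \<in> carrier_mat k k" "B' \<in> ?M"
      using ab(2) unfolding b by (auto simp: C_def K_def dest: GL_carrier)
    have e: "P = P'" "D = D'" using ab(3) unfolding a b by auto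
    have "upper_block Q X (lead l P) = upper_block Q' X' (lead l P)" "upper_block A B (lead l D) = upper_block A' B' (lead l D)"
      using ab(3) unfolding a b e by auto
    then show "a = b" unfolding a b e[symmetric]
      using upper_block_eq_iff[OF c(1,2) lead_carrier c'(1,2) lead_carrier]
        upper_block_eq_iff[OF c(3,4) lead_carrier c'(3,4) lead_carrier] by blast
  qed
  ultimately have "card ?CG = (\<Sum>c\<in>C. card (K c))"
    using finC finK by (simp add: card_image card_SigmaI)
  also have "\<dots> = card ?M * (\<Sum>c\<in>C. card (L c))"
    by (simp add: KL sum_distrib_left)
  also have "(\<Sum>c\<in>C. card (L c)) = card (SIGMA c:C. L c)"
    using finC finL by (simp add: card_SigmaI)
  also have "\<dots> = card {(g,x). g \<in> ?G \<and> x \<in> ?Y \<and> triple_act l g x x}" (is "_ = card ?CH")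
  proof -
    let ?h = "\<lambda>((g,(D,A)),F). (g,(D,A,F))"
    have "?CH = ?h ` (SIGMA c:C. L c)"
    proof (intro Set.set_eqI iffI)
      fix gx assume gx: "gx \<in> ?CH"
      obtain P Q D A F where e: "gx = ((P,Q),(D,A,F))" by (metis surj_pair)
      show "gx \<in> ?h ` (SIGMA c:C. L c)"
        by (rule image_eqI[of _ _ "(((P,Q),(D,A)),F)"])
          (use gx in \<open>auto simp: e C_def L_def triples_def triple_act_simp\<close>)
    next
      fix gx assume "gx \<in> ?h ` (SIGMA c:C. L c)"
      then show "gx \<in> ?CH" by (auto simp: C_def L_def triples_def triple_act_simp)
    qed
    moreover have "inj_on ?h (SIGMA c:C. L c)" by (auto intro!: inj_onI)
    ultimately show ?thesis by (simp add: card_image)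
  qed
  finally have "norb A.orel ?X * card ?U = card ?M * (norb B.orel ?Y * card ?G)"
    unfolding A.burnside B.burnside .
  then have "norb A.orel ?X * (card ?G * card ?M) = norb B.orel ?Y * (card ?G * card ?M)"
    unfolding card_upairs_Phi[OF l] by (simp add: ac_simps)
  moreover have "card ?G > 0"
    using finite_flag finite_GL B.neutral B.finG by (auto simp: card_gt_0_iff simp del: Times_Int_distrib1)
  moreover have "card ?M > 0"
    using finite_carrier_mat[of k l, where 'a='a] zero_carrier_mat[of k l] by (metis card_gt_0_iff empty_iff)
  ultimately have "norb A.orel ?X = norb B.orel ?Y" by simp
  then show ?thesis unfolding pair_orbits_def .
qed

section \<open>Rank normal form\<close>

definition mat_equiv :: "nat \<Rightarrow> nat \<Rightarrow> 'a :: field mat \<Rightarrow> 'a mat \<Rightarrow> bool" where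
  "mat_equiv l k F F' \<longleftrightarrow> (\<exists>p\<in>GL l. \<exists>Q\<in>GL k. p * F = F' * Q)"

lemma mat_equiv_trans:
  assumes "F \<in> carrier_mat l k" "F' \<in> carrier_mat l k" "F'' \<in> carrier_mat l k"
    and "mat_equiv l k F F'" "mat_equiv l k F' F''"
  shows "mat_equiv l k F F''"
proof -
  from assms(4,5) obtain p Q p' Q' where *: "p \<in> GL l" "Q \<in> GL k" "p * F = F' * Q"
    "p' \<in> GL l" "Q' \<in> GL k" "p' * F' = F'' * Q'" unfolding mat_equiv_def by blast
  have "(p' * p) * F = F'' * (Q' * Q)"
    using * by (intro intertwine_mult[OF _ _ _ _ assms(1-3)]) (auto dest: GL_carrier)
  then show ?thesis unfolding mat_equiv_def using GL_mult * by blast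
qed

lemma mat_equiv_swaprows:
  assumes "F \<in> carrier_mat l k" "a < l" "b < l"
  shows "mat_equiv l k F (swaprows a b F)"
proof -
  have "swaprows_mat l a b \<in> GL l"
    by (rule GL_I[OF _ _ swaprows_mat_inv]) (use assms in auto)
  moreover have "swaprows_mat l a b * F = swaprows a b F * 1\<^sub>m k"
    using assms by (simp add: swaprows_mat[OF assms, symmetric])
  ultimately show ?thesis unfolding mat_equiv_def using GL_one by blast
qed

lemma mat_equiv_swapcols:
  assumes "F \<in> carrier_mat l k" "a < k" "b < k"
  shows "mat_equiv l k F (swapcols a b F)"
proof -
  have "swaprows_mat k a b \<in> GL k"
    by (rule GL_I[OF _ _ swaprows_mat_inv]) (use assms in auto)
  moreover have "1\<^sub>m l * F = swapcols a b F * swaprows_mat k a b"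
    using assms by (simp add: swapcols_mat[OF assms] assoc_mult_mat[of _ l k _ k _ k] swaprows_mat_inv)
  ultimately show ?thesis unfolding mat_equiv_def using GL_one by blast
qed

lemma upper_block_GL:
  assumes "A \<in> GL k" "B \<in> carrier_mat k l" "d \<in> GL l"
  shows "upper_block A B d \<in> GL (k + l)"
  using assms det_four_block_mat_lower_left_zero[OF GL_carrier[OF assms(1)] assms(2) refl GL_carrier[OF assms(3)]]
  by (auto simp: GL_det upper_block_def)

lemma lower_block_GL:
  assumes "A \<in> GL k" "C \<in> carrier_mat l k" "d \<in> GL l"
  shows "four_block_mat A (0\<^sub>m k l) C d \<in> GL (k + l)"
  using assms det_four_block_mat_upper_right_zero[OF GL_carrier[OF assms(1)] refl assms(2) GL_carrier[OF assms(3)]]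
  by (auto simp: GL_det)

definition diag_ones :: "nat \<Rightarrow> nat \<Rightarrow> nat \<Rightarrow> 'a :: field mat" where
  "diag_ones i l k = mat l k (\<lambda>(x,y). if x = y \<and> x < i then 1 else 0)"

lemma diag_ones_carrier[simp]: "diag_ones i l k \<in> carrier_mat l k"
  by (simp add: diag_ones_def)

lemma diag_ones_Suc:
  "diag_ones (Suc i) (1 + l) (1 + k) = four_block_mat (1\<^sub>m 1) (0\<^sub>m 1 k) (0\<^sub>m l 1) (diag_ones i l k)"
  by (rule eq_matI) (auto simp: diag_ones_def)

text \<open>Elimination with a pivot in the corner: subtracting multiples of the first row clears
  the first column and leaves the Schur complement \<open>?M\<close>.\<close>

lemma mat_equiv_pivot:
  assumes F: "F \<in> carrier_mat (1 + l) (1 + k)" and nz: "F $$ (0,0) \<noteq> 0"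
  obtains M where "M \<in> carrier_mat l k"
    "mat_equiv (1 + l) (1 + k) F (four_block_mat (1\<^sub>m 1) (0\<^sub>m 1 k) (0\<^sub>m l 1) M)"
proof -
  obtain x r c M0 where sp: "split_block F 1 1 = (x, r, c, M0)" by (metis surj_pair)
  have car: "x \<in> carrier_mat 1 1" "r \<in> carrier_mat 1 k" "c \<in> carrier_mat l 1" "M0 \<in> carrier_mat l k"
    and F4: "F = four_block_mat x r c M0"
    using split_block[OF sp, of l k] F by auto
  have x00: "x $$ (0,0) = F $$ (0,0)" using car unfolding F4 by auto
  define c' where "c' = (- inverse (x $$ (0,0))) \<cdot>\<^sub>m c"
  have c': "c' \<in> carrier_mat l 1" using car by (simp add: c'_def)
  have z: "c' * x + c = 0\<^sub>m l 1"
  proof (rule eq_matI)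
    fix i j assume ij: "i < dim_row (0\<^sub>m l 1 :: 'a mat)" "j < dim_col (0\<^sub>m l 1 :: 'a mat)"
    then have "(c' * x) $$ (i,j) = c' $$ (i,0) * x $$ (0,0)"
      using mat_mult_index_sum[OF c' car(1), of i j] by simp
    then show "(c' * x + c) $$ (i,j) = 0\<^sub>m l 1 $$ (i,j)"
      using ij car c' nz x00 by (simp add: c'_def del: index_mult_mat(1))
  qed (use car c' in auto)
  let ?M = "c' * r + M0"
  let ?p = "four_block_mat (1\<^sub>m 1) (0\<^sub>m 1 l) c' (1\<^sub>m l)"
  let ?D = "four_block_mat (1\<^sub>m 1) (0\<^sub>m 1 k) (0\<^sub>m l 1) ?M"
  have M: "?M \<in> carrier_mat l k" using c' car by auto
  have "?p * F = four_block_mat x r (0\<^sub>m l 1) ?M"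
  proof -
    have "1\<^sub>m 1 * x + 0\<^sub>m 1 l * c = x" "1\<^sub>m 1 * r + 0\<^sub>m 1 l * M0 = r"
      "c' * x + 1\<^sub>m l * c = 0\<^sub>m l 1" "c' * r + 1\<^sub>m l * M0 = ?M"
      using car c' z by simp_all
    then show ?thesis
      unfolding F4 mult_four_block_mat[OF one_carrier_mat zero_carrier_mat c' one_carrier_mat car] by (simp only:)
  qed
  \<comment> \<open>The pivot and the rest of its row are split off as an invertible right factor,
    which replaces the column operations.\<close>
  also have "\<dots> = ?D * upper_block x r (1\<^sub>m k)"
  proof -
    have "1\<^sub>m 1 * x + 0\<^sub>m 1 k * 0\<^sub>m k 1 = x" "1\<^sub>m 1 * r + 0\<^sub>m 1 k * 1\<^sub>m k = r"
      "0\<^sub>m l 1 * x + ?M * 0\<^sub>m k 1 = 0\<^sub>m l 1" "0\<^sub>m l 1 * r + ?M * 1\<^sub>m k = ?M"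
      using car M by simp_all
    moreover have "upper_block x r (1\<^sub>m k) = four_block_mat x r (0\<^sub>m k 1) (1\<^sub>m k)"
      using car(1) by (simp add: upper_block_def)
    ultimately show ?thesis
      by (simp only: mult_four_block_mat[OF one_carrier_mat zero_carrier_mat zero_carrier_mat M
        car(1,2) zero_carrier_mat[of k 1] one_carrier_mat])
  qed
  finally have "?p * F = ?D * upper_block x r (1\<^sub>m k)" .
  moreover have "?p \<in> GL (1 + l)" by (rule lower_block_GL[OF GL_one c' GL_one])
  moreover have "x \<in> GL 1"
    using car(1) nz x00 by (simp add: GL_det det_single)
  then have "upper_block x r (1\<^sub>m k) \<in> GL (1 + k)" by (rule upper_block_GL[OF _ car(2) GL_one])
  ultimately have "mat_equiv (1 + l) (1 + k) F ?D" unfolding mat_equiv_def by blast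
  with M that show ?thesis by blast
qed

lemma mat_equiv_diag_block:
  assumes "M \<in> carrier_mat l k" "M' \<in> carrier_mat l k" "mat_equiv l k M M'"
  shows "mat_equiv (1 + l) (1 + k) (four_block_mat (1\<^sub>m 1) (0\<^sub>m 1 k) (0\<^sub>m l 1) M)
    (four_block_mat (1\<^sub>m 1) (0\<^sub>m 1 k) (0\<^sub>m l 1) M')"
proof -
  from assms(3) obtain p Q where pQ: "p \<in> GL l" "Q \<in> GL k" "p * M = M' * Q" unfolding mat_equiv_def by blast
  have c: "p \<in> carrier_mat l l" "Q \<in> carrier_mat k k" using pQ GL_carrier by auto
  have "four_block_mat (1\<^sub>m 1) (0\<^sub>m 1 l) (0\<^sub>m l 1) p * four_block_mat (1\<^sub>m 1) (0\<^sub>m 1 k) (0\<^sub>m l 1) M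
    = four_block_mat (1\<^sub>m 1) (0\<^sub>m 1 k) (0\<^sub>m l 1) M' * four_block_mat (1\<^sub>m 1) (0\<^sub>m 1 k) (0\<^sub>m k 1) Q"
    using mult_four_block_mat[OF one_carrier_mat zero_carrier_mat zero_carrier_mat c(1)
        one_carrier_mat zero_carrier_mat zero_carrier_mat assms(1)]
      mult_four_block_mat[OF one_carrier_mat zero_carrier_mat zero_carrier_mat assms(2)
        one_carrier_mat zero_carrier_mat zero_carrier_mat c(2)] pQ(3) c assms(1,2) by simp
  moreover have "four_block_mat (1\<^sub>m 1) (0\<^sub>m 1 l) (0\<^sub>m l 1) p \<in> GL (1 + l)"
    by (rule lower_block_GL[OF GL_one _ pQ(1)]) simp
  moreover have "four_block_mat (1\<^sub>m 1) (0\<^sub>m 1 k) (0\<^sub>m k 1) Q \<in> GL (1 + k)"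
    by (rule lower_block_GL[OF GL_one _ pQ(2)]) simp
  ultimately show ?thesis unfolding mat_equiv_def by blast
qed

lemma mat_equiv_diag_ones:
  "F \<in> carrier_mat l k \<Longrightarrow> \<exists>i\<le>min l k. mat_equiv l k F (diag_ones i l k)"
proof (induction l arbitrary: k F)
  case 0
  then have "1\<^sub>m 0 * F = diag_ones 0 0 k * 1\<^sub>m k" by (intro eq_matI) (auto simp: diag_ones_def)
  then show ?case unfolding mat_equiv_def using GL_one by auto
next
  case (Suc l k F)
  show ?case
  proof (cases "F = 0\<^sub>m (Suc l) k")
    case True
    then have "1\<^sub>m (Suc l) * F = diag_ones 0 (Suc l) k * 1\<^sub>m k"
      by (intro eq_matI) (auto simp: diag_ones_def)
    then show ?thesis unfolding mat_equiv_def using GL_one by blast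
  next
    case False
    then obtain a b where ab: "a < Suc l" "b < k" "F $$ (a,b) \<noteq> 0"
      using Suc.prems by (auto simp: mat_eq_iff)
    then obtain k' where k: "k = 1 + k'" by (cases k) auto
    let ?F1 = "swaprows 0 a F" let ?F2 = "swapcols 0 b ?F1"
    have c: "?F1 \<in> carrier_mat (1 + l) (1 + k')" "?F2 \<in> carrier_mat (1 + l) (1 + k')" "F \<in> carrier_mat (1 + l) (1 + k')"
      using Suc.prems k by auto
    have "?F2 $$ (0,0) \<noteq> 0" using ab c k by (auto simp: mat_swaprows_def mat_swapcols_def)
    from mat_equiv_pivot[OF c(2) this] obtain M where M: "M \<in> carrier_mat l k'"
      "mat_equiv (1 + l) (1 + k') ?F2 (four_block_mat (1\<^sub>m 1) (0\<^sub>m 1 k') (0\<^sub>m l 1) M)" .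
    from Suc.IH[OF M(1)] obtain i where i: "i \<le> min l k'" "mat_equiv l k' M (diag_ones i l k')" by blast
    have 1: "mat_equiv (1 + l) (1 + k') F ?F1" "mat_equiv (1 + l) (1 + k') ?F1 ?F2"
      using mat_equiv_swaprows[OF c(3), of 0 a] mat_equiv_swapcols[OF c(1), of 0 b] ab k by auto
    have 2: "mat_equiv (1 + l) (1 + k') (four_block_mat (1\<^sub>m 1) (0\<^sub>m 1 k') (0\<^sub>m l 1) M) (diag_ones (Suc i) (1 + l) (1 + k'))"
      unfolding diag_ones_Suc by (rule mat_equiv_diag_block[OF M(1) diag_ones_carrier i(2)])
    have B: "four_block_mat (1\<^sub>m 1) (0\<^sub>m 1 k') (0\<^sub>m l 1) M \<in> carrier_mat (1 + l) (1 + k')" using M by auto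
    note t = mat_equiv_trans
    have "mat_equiv (1 + l) (1 + k') F (diag_ones (Suc i) (1 + l) (1 + k'))"
      by (rule t[OF c(3) c(1) diag_ones_carrier 1(1) t[OF c(1,2) diag_ones_carrier 1(2)
            t[OF c(2) B diag_ones_carrier M(2) 2]]])
    moreover have "Suc i \<le> min (Suc l) k" using i(1) k by simp
    ultimately show ?thesis unfolding k plus_1_eq_Suc by blast
  qed
qed

text \<open>\<open>diag_ones\<close> suits the induction, which adds one corner entry at a time,
  while \<open>Phi\<close> suits the flags. They differ by the permutation \<open>?Q\<close>, which
  moves the first \<open>i\<close> coordinates to the last positions.\<close>

lemma diag_ones_equiv_Phi:
  assumes i: "i \<le> l" "i \<le> k"
  shows "mat_equiv l k (diag_ones i l k) (Phi i l k)"
proof -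
  let ?Q = "four_block_mat (0\<^sub>m (k - i) i) (1\<^sub>m (k - i)) (1\<^sub>m i) (0\<^sub>m i (k - i)) :: 'a mat"
  let ?Q' = "four_block_mat (0\<^sub>m i (k - i)) (1\<^sub>m i) (1\<^sub>m (k - i)) (0\<^sub>m (k - i) i) :: 'a mat"
  have c: "?Q \<in> carrier_mat k k" "?Q' \<in> carrier_mat k k" 
    using four_block_carrier_mat[OF zero_carrier_mat[of "k - i" i] zero_carrier_mat[of i "k - i"]]
      four_block_carrier_mat[OF zero_carrier_mat[of i "k - i"] zero_carrier_mat[of "k - i" i]] i(2)
    by (simp_all only: le_add_diff_inverse le_add_diff_inverse2)
  have "?Q * ?Q' = four_block_mat (1\<^sub>m (k - i)) (0\<^sub>m (k - i) i) (0\<^sub>m i (k - i)) (1\<^sub>m i)"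
    unfolding mult_four_block_mat[OF zero_carrier_mat one_carrier_mat one_carrier_mat zero_carrier_mat
        zero_carrier_mat one_carrier_mat one_carrier_mat zero_carrier_mat]
    by (rule cong_four_block_mat) simp_all
  also have "\<dots> = 1\<^sub>m k" using i(2) by simp
  finally have "?Q * ?Q' = 1\<^sub>m k" .
  then have "?Q \<in> GL k" by (rule GL_I[OF c])
  moreover have "1\<^sub>m l * diag_ones i l k = Phi i l k * ?Q"
  proof (rule eq_matI)
    fix x y assume "x < dim_row (Phi i l k * ?Q)" "y < dim_col (Phi i l k * ?Q)"
    then have xy: "x < l" "y < k" using i by (auto simp: Phi_def)
    show "(1\<^sub>m l * diag_ones i l k) $$ (x,y) = (Phi i l k * ?Q) $$ (x,y)"
      unfolding Phi_mult_index[OF c(1) i(2) xy] left_mult_one_mat[OF diag_ones_carrier]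
      using xy i by (auto simp: diag_ones_def)
  qed (use i in \<open>auto simp: Phi_def diag_ones_def\<close>)
  ultimately show ?thesis unfolding mat_equiv_def using GL_one by blast
qed

lemma rank_normal_form:
  assumes "F \<in> carrier_mat l k"
  shows "\<exists>i\<le>min l k. mat_equiv l k F (Phi i l k)"
proof -
  from mat_equiv_diag_ones[OF assms] obtain i where i: "i \<le> min l k" "mat_equiv l k F (diag_ones i l k)" by blast
  then have "mat_equiv l k F (Phi i l k)"
    by (intro mat_equiv_trans[OF assms diag_ones_carrier Phi_carrier _ diag_ones_equiv_Phi]) auto
  with i show ?thesis by blast
qed

text \<open>If \<open>i < j\<close>, then \<open>Q\<close> would map the vectors supported on the first \<open>k - i\<close> coordinates
  injectively to those supported on the first \<open>k - j\<close>.\<close>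

lemma Phi_equiv_imp_ge:
  fixes p Q :: "'a :: {field,finite} mat"
  assumes "i \<le> min l k" "j \<le> min l k" and pQ: "p \<in> GL l" "Q \<in> GL k" "p * Phi i l k = Phi j l k * Q"
  shows "j \<le> i"
proof (rule ccontr)
  assume ij: "\<not> j \<le> i"
  note p = GL_carrier[OF pQ(1)] and Q = GL_carrier[OF pQ(2)]
  \<comment> \<open>Column \<open>y < k - i\<close> of \<open>p * Phi i l k\<close> is zero, while
    the first \<open>j\<close> rows of \<open>Phi j l k * Q\<close> are the last \<open>j\<close>
    rows of \<open>Q\<close>.\<close>
  have Q0: "Q $$ (a,y) = 0" if "k - j \<le> a" "a < k" "y < k - i" for a y
  proof -
    define x where "x = a - (k - j)"
    have x: "x < j" "a = k - j + x" "x < l" "y < k" using that assms(1,2) by (auto simp: x_def)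
    have "(p * Phi i l k) $$ (x,y) = 0" using mult_Phi_index[OF p, of i k x y] x that assms(1) by simp
    moreover have "(Phi j l k * Q) $$ (x,y) = Q $$ (a,y)" using Phi_mult_index[OF Q, of j x l y] x assms(2) by simp
    ultimately show ?thesis unfolding pQ(3) by simp
  qed
  define W where "W s = {V \<in> carrier_mat k 1 :: 'a mat set. \<forall>a<k. s \<le> a \<longrightarrow> V $$ (a,0) = 0}" for s
  have fin: "finite (W s)" for s unfolding W_def by (simp add: finite_carrier_mat)
  have "(*) Q ` W (k - i) \<subseteq> W (k - j)"
  proof clarify
    fix V assume V: "V \<in> W (k - i)"
    then have Vc: "V \<in> carrier_mat k 1" by (simp add: W_def)
    have "(Q * V) $$ (a,0) = 0" if a: "a < k" "k - j \<le> a" for a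
    proof -
      have "(Q * V) $$ (a,0) = (\<Sum>c<k. Q $$ (a,c) * V $$ (c,0))" by (rule mat_mult_index_sum[OF Q Vc a(1)]) simp
      also have "\<dots> = 0"
      proof (rule sum.neutral, rule ballI)
        fix c assume "c \<in> {..<k}"
        then show "Q $$ (a,c) * V $$ (c,0) = 0" using Q0[OF a(2,1), of c] V by (cases "c < k - i") (auto simp: W_def)
      qed
      finally show ?thesis .
    qed
    then show "Q * V \<in> W (k - j)" using Q Vc by (auto simp: W_def simp del: index_mult_mat(1))
  qed
  moreover have "inj_on ((*) Q) (W (k - i))"
    by (rule inj_onI, rule GL_cancel[OF pQ(2), of _ 1]) (auto simp: W_def)
  ultimately have "card (W (k - i)) \<le> card (W (k - j))"
    using card_inj_on_le fin by blast
  moreover have "W (k - j) \<subset> W (k - i)"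
  proof
    show "W (k - j) \<subseteq> W (k - i)" using ij by (auto simp: W_def)
    have "mat k 1 (\<lambda>(a,_). if a = k - j then 1 else 0) \<in> W (k - i) - W (k - j)"
      using ij assms(1,2) by (auto simp: W_def intro!: exI[of _ "k - j"])
    then show "W (k - j) \<noteq> W (k - i)" by blast
  qed
  ultimately show False using psubset_card_mono[OF fin] by (metis leD)
qed

lemma mat_equiv_sym:
  assumes "F \<in> carrier_mat l k" "F' \<in> carrier_mat l k" "mat_equiv l k F F'"
  shows "mat_equiv l k F' F"
proof -
  from assms(3) obtain p Q where pQ: "p \<in> GL l" "Q \<in> GL k" "p * F = F' * Q" unfolding mat_equiv_def by blast
  from GL_inverse[OF pQ(1)] obtain p' where p': "p' \<in> GL l" "p' * p = 1\<^sub>m l" by blast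
  from GL_inverse[OF pQ(2)] obtain Q' where Q': "Q' \<in> GL k" "Q * Q' = 1\<^sub>m k" by blast
  have "p' * F' = F * Q'"
    by (rule intertwine_inverse[OF _ _ _ _ assms(1,2) p'(2) Q'(2) pQ(3)]) (use pQ p' Q' GL_carrier in auto)
  then show ?thesis unfolding mat_equiv_def using p' Q' by blast
qed

lemma Phi_equiv_unique:
  fixes i :: nat
  assumes "i \<le> min l k" "j \<le> min l k" "mat_equiv l k (Phi i l k :: 'a :: {field,finite} mat) (Phi j l k)"
  shows "i = j"
proof (rule antisym)
  show "j \<le> i" using assms Phi_equiv_imp_ge unfolding mat_equiv_def by blast
  show "i \<le> j" using mat_equiv_sym[OF Phi_carrier Phi_carrier assms(3)] assms(1,2) Phi_equiv_imp_ge
    unfolding mat_equiv_def by blast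
qed

section \<open>Sorting by the rank of the intertwiner\<close>

text \<open>No member of the flag lies strictly between 0 and \<open>l\<close>, so \<open>p\<close>
  extended by the identity preserves all of them. Restriction to the first step thus reaches all of
  \<open>GL l\<close>, and the group at hand can bring every intertwiner to its normal form.\<close>

lemma flag_lift:
  assumes p: "p \<in> GL l" and l: "l \<le> N" and T: "\<And>s. s \<in> T \<Longrightarrow> s = 0 \<or> l \<le> s"
  obtains P where "P \<in> flag N T \<inter> GL N" "lead l P = p"
proof
  let ?P = "upper_block p (0\<^sub>m l (N - l)) (1\<^sub>m (N - l))"
  note pc = GL_carrier[OF p]
  have g: "?P \<in> GL (l + (N - l))" by (rule upper_block_GL[OF p zero_carrier_mat GL_one])
  have "?P $$ (i,j) = 0" if "s \<in> T" "i < N" "j < s" "s \<le> i" for s i j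
    using T[OF that(1)] that(2-4) pc l by (auto simp: upper_block_def)
  then show "?P \<in> flag N T \<inter> GL N"
    using g GL_carrier[OF g] l by (auto simp: flag_def)
  show "lead l ?P = p" by (rule upper_block_parts[OF pc zero_carrier_mat one_carrier_mat])
qed

text \<open>The image of \<open>Phi i l k\<close> is the span of the first \<open>i\<close>
  coordinates, and the intertwining relation forces it to be stable under \<open>D\<close>. Once
  this stability is recorded in the flag, the relation reduces to its first \<open>i\<close>
  rows.\<close>

lemma ipairs_insert:
  assumes l: "l \<in> T" "l \<le> N" and i: "i \<le> l" "i \<le> k"
  shows "ipairs N (insert i T) i k (Phi i i k) = ipairs N T l k (Phi i l k)"
proof -
  have "(D,E) \<in> ipairs N (insert i T) i k (Phi i i k) \<longleftrightarrow> (D,E) \<in> ipairs N T l k (Phi i l k)" (is "?L \<longleftrightarrow> ?R")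
    for D E :: "'a mat"
  proof (cases "D \<in> flag N T \<and> E \<in> carrier_mat k k")
    case True
    then have D: "D \<in> flag N T" and E: "E \<in> carrier_mat k k" by auto
    let ?e = "\<lambda>l x y. (if y < k - i then 0 else lead l D $$ (x, y - (k - i))) = (if x < i then E $$ (k - i + x, y) else 0)"
    have L: "?L \<longleftrightarrow> (\<forall>a<N. \<forall>c<i. i \<le> a \<longrightarrow> D $$ (a,c) = 0) \<and> (\<forall>x<i. \<forall>y<k. ?e i x y)"
      using D E flag_carrier[OF D] unfolding ipairs_def Phi_intertwine_iff[OF lead_carrier E le_refl i(2)]
      by (auto simp: flag_def Phi_intertwine_iff[OF lead_carrier E le_refl i(2)])
    have R: "?R \<longleftrightarrow> (\<forall>x<l. \<forall>y<k. ?e l x y)"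
      using D E by (auto simp: ipairs_def Phi_intertwine_iff[OF lead_carrier E i])
    \<comment> \<open>Rows \<open>x < i\<close> say the same for both maps. Rows from
      \<open>i\<close> up to \<open>l\<close> say that the first \<open>i\<close> columns of
      \<open>D\<close> vanish there; from row \<open>l\<close> on they vanish already because
      \<open>l\<close> belongs to the flag.\<close>
    have low: "?e l x y \<longleftrightarrow> ?e i x y" if "x < i" "y < k" for x y
      using that i by (auto simp: lead_def)
    have high: "?e l x y \<longleftrightarrow> (k - i \<le> y \<longrightarrow> D $$ (x, y - (k - i)) = 0)" if "x < l" "\<not> x < i" "y < k" for x y
      using that i by (auto simp: lead_def)
    have "(\<forall>a<N. \<forall>c<i. i \<le> a \<longrightarrow> D $$ (a,c) = 0) \<longleftrightarrow> (\<forall>x<l. \<not> x < i \<longrightarrow> (\<forall>y<k. ?e l x y))"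
    proof
      assume z: "\<forall>a<N. \<forall>c<i. i \<le> a \<longrightarrow> D $$ (a,c) = 0"
      show "\<forall>x<l. \<not> x < i \<longrightarrow> (\<forall>y<k. ?e l x y)"
      proof (intro allI impI)
        fix x y assume xy: "x < l" "\<not> x < i" "y < k"
        have "D $$ (x, y - (k - i)) = 0" if "k - i \<le> y"
          using z[rule_format, of x "y - (k - i)"] xy i l(2) that by auto
        then show "?e l x y" using high[OF xy] by blast
      qed
    next
      assume z: "\<forall>x<l. \<not> x < i \<longrightarrow> (\<forall>y<k. ?e l x y)"
      show "\<forall>a<N. \<forall>c<i. i \<le> a \<longrightarrow> D $$ (a,c) = 0"
      proof (intro allI impI)
        fix a c assume ac: "a < N" "c < i" "i \<le> a"
        show "D $$ (a,c) = 0"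
        proof (cases "a < l")
          case True
          have c: "c + (k - i) < k" using ac i by simp
          then show ?thesis using high[OF True _ c] z[rule_format, OF True _ c] ac by simp
        next
          case False
          then show ?thesis using flag_zero[OF D l(1) ac(1), of c] ac i by simp
        qed
      qed
    qed
    then show ?thesis unfolding L R using low less_le_trans[OF _ i(1)] by blast
  next
    case False
    then show ?thesis by (auto simp: ipairs_def flag_def)
  qed
  then show ?thesis by (intro Set.set_eqI) (auto simp: split_paired_all)
qed

lemma equiv_on_subset: "equiv_on X R \<Longrightarrow> Y \<subseteq> X \<Longrightarrow> equiv_on Y R"
  unfolding equiv_on_def by (meson subsetD)

text \<open>The rank is constant on orbits. Every orbit of rank \<open>i\<close> has representatives
  with \<open>F = Phi i l k\<close>, and the group elements relating two of these are those that fix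
  this map, which is the definition of \<open>upairs\<close>.\<close>

lemma triple_orbits_eq_sum:
  fixes S :: "'a :: {field,finite} poly set"
  assumes l: "l \<in> T" "l \<le> N" and T: "\<And>s. s \<in> T \<Longrightarrow> s = 0 \<or> l \<le> s"
  shows "norb (\<lambda>x y. \<exists>g\<in>(flag N T \<inter> GL N) \<times> GL k. triple_act l g x y) (triples S N T l k)
    = (\<Sum>i\<le>min k l. pair_orbits S N (insert i T) i k (Phi i i k))"
proof -
  let ?G = "(flag N T \<inter> GL N) \<times> GL k :: ('a mat \<times> 'a mat) set"
  interpret B: relational_action ?G "triples S N T l k" "triple_act l" pair_mult by (rule triple_action[OF l])
  define Y where "Y i = {(D,A,F) \<in> triples S N T l k. mat_equiv l k F (Phi i l k)}" for i
  have sub: "Y i \<subseteq> triples S N T l k" for i by (auto simp: Y_def)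
  have car: "F \<in> carrier_mat l k" if "(D,A,F) \<in> triples S N T l k" for D A F
    using that by (simp add: triples_def)
  have U: "triples S N T l k = (\<Union>i\<le>min k l. Y i)"
  proof
    show "triples S N T l k \<subseteq> (\<Union>i\<le>min k l. Y i)"
    proof
      fix x assume x: "x \<in> triples S N T l k"
      obtain D A F where e: "x = (D,A,F)" by (cases x) auto
      from rank_normal_form[OF car[OF x[unfolded e]]] x e show "x \<in> (\<Union>i\<le>min k l. Y i)"
        by (auto simp: Y_def min.commute)
    qed
  qed (use sub in blast)
  have "norb B.orel (triples S N T l k) = (\<Sum>i\<le>min k l. norb B.orel (Y i))"
    unfolding U
  proof (rule norb_UN)
    show "finite (Y i)" for i using B.finX sub finite_subset by blast
    show "B.orel x x" if "x \<in> Y i" for i x using equiv_onD(1)[OF B.orel_equiv] that sub by blast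
    show "i = j" if ij: "i \<in> {..min k l}" "j \<in> {..min k l}" and xy: "x \<in> Y i" "y \<in> Y j" "B.orel x y" for i j x y
    proof -
      obtain D A F D' A' F' where e: "x = (D,A,F)" "y = (D',A',F')" by (cases x; cases y) auto
      have c: "F \<in> carrier_mat l k" "F' \<in> carrier_mat l k"
        and eq: "mat_equiv l k F (Phi i l k)" "mat_equiv l k F' (Phi j l k)"
        using xy(1,2) car unfolding e Y_def by auto
      have "mat_equiv l k F F'"
        using xy(3) lead_GL[OF _ _ l] unfolding e mat_equiv_def by (auto simp: triple_act_simp)
      then have "mat_equiv l k (Phi i l k :: 'a mat) (Phi j l k)"
        using mat_equiv_trans[OF Phi_carrier c(1) Phi_carrier mat_equiv_sym[OF c(1) Phi_carrier eq(1)]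
            mat_equiv_trans[OF c Phi_carrier _ eq(2)]] by blast
      then show "i = j" using Phi_equiv_unique[of i l k j] ij by (simp add: min.commute)
    qed
  qed simp
  also have "\<dots> = (\<Sum>i\<le>min k l. pair_orbits S N (insert i T) i k (Phi i i k))"
  proof (rule sum.cong[OF refl])
    fix i assume "i \<in> {..min k l}"
    then have i: "i \<le> l" "i \<le> k" by auto
    have u: "upairs N (insert i T) i k (Phi i i k) = upairs N T l k (Phi i l k)"
      and cp: "cpairs S N (insert i T) i k (Phi i i k) = cpairs S N T l k (Phi i l k)"
      unfolding upairs_def cpairs_def ipairs_insert[OF l i] by auto
    show "norb B.orel (Y i) = pair_orbits S N (insert i T) i k (Phi i i k)"
      unfolding pair_orbits_def u cp
    proof (rule sym, rule norb_transfer[where f = "\<lambda>(D,A). (D, A, Phi i l k)"])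
      show "equiv_on (Y i) B.orel" by (rule equiv_on_subset[OF B.orel_equiv sub])
      show mem: "(case x of (D,A) \<Rightarrow> (D, A, Phi i l k)) \<in> Y i" if "x \<in> cpairs S N T l k (Phi i l k)" for x
      proof -
        have "1\<^sub>m l * Phi i l k = Phi i l k * (1\<^sub>m k :: 'a mat)" 
          unfolding left_mult_one_mat[OF Phi_carrier] right_mult_one_mat[OF Phi_carrier] ..
        then have "mat_equiv l k (Phi i l k) (Phi i l k :: 'a mat)" unfolding mat_equiv_def using GL_one by blast
        then show ?thesis using that
          by (auto simp: Y_def triples_def cpairs_def ipairs_def class_mats_def)
      qed
      show "(\<exists>g\<in>upairs N T l k (Phi i l k). pair_act g x y) \<longleftrightarrow>
          B.orel (case x of (D,A) \<Rightarrow> (D, A, Phi i l k)) (case y of (D,A) \<Rightarrow> (D, A, Phi i l k))" for x y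
      proof -
        obtain D A D' A' where e: "x = (D,A)" "y = (D',A')" by force
        have "(P,R) \<in> upairs N T l k (Phi i l k) \<and> pair_act (P,R) (D,A) (D',A')
            \<longleftrightarrow> (P,R) \<in> ?G \<and> triple_act l (P,R) (D,A,Phi i l k) (D',A',Phi i l k)" for P R
          by (auto simp: upairs_def ipairs_def pair_act_simp triple_act_simp dest: GL_carrier)
        then show ?thesis unfolding e prod.case by (metis surj_pair)
      qed
      show "\<exists>x\<in>cpairs S N T l k (Phi i l k). B.orel (case x of (D,A) \<Rightarrow> (D, A, Phi i l k)) y" if y: "y \<in> Y i" for y
      proof -
        obtain D A F where e: "y = (D,A,F)" by (cases y) auto
        have yt: "(D,A,F) \<in> triples S N T l k" using y e sub by blast
        from y e obtain p Q where pQ: "p \<in> GL l" "Q \<in> GL k" "p * F = Phi i l k * Q"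
          unfolding Y_def mat_equiv_def by blast
        \<comment> \<open>The lift of \<open>p\<close>, together with \<open>Q\<close>, carries
          \<open>F\<close> to a map that agrees with the normal form after multiplication by
          \<open>Q\<close>, hence is equal to it.\<close>
        from flag_lift[OF pQ(1) l(2) T] obtain P where P: "P \<in> flag N T \<inter> GL N" "lead l P = p" by metis
        have g: "(P,Q) \<in> ?G" using P pQ by simp
        from B.total[OF g yt] obtain D' A' F' where z: "(D',A',F') \<in> triples S N T l k"
          "triple_act l (P,Q) (D,A,F) (D',A',F')" by (metis surj_pair)
        have "F' * Q = Phi i l k * Q" using z(2) pQ(3) unfolding triple_act_simp P(2) by simp
        then have F': "F' = Phi i l k" by (rule GL_cancel_right[OF pQ(2) car[OF z(1)] Phi_carrier])
        have "B.orel (case (D',A') of (D,A) \<Rightarrow> (D, A, Phi i l k)) (D,A,F)"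
          unfolding prod.case using equiv_onD(2)[OF B.orel_equiv yt z(1)] z(2) g unfolding F' by blast
        moreover have "(D',A') \<in> cpairs S N T l k (Phi i l k)"
          using z(1) unfolding F' by (auto simp: triples_def cpairs_def ipairs_def class_mats_def)
        ultimately show ?thesis unfolding e by blast
      qed
    qed
  qed
  finally show ?thesis .
qed

section \<open>The recursion on block sizes\<close>

lemma conj_orbits_eq_norb: "conj_orbits G X = norb (\<lambda>A B. \<exists>P\<in>G. P * A = B * P) X"
  unfolding conj_orbits_def norb_def ..

lemma conj_refl:
  fixes A :: "'a :: semiring_1 mat"
  assumes "1\<^sub>m n \<in> G" "A \<in> carrier_mat n n"
  shows "\<exists>P\<in>G. P * A = A * P"
  by (rule bexI[OF _ assms(1)]) (use assms(2) in simp)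

text \<open>\<open>Phi 0 0 k\<close> has no rows, so the intertwining condition is empty and the
  pairs decouple into the flag and an arbitrary endomorphism in the class.\<close>

lemma pair_orbits_0:
  fixes S :: "'a :: {field,finite} poly set"
  shows "pair_orbits S N T 0 k (Phi 0 0 k) = c_count k S * conj_orbits (flag N T \<inter> GL N) (flag N T \<inter> class_mats S)"
proof -
  have "lead 0 D * Phi 0 0 k = Phi 0 0 k * E" if "E \<in> carrier_mat k k" for D E :: "'a mat"
    using that by (intro eq_matI) (auto simp: Phi_def)
  then have ip: "ipairs N T 0 k (Phi 0 0 k :: 'a mat) = flag N T \<times> carrier_mat k k"
    by (auto simp: ipairs_def)
  have u: "upairs N T 0 k (Phi 0 0 k :: 'a mat) = (flag N T \<inter> GL N) \<times> GL k"
    unfolding upairs_def ip by (auto dest: GL_carrier)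
  have c: "cpairs S N T 0 k (Phi 0 0 k) = (flag N T \<inter> class_mats S) \<times> (carrier_mat k k \<inter> class_mats S)"
    unfolding cpairs_def ip by auto
  let ?R = "\<lambda>A B. \<exists>P\<in>flag N T \<inter> GL N. P * A = B * P" and ?Q = "\<lambda>A B. \<exists>P\<in>GL k. P * A = B * P"
  have "pair_orbits S N T 0 k (Phi 0 0 k) = norb (\<lambda>(x,y) (x',y'). ?R x x' \<and> ?Q y y')
    ((flag N T \<inter> class_mats S) \<times> (carrier_mat k k \<inter> class_mats S))"
    unfolding pair_orbits_def u c by (rule norb_cong) (auto simp: pair_act_def)
  also have "\<dots> = norb ?R (flag N T \<inter> class_mats S) * norb ?Q (carrier_mat k k \<inter> class_mats S)"
    by (rule norb_Times; rule conj_refl) (auto simp: flag_one GL_one dest: flag_carrier)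
  finally show ?thesis unfolding c_count_def conj_orbits_eq_norb GL_def[symmetric] by simp
qed

text \<open>Counts flags with block sizes \<open>ls\<close> together with an extension of their
  first step, of dimension \<open>hd ls\<close>, by a space of dimension \<open>k\<close>.\<close>

definition list_orbits :: "'a :: field poly set \<Rightarrow> nat \<Rightarrow> nat list \<Rightarrow> nat" where
  "list_orbits S k ls = pair_orbits S (sum_list ls) (prefix_sums ls) (hd ls) (k + hd ls) (Phi (hd ls) (hd ls) (k + hd ls))"

lemma zero_in_prefix_sums: "0 \<in> prefix_sums ls"
  by (cases ls) auto

text \<open>Inserting \<open>i\<close> into the prefix sums replaces the block \<open>l\<close> by
  \<open>i\<close> and \<open>l - i\<close>, and \<open>k\<close> becomes the dimension
  \<open>k - i\<close> of the kernel of \<open>Phi i i k\<close>. For \<open>i = l\<close> an empty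
  block appears, which the set of prefix sums does not see.\<close>

lemma list_orbits_rec:
  fixes S :: "'a :: {field,finite} poly set"
  shows "list_orbits S k (l # ls) = (\<Sum>i\<le>min k l. list_orbits S (k - i) (i # (l - i) # ls))"
proof -
  let ?N = "l + sum_list ls" and ?T = "prefix_sums (l # ls)"
  have l: "l \<in> ?T" "l \<le> ?N" using zero_in_prefix_sums[of ls] by (auto intro!: image_eqI[of l])
  have "list_orbits S k (l # ls) = pair_orbits S ?N ?T l (k + l) (Phi l l (k + l))"
    by (simp add: list_orbits_def)
  also have "\<dots> = (\<Sum>i\<le>min k l. pair_orbits S ?N (insert i ?T) i k (Phi i i k))"
    unfolding pair_orbits_eq_triple_orbits[OF l] by (rule triple_orbits_eq_sum[OF l]) auto
  also have "\<dots> = (\<Sum>i\<le>min k l. list_orbits S (k - i) (i # (l - i) # ls))"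
  proof (rule sum.cong[OF refl])
    fix i assume i: "i \<in> {..min k l}"
    then have "prefix_sums (i # (l - i) # ls) = insert i ?T" by (auto simp: image_image image_iff)
    then show "pair_orbits S ?N (insert i ?T) i k (Phi i i k) = list_orbits S (k - i) (i # (l - i) # ls)"
      using i by (simp add: list_orbits_def)
  qed
  finally show ?thesis .
qed

lemma list_orbits_0:
  fixes S :: "'a :: {field,finite} poly set"
  shows "list_orbits S k (0 # ls) = c_count k S * conj_orbits (Pblk ls) (Mblk ls \<inter> class_mats S)"
proof -
  have "prefix_sums (0 # ls) = prefix_sums ls" using zero_in_prefix_sums[of ls] by auto
  then show ?thesis by (simp add: list_orbits_def pair_orbits_0 Mblk_eq_flag Pblk_eq_flag)
qed

lemma in_class_upper_block:
  assumes "A \<in> carrier_mat k k" "B \<in> carrier_mat k l" "d \<in> carrier_mat l l"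
  shows "in_class S (upper_block A B d) \<longleftrightarrow> in_class S A \<and> in_class S d"
  using in_class_four_block[OF assms, of S] assms(1,3) by (simp add: upper_block_def)

text \<open>A matrix of type \<open>(k, m)\<close> is an extension of its lower right block, the
  induced map on the quotient. Passing from \<open>E\<close> to the pair \<open>(lr E, E)\<close>
  over the trivial flag of the \<open>m\<close>-dimensional space adds no data.\<close>

lemma kappa_eq_list_orbits:
  fixes S :: "'a :: {field,finite} poly set"
  shows "kappa (k + m) [k] S = list_orbits S k [m]"
proof -
  let ?T = "{0, m}" and ?n = "k + m"
  let ?F = "Phi m m (k + m) :: 'a mat"
  interpret A: relational_action "upairs m ?T m ?n ?F" "cpairs S m ?T m ?n ?F" pair_act pair_mult
    by (rule pair_action) auto
  have mT: "m \<in> ?T" "m \<le> m" by auto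
  have d: "delta (k + m) [k] = [k, m]" by (simp add: delta_def)
  have T: "prefix_sums [m] = ?T" "prefix_sums [k,m] = {0, k, k + m}" by auto
  have fl: "flag m ?T = (carrier_mat m m :: 'a mat set)" by (auto simp: flag_def)
  have lead: "lead m D = D" if "D \<in> carrier_mat m m" for D :: "'a mat"
    using that by (auto simp: lead_def intro!: eq_matI)
  have fl2: "E \<in> flag ?n {0,k,k+m} \<longleftrightarrow>
      (\<exists>A\<in>carrier_mat k k. \<exists>B\<in>carrier_mat k m. \<exists>d\<in>carrier_mat m m. E = upper_block A B d)" for E :: "'a mat"
  proof
    assume E: "E \<in> flag ?n {0,k,k+m}"
    from flag_lead_block[OF E, of k] obtain U V where "U \<in> carrier_mat k m" "V \<in> carrier_mat m m"
      "E = four_block_mat (lead k E) U (0\<^sub>m m k) V" by auto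
    then show "\<exists>A\<in>carrier_mat k k. \<exists>B\<in>carrier_mat k m. \<exists>d\<in>carrier_mat m m. E = upper_block A B d"
      using lead_carrier[of k E] by (intro bexI[of _ "lead k E"] bexI[of _ U] bexI[of _ V]) (auto simp: upper_block_def)
  qed (auto simp: flag_def upper_block_def)
  define lr where "lr = (\<lambda>E :: 'a mat. mat m m (\<lambda>(i,j). E $$ (k + i, k + j)))"
  have lr: "lr (upper_block A B d) = d"
    if "A \<in> carrier_mat k k" "B \<in> carrier_mat k m" "d \<in> carrier_mat m m" for A B d
    using that by (auto simp: lr_def upper_block_def intro!: eq_matI)
  have Uiff: "(P,R) \<in> upairs m ?T m ?n ?F \<longleftrightarrow> R \<in> flag ?n {0,k,k+m} \<inter> GL ?n \<and> P = lr R" for P R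
  proof -
    have "upper_block Q X P \<in> GL ?n \<longleftrightarrow> Q \<in> GL k \<and> P \<in> GL m"
      if "Q \<in> carrier_mat k k" "X \<in> carrier_mat k m" "P \<in> carrier_mat m m" for Q X P :: "'a mat"
      using that det_four_block_mat_lower_left_zero[OF that(1,2) refl that(3)]
      by (auto simp: GL_det upper_block_def)
    note 1 = this
    show ?thesis
    proof
      assume "(P,R) \<in> upairs m ?T m ?n ?F"
      then obtain Q X where *: "P \<in> carrier_mat m m" "P \<in> GL m" "Q \<in> GL k" "X \<in> carrier_mat k m"
          "R = upper_block Q X (lead m P)"
        unfolding upairs_Phi_iff[OF mT] fl by blast
      have Q: "Q \<in> carrier_mat k k" by (rule GL_carrier[OF *(3)])
      have R: "R = upper_block Q X P" using * lead by simp
      have "R \<in> flag ?n {0,k,k+m}" unfolding fl2 using R Q * by blast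
      moreover have "R \<in> GL ?n" using 1[OF Q *(4,1)] *(2,3) R by blast
      moreover have "P = lr R" unfolding R by (rule lr[OF Q *(4,1), symmetric])
      ultimately show "R \<in> flag ?n {0,k,k+m} \<inter> GL ?n \<and> P = lr R" by blast
    next
      assume "R \<in> flag ?n {0,k,k+m} \<inter> GL ?n \<and> P = lr R"
      then obtain Q X d where *: "Q \<in> carrier_mat k k" "X \<in> carrier_mat k m" "d \<in> carrier_mat m m" "R = upper_block Q X d"
        and R: "R \<in> GL ?n" "P = lr R" using fl2[of R] by blast
      have P: "P = d" using lr[OF *(1-3)] R(2) *(4) by simp
      show "(P,R) \<in> upairs m ?T m ?n ?F"
        unfolding upairs_Phi_iff[OF mT] fl P lead[OF *(3)] using 1[OF *(1-3)] R(1) * by blast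
    qed
  qed
  have Ciff: "(D,E) \<in> cpairs S m ?T m ?n ?F \<longleftrightarrow> E \<in> flag ?n {0,k,k+m} \<inter> class_mats S \<and> D = lr E" for D E
  proof
    assume "(D,E) \<in> cpairs S m ?T m ?n ?F"
    then obtain A B where *: "D \<in> carrier_mat m m" "in_class S D" "A \<in> carrier_mat k k" "B \<in> carrier_mat k m"
        "in_class S A" "E = upper_block A B (lead m D)"
      unfolding cpairs_Phi_iff[OF mT] fl by blast
    have E: "E = upper_block A B D" using * lead by simp
    have "E \<in> flag ?n {0,k,k+m}" unfolding fl2 using E * by blast
    moreover have "in_class S E" unfolding E in_class_upper_block[OF *(3,4,1)] using * by blast
    moreover have "D = lr E" unfolding E by (rule lr[OF *(3,4,1), symmetric])
    ultimately show "E \<in> flag ?n {0,k,k+m} \<inter> class_mats S \<and> D = lr E" by (simp add: class_mats_def)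
  next
    assume E: "E \<in> flag ?n {0,k,k+m} \<inter> class_mats S \<and> D = lr E"
    then obtain A B d where *: "A \<in> carrier_mat k k" "B \<in> carrier_mat k m" "d \<in> carrier_mat m m" "E = upper_block A B d"
      using fl2[of E] by blast
    have D: "D = d" using lr[OF *(1-3)] E *(4) by simp
    have "in_class S A \<and> in_class S d"
      using E unfolding *(4) by (simp add: class_mats_def in_class_upper_block[OF *(1-3)])
    then show "(D,E) \<in> cpairs S m ?T m ?n ?F"
      unfolding cpairs_Phi_iff[OF mT] fl D lead[OF *(3)] using * by blast
  qed
  have "conj_orbits (Pblk [k,m]) (Mblk [k,m] \<inter> class_mats S)
    = norb (\<lambda>x y. \<exists>g\<in>upairs m ?T m ?n ?F. pair_act g x y) (cpairs S m ?T m ?n ?F)"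
    unfolding conj_orbits_eq_norb
  proof (rule norb_transfer[where f = "\<lambda>E. (lr E, E)"])
    show "equiv_on (cpairs S m ?T m ?n ?F) A.orel" by (rule A.orel_equiv)
    have M: "Mblk [k,m] = flag ?n {0,k,k+m}" "Pblk [k,m] = flag ?n {0,k,k+m} \<inter> GL ?n"
      unfolding Mblk_eq_flag Pblk_eq_flag T by simp_all
    show "(lr E, E) \<in> cpairs S m ?T m ?n ?F" if "E \<in> Mblk [k,m] \<inter> class_mats S" for E
      using that unfolding M Ciff by simp
    show "\<exists>E\<in>Mblk [k,m] \<inter> class_mats S. A.orel (lr E, E) y" if y: "y \<in> cpairs S m ?T m ?n ?F" for y
    proof -
      obtain D E where e: "y = (D,E)" by force
      show ?thesis using y equiv_onD(1)[OF A.orel_equiv y] unfolding e Ciff M by blast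
    qed
    show "(\<exists>P\<in>Pblk [k,m]. P * E = E' * P) \<longleftrightarrow> A.orel (lr E, E) (lr E', E')"
      if E: "E \<in> Mblk [k,m] \<inter> class_mats S" and E': "E' \<in> Mblk [k,m] \<inter> class_mats S" for E E'
    proof
      assume "\<exists>P\<in>Pblk [k,m]. P * E = E' * P"
      then obtain R where R: "R \<in> flag ?n {0,k,k+m} \<inter> GL ?n" "R * E = E' * R" unfolding M by blast
      then obtain Q X P A B d A' B' d' where
        *: "Q \<in> carrier_mat k k" "X \<in> carrier_mat k m" "P \<in> carrier_mat m m" "R = upper_block Q X P"
        "A \<in> carrier_mat k k" "B \<in> carrier_mat k m" "d \<in> carrier_mat m m" "E = upper_block A B d"
        "A' \<in> carrier_mat k k" "B' \<in> carrier_mat k m" "d' \<in> carrier_mat m m" "E' = upper_block A' B' d'"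
        using E E' fl2[of R] fl2[of E] fl2[of E'] unfolding M by blast
      have "upper_block (Q * A) (Q * B + X * d) (P * d) = upper_block (A' * Q) (A' * X + B' * P) (d' * P)"
        using R(2) unfolding *(4,8,12) upper_block_mult[OF *(1-3,5-7)] upper_block_mult[OF *(9-11,1-3)] .
      then have "lr (upper_block (Q * A) (Q * B + X * d) (P * d)) = lr (upper_block (A' * Q) (A' * X + B' * P) (d' * P))"
        by simp
      then have "P * d = d' * P"
        by (subst (asm) (1 2) lr) (use * in \<open>auto intro!: mult_carrier_mat add_carrier_mat\<close>)
      then have "pair_act (lr R, R) (lr E, E) (lr E', E')"
        using R(2) lr[OF *(1-3)] lr[OF *(5-7)] lr[OF *(9-11)] unfolding pair_act_simp *(4,8,12) by simp
      then show "A.orel (lr E, E) (lr E', E')" using Uiff R(1) by blast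
    next
      assume "A.orel (lr E, E) (lr E', E')"
      then obtain P R where "(P,R) \<in> upairs m ?T m ?n ?F" "R * E = E' * R" by (auto simp: pair_act_simp)
      then show "\<exists>P\<in>Pblk [k,m]. P * E = E' * P" unfolding M Uiff by blast
    qed
  qed
  then show ?thesis unfolding kappa_def d list_orbits_def pair_orbits_def by (simp add: insert_commute)
qed

subsection \<open>Recursion over partitions\<close>

text \<open>All sizes up to \<open>k\<close> are taken at once because removing the largest part
  \<open>i\<close> changes the available size to \<open>k - i\<close> and the bound on the parts to
  \<open>i\<close> simultaneously.\<close>

definition partitions_upto :: "nat \<Rightarrow> nat \<Rightarrow> nat list set" where
  "partitions_upto k m = (\<Union>j\<le>k. partitions_bounded j m)"

lemma partitions_upto_iff:
  "lam \<in> partitions_upto k m \<longleftrightarrow> is_partition lam \<and> sum_list lam \<le> k \<and> (\<forall>x\<in>set lam. x \<le> m)"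
  by (auto simp: partitions_upto_def partitions_bounded_def)

lemma length_le_sum_partition: "is_partition lam \<Longrightarrow> length lam \<le> sum_list lam"
  by (induction lam) (force simp: is_partition_def)+

lemma finite_partitions_upto: "finite (partitions_upto k m)"
proof (rule finite_subset)
  show "partitions_upto k m \<subseteq> {lam. set lam \<subseteq> {..m} \<and> length lam \<le> k}"
    using length_le_sum_partition le_trans by (fastforce simp: partitions_upto_iff)
qed (rule finite_lists_length_le, simp)

lemma partitions_upto_Cons:
  "partitions_upto k m = insert [] (\<Union>i\<in>{1..min k m}. (#) i ` partitions_upto (k - i) i)"
proof (intro Set.set_eqI)
  fix lam
  show "lam \<in> partitions_upto k m \<longleftrightarrow> lam \<in> insert [] (\<Union>i\<in>{1..min k m}. (#) i ` partitions_upto (k - i) i)"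
  proof (cases lam)
    case Nil
    then show ?thesis by (simp add: partitions_upto_iff is_partition_def)
  next
    case (Cons i mu)
    then show ?thesis by (auto simp: partitions_upto_iff is_partition_def image_iff)
  qed
qed

lemma delta_Nil: "delta l [] = [l]"
  by (simp add: delta_def)

text \<open>\<open>delta\<close> starts with the smallest part, so a new largest part only appends a
  block. In the recursion this is the block \<open>l - i\<close> left behind while the head
  \<open>i\<close> is split further.\<close>

lemma delta_Cons: "delta l (i # mu) = delta i mu @ [l - i]"
  by (simp add: delta_def)

text \<open>The term \<open>i = 0\<close> stops with the empty partition. A term
  \<open>i > 0\<close> prepends the part \<open>i\<close>; all later parts are bounded by the new
  head \<open>i\<close>, so the parts are non-increasing, and \<open>k\<close> has dropped. The tail
  \<open>ls\<close> is generalised because it collects the blocks left behind.\<close>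

lemma partition_recursion:
  fixes G :: "nat \<Rightarrow> nat list \<Rightarrow> nat"
  assumes rec: "\<And>k l ls. G k (l # ls) = (\<Sum>i\<le>min k l. G (k - i) (i # (l - i) # ls))"
    and base: "\<And>k ls. G k (0 # ls) = c k * h ls"
  shows "G k (l # ls) = (\<Sum>lam\<in>partitions_upto k l. c (k - sum_list lam) * h (delta l lam @ ls))"
proof (induction k arbitrary: l ls rule: less_induct)
  case (less k)
  let ?f = "\<lambda>lam. c (k - sum_list lam) * h (delta l lam @ ls)"
  have "G k (l # ls) = G k (0 # l # ls) + (\<Sum>i\<in>{1..min k l}. G (k - i) (i # (l - i) # ls))"
  proof -
    have s: "{..min k l} = insert 0 {1..min k l}" by auto
    show ?thesis unfolding rec[of k l ls] s by (subst sum.insert) auto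
  qed
  also have "(\<Sum>i\<in>{1..min k l}. G (k - i) (i # (l - i) # ls))
      = (\<Sum>i\<in>{1..min k l}. \<Sum>mu\<in>partitions_upto (k - i) i. ?f (i # mu))"
  proof (rule sum.cong[OF refl])
    fix i assume "i \<in> {1..min k l}"
    then have "k - i < k" by auto
    from less.IH[OF this] show "G (k - i) (i # (l - i) # ls) = (\<Sum>mu\<in>partitions_upto (k - i) i. ?f (i # mu))"
      by (simp add: delta_Cons diff_diff_left)
  qed
  also have "\<dots> = (\<Sum>i\<in>{1..min k l}. \<Sum>lam\<in>(#) i ` partitions_upto (k - i) i. ?f lam)"
    by (simp add: sum.reindex)
  also have "\<dots> = (\<Sum>lam\<in>(\<Union>i\<in>{1..min k l}. (#) i ` partitions_upto (k - i) i). ?f lam)"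
    by (rule sum.UNION_disjoint[symmetric]) (auto simp: finite_partitions_upto)
  also have "G k (0 # l # ls) = ?f []" by (simp add: base delta_Nil)
  finally show ?case
    unfolding partitions_upto_Cons[of k l] by (subst sum.insert) (auto simp: finite_partitions_upto)
qed

lemma sum_partitions_upto:
  "(\<Sum>lam\<in>partitions_upto k m. c (k - sum_list lam) * h lam)
    = (\<Sum>j=0..k. c (k - j) * (\<Sum>lam\<in>partitions_bounded j m. h lam :: nat))"
proof -
  have fin: "finite (partitions_bounded j m)" for j
    by (rule finite_subset[OF _ finite_partitions_upto[of j m]]) (auto simp: partitions_upto_def)
  have "(\<Sum>lam\<in>partitions_upto k m. c (k - sum_list lam) * h lam)
    = (\<Sum>j\<le>k. \<Sum>lam\<in>partitions_bounded j m. c (k - sum_list lam) * h lam)"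
    unfolding partitions_upto_def
    by (rule sum.UNION_disjoint) (use fin in \<open>auto simp: partitions_bounded_def\<close>)
  also have "\<dots> = (\<Sum>j\<le>k. c (k - j) * (\<Sum>lam\<in>partitions_bounded j m. h lam))"
    unfolding sum_distrib_left by (intro sum.cong refl) (simp add: partitions_bounded_def)
  finally show ?thesis by (simp add: atLeast0AtMost)
qed

theorem kappa_eq_partition_sum:
  fixes S :: "'a :: {field,finite} poly set"
  shows "kappa (k + m) [k] S = (\<Sum>j=0..k. c_count (k - j) S * (\<Sum>lam\<in>partitions_bounded j m. kappa m lam S))"
proof -
  have "list_orbits S k [m] = (\<Sum>lam\<in>partitions_upto k m. c_count (k - sum_list lam) S * kappa m lam S)"
    unfolding kappa_def
    using partition_recursion[of "list_orbits S" "\<lambda>j. c_count j S" "\<lambda>ls. conj_orbits (Pblk ls) (Mblk ls \<inter> class_mats S)",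
        OF list_orbits_rec list_orbits_0, of k m "[]"] by simp
  then show ?thesis 
    unfolding kappa_eq_list_orbits using sum_partitions_upto[of "\<lambda>j. c_count j S" k "\<lambda>lam. kappa m lam S" m] by simp
qed

section \<open>Nilpotent matrices\<close>

text \<open>The monic irreducible polynomials with 0 as their only root: this is the parameter for
  \<open>F = {0}\<close>.\<close>

abbreviation nilp_class :: "'a :: field poly set" where
  "nilp_class \<equiv> {[:0, 1:]}"

lemma similar_mat_iff_GL:
  fixes A :: "'a :: field mat"
  assumes A: "A \<in> carrier_mat n n" and B: "B \<in> carrier_mat n n"
  shows "similar_mat B A \<longleftrightarrow> (\<exists>P\<in>GL n. P * A = B * P)"
proof
  assume "similar_mat B A"
  then obtain P Q where w: "similar_mat_wit B A P Q" unfolding similar_mat_def by blast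
  have *: "P \<in> carrier_mat n n" "Q \<in> carrier_mat n n" "P * Q = 1\<^sub>m n" "Q * P = 1\<^sub>m n" "B = P * A * Q"
    using similar_mat_witD2[OF B w] by auto
  have "P * A = B * P" unfolding *(5) by (rule conj_exists[OF *(1,2) A *(4), symmetric])
  then show "\<exists>P\<in>GL n. P * A = B * P" using GL_I[OF *(1-3)] by blast
next
  assume "\<exists>P\<in>GL n. P * A = B * P"
  then obtain P where P: "P \<in> GL n" "P * A = B * P" by blast
  from GL_inverse[OF P(1)] obtain Q where Q: "Q \<in> GL n" "P * Q = 1\<^sub>m n" "Q * P = 1\<^sub>m n" by blast
  note c = GL_carrier[OF P(1)] GL_carrier[OF Q(1)]
  have "P * A * Q = B" unfolding P(2) assoc_mult_mat[OF B c] Q(2) by (rule right_mult_one_mat[OF B])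
  then show "similar_mat B A" by (intro similar_matI[of _ _ P Q n]) (use A B c Q in auto)
qed

section \<open>Nilpotency through strict triangularization\<close>

definition strictly_upper :: "nat \<Rightarrow> 'a :: zero mat \<Rightarrow> bool" where
  "strictly_upper n A \<longleftrightarrow> A \<in> carrier_mat n n \<and> (\<forall>i<n. \<forall>j\<le>i. A $$ (i,j) = 0)"

text \<open>Each further factor pushes the zero region up by one diagonal; at exponent
  \<open>n\<close> it covers the whole matrix.\<close>

lemma strictly_upper_pow:
  fixes A :: "'a :: semiring_1 mat"
  assumes A: "strictly_upper n A"
  shows "i < n \<Longrightarrow> j < n \<Longrightarrow> j < i + e \<Longrightarrow> (A ^\<^sub>m e) $$ (i,j) = 0"
proof (induction e arbitrary: j)
  case 0
  then show ?case using A by (auto simp: strictly_upper_def)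
next
  case (Suc e)
  have Ac: "A \<in> carrier_mat n n" using A by (simp add: strictly_upper_def)
  have "(A ^\<^sub>m Suc e) $$ (i,j) = (\<Sum>c<n. (A ^\<^sub>m e) $$ (i,c) * A $$ (c,j))"
    using mat_mult_index_sum[OF pow_carrier_mat[OF Ac] Ac Suc.prems(1,2), of e] by simp
  also have "\<dots> = 0"
  proof (rule sum.neutral, rule ballI)
    fix c assume c: "c \<in> {..<n}"
    show "(A ^\<^sub>m e) $$ (i,c) * A $$ (c,j) = 0"
    proof (cases "c < i + e")
      case True
      then show ?thesis using Suc.IH[of c] Suc.prems c by simp
    next
      case False
      then have "A $$ (c,j) = 0" using A c Suc.prems(3) by (simp add: strictly_upper_def)
      then show ?thesis by simp
    qed
  qed
  finally show ?case .
qed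

lemma strictly_upper_nilpotent:
  fixes A :: "'a :: field mat"
  assumes A: "strictly_upper n A"
  shows "nilpotent_mat A"
proof -
  have c: "A \<in> carrier_mat n n" using A by (simp add: strictly_upper_def)
  have "A ^\<^sub>m n = 0\<^sub>m n n"
    by (rule eq_matI) (use strictly_upper_pow[OF A, of _ _ n] pow_carrier_mat[OF c, of n] in auto)
  then show ?thesis unfolding nilpotent_mat_def using c by (intro exI[of _ n]) auto
qed

lemma strictly_upper_char_poly:
  fixes A :: "'a :: field mat"
  assumes A: "strictly_upper n A"
  shows "char_poly A = [:0, 1:] ^ n"
proof -
  have c: "A \<in> carrier_mat n n" and u: "upper_triangular A" using A by (auto simp: strictly_upper_def)
  have "diag_mat A = replicate n 0"
    by (rule nth_equalityI) (use A in \<open>auto simp: strictly_upper_def diag_mat_def\<close>)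
  then show ?thesis using char_poly_upper_triangular[OF c u] by (simp add: prod_list_replicate)
qed

lemma nilp_class_power:
  assumes "char_poly A = [:0, 1:] ^ n"
  shows "in_class nilp_class A"
  unfolding in_class_def
proof (intro allI impI)
  fix p :: "'a poly" assume p: "monic p \<and> irreducible p \<and> p dvd char_poly A"
  then have "prime_elem p" by (intro field_poly_irreducible_imp_prime) simp
  then have "p dvd [:0, 1:]" using p prime_elem_dvd_power unfolding assms by blast
  then obtain r where r: "[:0, 1:] = p * r" by (rule dvdE)
  have nz: "p \<noteq> 0" "r \<noteq> 0" using r by auto
  have "degree ([:0, 1:] :: 'a poly) = degree p + degree r" unfolding r by (rule degree_mult_eq[OF nz])
  then have deg: "degree p + degree r = 1" by simp
  have "degree p \<noteq> 0" using p irreducible_def is_unit_iff_degree[OF nz(1)] by auto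
  then have "degree r = 0" using deg by simp
  then obtain c where c: "r = [:c:]" by (rule degree_eq_zeroE)
  have "lead_coeff ([:0, 1:] :: 'a poly) = lead_coeff p * lead_coeff r" unfolding r by (rule lead_coeff_mult)
  then have "c = 1" using p c by simp
  then show "p \<in> nilp_class" using r c by simp
qed

text \<open>A characteristic polynomial of positive degree has a monic irreducible factor; this can
  only be \<open>[:0, 1:]\<close>, so 0 is a root.\<close>

lemma nilp_class_det:
  fixes A :: "'a :: field mat"
  assumes A: "A \<in> carrier_mat n n" and n: "0 < n" and S: "in_class nilp_class A"
  shows "det A = 0"
proof -
  have "0 < degree (char_poly A)" using degree_monic_char_poly[OF A] n by simp
  from irreducible_monic_factor[OF this] obtain q r where q: "irreducible q" "char_poly A = q * r" "monic q" by blast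
  then have "q = [:0, 1:]" using S unfolding in_class_def by (metis dvd_triv_left singletonD)
  then have "poly (char_poly A) 0 = 0" unfolding q(2) by simp
  then have "det (- char_matrix A 0) = 0" using char_poly_matrix[OF A, of 0] by simp
  moreover have "char_matrix A 0 = A" by (rule eq_matI) (use A in \<open>auto simp: char_matrix_def\<close>)
  ultimately show ?thesis using det_0_negate[OF A] by simp
qed

lemma GL_pow: "P \<in> GL n \<Longrightarrow> P ^\<^sub>m e \<in> GL n"
  by (induction e) (auto simp: GL_one GL_mult dest: GL_carrier)

lemma nilpotent_det:
  fixes A :: "'a :: field mat"
  assumes A: "A \<in> carrier_mat n n" and n: "0 < n" and nil: "nilpotent_mat A"
  shows "det A = 0"
proof (rule ccontr)
  assume "det A \<noteq> 0"
  then have "A \<in> GL n" using A by (simp add: GL_det)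
  moreover obtain e where "A ^\<^sub>m e = 0\<^sub>m n n" using nil A unfolding nilpotent_mat_def by auto
  ultimately have "(0\<^sub>m n n :: 'a mat) \<in> GL n" using GL_pow by metis
  then have "det (0\<^sub>m n n :: 'a mat) \<noteq> 0" by (simp add: GL_det)
  then show False using det_zero[OF n] by metis
qed

lemma mult_column_mat:
  fixes A :: "'a :: semiring_0 mat"
  assumes "A \<in> carrier_mat l n" "v \<in> carrier_vec n"
  shows "A * mat n 1 (\<lambda>(i,_). v $ i) = mat l 1 (\<lambda>(i,_). (A *\<^sub>v v) $ i)"
  by (rule eq_matI) (use assms in \<open>auto simp: scalar_prod_def intro!: sum.cong\<close>)

text \<open>A kernel vector, read as a one-column matrix, has a rank normal form. The base change on
  its left side turns the vector into a multiple of the first coordinate vector, so the conjugate of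
  \<open>A\<close> has zero first column.\<close>

lemma singular_similar_block:
  fixes A :: "'a :: field mat"
  assumes A: "A \<in> carrier_mat (1 + m) (1 + m)" and sing: "det A = 0"
  obtains r A' where "r \<in> carrier_mat 1 m" "A' \<in> carrier_mat m m"
    "similar_mat A (upper_block (0\<^sub>m 1 1) r A')"
proof -
  let ?n = "1 + m"
  from sing obtain v where v: "v \<in> carrier_vec ?n" "v \<noteq> 0\<^sub>v ?n" "A *\<^sub>v v = 0\<^sub>v ?n"
    using det_0_iff_vec_prod_zero_field[OF A] by blast
  define V where "V = mat ?n 1 (\<lambda>(i,_). v $ i)"
  have V: "V \<in> carrier_mat ?n 1" by (simp add: V_def)
  have AV: "A * V = 0\<^sub>m ?n 1"
    unfolding V_def mult_column_mat[OF A v(1)] v(3) by (rule eq_matI) auto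
  from rank_normal_form[OF V] obtain i p Q where i: "i \<le> min ?n 1" and p: "p \<in> GL ?n" and Q: "Q \<in> GL 1"
    and eq: "p * V = Phi i ?n 1 * Q" unfolding mat_equiv_def by blast
  note pc = GL_carrier[OF p] and Qc = GL_carrier[OF Q]
  have "i \<noteq> 0"
  proof
    assume i: "i = 0"
    have "Phi 0 ?n 1 * Q = p * 0\<^sub>m ?n 1" using pc Qc by (intro eq_matI) (auto simp: Phi_def scalar_prod_def)
    then have V0: "V = 0\<^sub>m ?n 1" using eq i GL_cancel[OF p V, of "0\<^sub>m ?n 1"] by simp
    have "v $ j = 0" if "j < ?n" for j
    proof -
      have "v $ j = V $$ (j,0)" using that by (simp add: V_def)
      also have "\<dots> = 0" unfolding V0 using that by simp
      finally show ?thesis .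
    qed
    then show False using v by (auto simp: vec_eq_iff)
  qed
  then have i1: "i = 1" using i by simp
  from GL_inverse[OF p] obtain p' where p': "p' \<in> GL ?n" "p * p' = 1\<^sub>m ?n" "p' * p = 1\<^sub>m ?n" by blast
  note p'c = GL_carrier[OF p'(1)]
  define B where "B = p * A * p'"
  have B: "B \<in> carrier_mat ?n ?n" using pc p'c A by (simp add: B_def)
  have Bp: "B * p = p * A" unfolding B_def by (rule conj_exists[OF pc p'c A p'(3)])
  have "(B * Phi 1 ?n 1) * Q = B * (p * V)" unfolding eq i1 by (rule assoc_mult_mat[OF B Phi_carrier Qc])
  also have "\<dots> = (p * A) * V" unfolding Bp[symmetric] by (rule assoc_mult_mat[OF B pc V, symmetric])
  also have "\<dots> = p * 0\<^sub>m ?n 1" unfolding AV[symmetric] by (rule assoc_mult_mat[OF pc A V])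
  also have "\<dots> = 0\<^sub>m ?n 1 * Q" using pc Qc by simp
  finally have BPhi: "B * Phi 1 ?n 1 = 0\<^sub>m ?n 1"
    by (rule GL_cancel_right[OF Q mult_carrier_mat[OF B Phi_carrier] zero_carrier_mat])
  have col: "B $$ (x,0) = 0" if "x < ?n" for x
    using mult_Phi_index[OF B, of 1 1 x 0] that unfolding BPhi by simp
  obtain b r c A' where sp: "split_block B 1 1 = (b, r, c, A')" by (metis surj_pair)
  have car: "b \<in> carrier_mat 1 1" "r \<in> carrier_mat 1 m" "c \<in> carrier_mat m 1" "A' \<in> carrier_mat m m"
    and B4: "B = four_block_mat b r c A'"
    using split_block[OF sp, of m m] B by auto
  have "b = 0\<^sub>m 1 1" using col[of 0] car unfolding B4 by (intro eq_matI) auto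
  moreover have "c = 0\<^sub>m m 1"
  proof (rule eq_matI)
    fix x y assume "x < dim_row (0\<^sub>m m 1 :: 'a mat)" "y < dim_col (0\<^sub>m m 1 :: 'a mat)"
    then show "c $$ (x,y) = 0\<^sub>m m 1 $$ (x,y)" using col[of "1 + x"] car unfolding B4 by auto
  qed (use car in auto)
  ultimately have "B = upper_block (0\<^sub>m 1 1) r A'" using B4 car by (simp add: upper_block_def)
  moreover have "similar_mat B A" unfolding similar_mat_iff_GL[OF A B] using p Bp by metis
  ultimately show ?thesis using that[OF car(2,4)] similar_mat_sym by blast
qed

text \<open>\<open>H\<close> stands for either of two properties, nilpotency or membership in
  \<open>nilp_class\<close>. Both force singularity, are invariant under similarity and pass to the
  lower right block, so a kernel vector can be split off again and again.\<close>

lemma strict_triangularization: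
  fixes A :: "'a :: field mat"
  assumes sing: "\<And>n A. H n A \<Longrightarrow> A \<in> carrier_mat n n \<Longrightarrow> 0 < n \<Longrightarrow> det A = 0"
    and sim: "\<And>n A B. H n A \<Longrightarrow> similar_mat A B \<Longrightarrow> A \<in> carrier_mat n n \<Longrightarrow> H n B"
    and block: "\<And>m r A. r \<in> carrier_mat 1 m \<Longrightarrow> A \<in> carrier_mat m m \<Longrightarrow> H (1 + m) (upper_block (0\<^sub>m 1 1) r A) \<Longrightarrow> H m A"
  shows "A \<in> carrier_mat n n \<Longrightarrow> H n A \<Longrightarrow> \<exists>T. strictly_upper n T \<and> similar_mat A T"
proof (induction n arbitrary: A)
  case 0
  then show ?case by (intro exI[of _ A]) (auto simp: strictly_upper_def intro: similar_mat_refl)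
next
  case (Suc m)
  have A: "A \<in> carrier_mat (1 + m) (1 + m)" using Suc.prems by simp
  from singular_similar_block[OF A sing[OF Suc.prems(2,1)]] obtain r A' where
    r: "r \<in> carrier_mat 1 m" and A': "A' \<in> carrier_mat m m" and s: "similar_mat A (upper_block (0\<^sub>m 1 1) r A')" by blast
  have "H m A'" using block[OF r A'] sim[OF Suc.prems(2) s Suc.prems(1)] by simp
  from Suc.IH[OF A' this] obtain T where T: "strictly_upper m T" "similar_mat A' T" by blast
  have Tc: "T \<in> carrier_mat m m" using T by (simp add: strictly_upper_def)
  from similar_mat_four_block_0_ex[OF similar_mat_refl[OF zero_carrier_mat[of 1 1]] T(2) r zero_carrier_mat A']
  obtain B0 where B0: "B0 \<in> carrier_mat 1 m"
    "similar_mat (four_block_mat (0\<^sub>m 1 1) r (0\<^sub>m m 1) A') (four_block_mat (0\<^sub>m 1 1) B0 (0\<^sub>m m 1) T)" by blast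
  have "strictly_upper (Suc m) (four_block_mat (0\<^sub>m 1 1) B0 (0\<^sub>m m 1) T)"
    unfolding strictly_upper_def
  proof (intro conjI allI impI)
    fix i j assume ij: "i < Suc m" "j \<le> i"
    have "T $$ (i - 1, j - 1) = 0" if "1 \<le> j"
      using T(1) ij that unfolding strictly_upper_def by simp
    then show "four_block_mat (0\<^sub>m 1 1) B0 (0\<^sub>m m 1) T $$ (i,j) = 0"
      using ij carrier_matD[OF Tc] by (cases "j = 0") auto
  qed (use Tc in auto)
  moreover have "similar_mat A (four_block_mat (0\<^sub>m 1 1) B0 (0\<^sub>m m 1) T)"
    using similar_mat_trans[OF s] B0(2) A' by (simp add: upper_block_def)
  ultimately show ?case by blast
qed

lemma in_class_similar: "similar_mat A B \<Longrightarrow> in_class S A \<Longrightarrow> in_class S B"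
  unfolding in_class_def by (simp add: char_poly_similar)

lemma nilpotent_similar:
  fixes A :: "'a :: field mat"
  assumes sim: "similar_mat A B" and nil: "nilpotent_mat B"
  shows "nilpotent_mat A"
proof -
  from sim obtain P Q where w: "similar_mat_wit A B P Q" unfolding similar_mat_def by blast
  define n where "n = dim_row A"
  from similar_mat_witD[OF n_def w] have c: "A \<in> carrier_mat n n" "B \<in> carrier_mat n n" "P \<in> carrier_mat n n" "Q \<in> carrier_mat n n"
    by auto
  from nil c obtain e where "B ^\<^sub>m e = 0\<^sub>m n n" unfolding nilpotent_mat_def by auto
  then have "A ^\<^sub>m e = 0\<^sub>m n n" using similar_mat_wit_pow_id[OF w, of e] c by simp
  then show ?thesis unfolding nilpotent_mat_def using c by (intro exI[of _ e]) auto
qed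

lemma upper_block_pow:
  fixes A :: "'a :: semiring_1 mat"
  assumes A: "A \<in> carrier_mat k k" "B \<in> carrier_mat k l" "d \<in> carrier_mat l l"
  shows "\<exists>B'\<in>carrier_mat k l. upper_block A B d ^\<^sub>m e = upper_block (A ^\<^sub>m e) B' (d ^\<^sub>m e)"
proof (induction e)
  case 0
  have "upper_block A B d ^\<^sub>m 0 = upper_block (A ^\<^sub>m 0) (0\<^sub>m k l) (d ^\<^sub>m 0)"
    using assms by (simp add: upper_block_def)
  then show ?case by (intro bexI[of _ "0\<^sub>m k l"]) auto
next
  case (Suc e)
  then obtain B' where B': "B' \<in> carrier_mat k l" "upper_block A B d ^\<^sub>m e = upper_block (A ^\<^sub>m e) B' (d ^\<^sub>m e)" by blast
  have "upper_block A B d ^\<^sub>m Suc e = upper_block (A ^\<^sub>m Suc e) (A ^\<^sub>m e * B + B' * d) (d ^\<^sub>m Suc e)"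
    using upper_block_mult[OF pow_carrier_mat[OF A(1)] B'(1) pow_carrier_mat[OF A(3)] A, of e e] B'(2) by simp
  then show ?case using A B' pow_carrier_mat[OF A(1), of e] by (intro bexI[of _ "A ^\<^sub>m e * B + B' * d"]) auto
qed

lemma upper_block_lower_right:
  assumes "A \<in> carrier_mat k k" "d \<in> carrier_mat l l" "i < l" "j < l"
  shows "upper_block A B d $$ (k + i, k + j) = d $$ (i,j)"
  using assms by (simp add: upper_block_def)

lemma nilpotent_triangularization:
  fixes A :: "'a :: field mat"
  assumes "A \<in> carrier_mat n n" "nilpotent_mat A"
  shows "\<exists>T. strictly_upper n T \<and> similar_mat A T"
proof (rule strict_triangularization[where H = "\<lambda>n. nilpotent_mat"])
  fix m r and A :: "'a mat"
  assume r: "r \<in> carrier_mat 1 m" and A: "A \<in> carrier_mat m m" and nil: "nilpotent_mat (upper_block (0\<^sub>m 1 1) r A)"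
  note c = upper_block_carrier[OF zero_carrier_mat[of 1 1] A, of r]
  from nil obtain e where "upper_block (0\<^sub>m 1 1) r A ^\<^sub>m e = 0\<^sub>m (1 + m) (1 + m)"
    unfolding nilpotent_mat_def carrier_matD[OF c] by blast
  moreover obtain B' where B': "B' \<in> carrier_mat 1 m"
    "upper_block (0\<^sub>m 1 1) r A ^\<^sub>m e = upper_block (0\<^sub>m 1 1 ^\<^sub>m e) B' (A ^\<^sub>m e)"
    using upper_block_pow[OF zero_carrier_mat[of 1 1] r A, of e] by blast
  ultimately have z: "upper_block (0\<^sub>m 1 1 ^\<^sub>m e) B' (A ^\<^sub>m e) = 0\<^sub>m (1 + m) (1 + m)" by simp
  have Ae: "A ^\<^sub>m e \<in> carrier_mat m m" by (rule pow_carrier_mat[OF A])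
  have Ze: "(0\<^sub>m 1 1 :: 'a mat) ^\<^sub>m e \<in> carrier_mat 1 1" by (rule pow_carrier_mat) simp
  have "A ^\<^sub>m e = 0\<^sub>m m m"
  proof (rule eq_matI)
    fix i j assume ij: "i < dim_row (0\<^sub>m m m :: 'a mat)" "j < dim_col (0\<^sub>m m m :: 'a mat)"
    have "upper_block (0\<^sub>m 1 1 ^\<^sub>m e) B' (A ^\<^sub>m e) $$ (1 + i, 1 + j) = (A ^\<^sub>m e) $$ (i,j)"
      using upper_block_lower_right[OF Ze Ae] ij by simp
    then show "(A ^\<^sub>m e) $$ (i,j) = 0\<^sub>m m m $$ (i,j)" unfolding z using ij by simp
  qed (use Ae in auto)
  then show "nilpotent_mat A" unfolding nilpotent_mat_def using A by (intro exI[of _ e]) auto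
qed (use assms nilpotent_det nilpotent_similar similar_mat_sym in blast)+

lemma nilp_class_triangularization:
  fixes A :: "'a :: field mat"
  assumes "A \<in> carrier_mat n n" "in_class nilp_class A"
  shows "\<exists>T. strictly_upper n T \<and> similar_mat A T"
proof (rule strict_triangularization[where H = "\<lambda>n. in_class nilp_class"])
  fix m r and A :: "'a mat"
  assume r: "r \<in> carrier_mat 1 m" and A: "A \<in> carrier_mat m m" and c: "in_class nilp_class (upper_block (0\<^sub>m 1 1) r A)"
  show "in_class nilp_class A" using c in_class_upper_block[OF zero_carrier_mat r A] by blast
qed (use assms nilp_class_det in_class_similar in blast)+

text \<open>Both properties amount to similarity to a strictly upper triangular matrix, whose
  characteristic polynomial and powers are explicit.\<close>

lemma nilpotent_iff_in_class:
  fixes A :: "'a :: field mat"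
  assumes A: "A \<in> carrier_mat n n"
  shows "nilpotent_mat A \<longleftrightarrow> in_class nilp_class A"
proof
  assume "nilpotent_mat A"
  from nilpotent_triangularization[OF A this] obtain T where "strictly_upper n T" "similar_mat A T" by blast
  then show "in_class nilp_class A"
    using in_class_similar[OF similar_mat_sym nilp_class_power[OF strictly_upper_char_poly]] by blast
next
  assume "in_class nilp_class A"
  from nilp_class_triangularization[OF A this] obtain T where "strictly_upper n T" "similar_mat A T" by blast
  then show "nilpotent_mat A" using nilpotent_similar strictly_upper_nilpotent by blast
qed

lemma Nblk_eq: "Nblk ls = Mblk ls \<inter> class_mats nilp_class"
  unfolding Nblk_def class_mats_def by (auto simp: Mblk_def nilpotent_iff_in_class[of _ "sum_list ls"])

subsection \<open>Nilpotent conjugacy classes and partitions\<close>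

lemma similar_diag_block_swap:
  fixes A :: "'a :: field mat"
  assumes A: "A \<in> carrier_mat n n" and B: "B \<in> carrier_mat m m"
  shows "similar_mat (four_block_mat A (0\<^sub>m n m) (0\<^sub>m m n) B) (four_block_mat B (0\<^sub>m m n) (0\<^sub>m n m) A)"
proof -
  let ?P = "four_block_mat (0\<^sub>m n m) (1\<^sub>m n) (1\<^sub>m m) (0\<^sub>m m n) :: 'a mat"
  let ?Q = "four_block_mat (0\<^sub>m m n) (1\<^sub>m m) (1\<^sub>m n) (0\<^sub>m n m) :: 'a mat"
  let ?L = "four_block_mat A (0\<^sub>m n m) (0\<^sub>m m n) B" and ?R = "four_block_mat B (0\<^sub>m m n) (0\<^sub>m n m) A"
  have c: "?P \<in> carrier_mat (n + m) (n + m)" "?Q \<in> carrier_mat (n + m) (n + m)"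
    "?L \<in> carrier_mat (n + m) (n + m)" "?R \<in> carrier_mat (n + m) (n + m)"
    using four_block_carrier_mat[OF zero_carrier_mat[of n m] zero_carrier_mat[of m n]]
      four_block_carrier_mat[OF zero_carrier_mat[of m n] zero_carrier_mat[of n m]]
      four_block_carrier_mat[OF A B] four_block_carrier_mat[OF B A]
    by (simp_all only: add.commute[of m n])
  have "?P * ?Q = four_block_mat (1\<^sub>m n) (0\<^sub>m n m) (0\<^sub>m m n) (1\<^sub>m m)"
    unfolding mult_four_block_mat[OF zero_carrier_mat one_carrier_mat one_carrier_mat zero_carrier_mat
        zero_carrier_mat one_carrier_mat one_carrier_mat zero_carrier_mat]
    by (rule cong_four_block_mat) simp_all
  then have "?P * ?Q = 1\<^sub>m (n + m)" by simp
  then have "?P \<in> GL (n + m)" by (rule GL_I[OF c(1,2)])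
  moreover have "?P * ?R = ?L * ?P"
    unfolding mult_four_block_mat[OF zero_carrier_mat one_carrier_mat one_carrier_mat zero_carrier_mat
        B zero_carrier_mat zero_carrier_mat A]
      mult_four_block_mat[OF A zero_carrier_mat zero_carrier_mat B
        zero_carrier_mat one_carrier_mat one_carrier_mat zero_carrier_mat]
    by (rule cong_four_block_mat) (use A B in simp_all)
  ultimately show ?thesis using similar_mat_iff_GL[OF c(4,3)] by blast
qed

lemma jordan_matrix_cong:
  fixes xs :: "(nat \<times> 'a :: field) list"
  assumes "similar_mat (jordan_matrix xs) (jordan_matrix ys)"
  shows "similar_mat (jordan_matrix (x # xs)) (jordan_matrix (x # ys))"
proof -
  obtain n a where x: "x = (n,a)" by force
  from similar_matD[OF assms] obtain N where "jordan_matrix xs \<in> carrier_mat N N" "jordan_matrix ys \<in> carrier_mat N N" by auto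
  then have e: "sum_list (map fst xs) = sum_list (map fst ys)" by (metis carrier_matD(1) jordan_matrix_dim(1))
  show ?thesis unfolding x jordan_matrix_Cons e
    by (rule similar_mat_four_block_0_0[OF similar_mat_refl assms]) (use jordan_matrix_carrier[of xs] e in auto)
qed

lemma jordan_matrix_swap:
  fixes zs :: "(nat \<times> 'a :: field) list"
  shows "similar_mat (jordan_matrix (x # y # zs)) (jordan_matrix (y # x # zs))"
proof -
  obtain n a m b where xy: "x = (n,a)" "y = (m,b)" by force
  let ?A = "jordan_block n a" and ?B = "jordan_block m b" and ?C = "jordan_matrix zs" and ?c = "sum_list (map fst zs)"
  let ?d = "\<lambda>A B. four_block_mat A (0\<^sub>m (dim_row A) (dim_col B)) (0\<^sub>m (dim_row B) (dim_col A)) B"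
  have J: "jordan_matrix (x # y # zs) = ?d (?d ?A ?B) ?C" "jordan_matrix (y # x # zs) = ?d (?d ?B ?A) ?C"
    unfolding assoc_four_block_mat[symmetric] by (simp_all add: xy jordan_matrix_Cons jordan_block_def)
  have "similar_mat (four_block_mat (?d ?A ?B) (0\<^sub>m (n + m) ?c) (0\<^sub>m ?c (n + m)) ?C)
    (four_block_mat (?d ?B ?A) (0\<^sub>m (n + m) ?c) (0\<^sub>m ?c (n + m)) ?C)"
  proof (rule similar_mat_four_block_0_0)
    show "similar_mat (?d ?A ?B) (?d ?B ?A)"
      using similar_diag_block_swap[of ?A n ?B m] by (simp add: jordan_block_def)
    show "similar_mat ?C ?C" by (rule similar_mat_refl) (rule jordan_matrix_carrier)
    show "?d ?A ?B \<in> carrier_mat (n + m) (n + m)" by simp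
  qed (rule jordan_matrix_carrier)
  then show ?thesis unfolding J by (simp add: jordan_block_def add.commute)
qed

lemma jordan_matrix_move:
  fixes xs :: "(nat \<times> 'a :: field) list"
  shows "similar_mat (jordan_matrix (xs @ x # ys)) (jordan_matrix (x # xs @ ys))"
proof (induction xs)
  case Nil
  then show ?case by (auto intro: similar_mat_refl[OF jordan_matrix_carrier])
next
  case (Cons y xs)
  show ?case using similar_mat_trans[OF jordan_matrix_cong[OF Cons.IH] jordan_matrix_swap] by simp
qed

text \<open>Swapping adjacent Jordan blocks is a similarity, so their order is immaterial and they
  may be sorted by size.\<close>

lemma jordan_matrix_mset_cong:
  fixes xs :: "(nat \<times> 'a :: field) list"
  shows "mset xs = mset ys \<Longrightarrow> similar_mat (jordan_matrix xs) (jordan_matrix ys)"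
proof (induction xs arbitrary: ys)
  case Nil
  then show ?case by (auto intro: similar_mat_refl[OF jordan_matrix_carrier])
next
  case (Cons x xs)
  then have "x \<in> set ys" by (metis list.set_intros(1) set_mset_mset)
  then obtain us vs where ys: "ys = us @ x # vs" by (meson split_list)
  then have "mset xs = mset (us @ vs)" using Cons.prems by simp
  from jordan_matrix_cong[OF Cons.IH[OF this]] jordan_matrix_move[of us x vs] show ?case
    unfolding ys using similar_mat_trans similar_mat_sym by blast
qed

definition nilp_jordan :: "nat list \<Rightarrow> 'a :: field mat" where
  "nilp_jordan lam = jordan_matrix (map (\<lambda>n. (n, 0)) lam)"

lemma nilp_jordan_carrier: "nilp_jordan lam \<in> carrier_mat (sum_list lam) (sum_list lam)"
  using jordan_matrix_carrier[of "map (\<lambda>n. (n, 0 :: 'a)) lam"] by (simp add: nilp_jordan_def comp_def)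

lemma nilp_jordan_in_class: "in_class nilp_class (nilp_jordan lam)"
proof (rule nilp_class_power)
  show "char_poly (nilp_jordan lam :: 'a mat) = [:0, 1:] ^ sum_list lam"
    unfolding nilp_jordan_def jordan_matrix_char_poly by (induction lam) (auto simp: power_add)
qed

text \<open>The number of Jordan blocks of each positive size is an invariant of the matrix, so the
  two lists agree as multisets, and a non-increasing list is determined by its multiset.\<close>

lemma nilp_jordan_inj:
  assumes sim: "similar_mat (nilp_jordan lam :: 'a :: field mat) (nilp_jordan mu)"
    and lam: "is_partition lam" and mu: "is_partition mu"
  shows "lam = mu"
proof -
  let ?j = "map (\<lambda>n. (n, 0 :: 'a))"
  have 0: "0 \<notin> fst ` set (?j lam)" "0 \<notin> fst ` set (?j mu)" using lam mu by (auto simp: is_partition_def)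
  have j: "jordan_nf (nilp_jordan lam :: 'a mat) (?j lam)" "jordan_nf (nilp_jordan lam :: 'a mat) (?j mu)"
    unfolding jordan_nf_def
    using sim 0 similar_mat_refl[OF nilp_jordan_carrier[of lam, where 'a='a]] by (simp_all add: nilp_jordan_def)
  have len: "length (filter ((=) (k, 0 :: 'a)) (?j xs)) = count (mset xs) k" for k xs
    by (induction xs) auto
  have "count (mset lam) k = count (mset mu) k" for k
  proof (cases "k = 0")
    case True
    have "k \<notin> set lam" "k \<notin> set mu" using True lam mu by (auto simp: is_partition_def)
    then have "k \<notin># mset lam" "k \<notin># mset mu" by simp_all
    then have "count (mset lam) k = 0" "count (mset mu) k = 0" by (simp_all only: not_in_iff)
    then show ?thesis by (simp only:)
  next
    case False
    then show ?thesis
      using compute_nr_of_jordan_blocks[OF j(1) False, of 0] compute_nr_of_jordan_blocks[OF j(2) False, of 0]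
      unfolding len by simp
  qed
  then have m: "mset lam = mset mu" by (rule multiset_eqI)
  have "sorted (rev lam)" "sorted (rev mu)" using lam mu by (simp_all add: is_partition_def sorted_wrt_rev)
  then have "rev lam = rev mu" using m by (metis mset_rev properties_for_sort)
  then show ?thesis by simp
qed

text \<open>A triangular matrix has a Jordan form over its own field, and strict triangularization
  provides such a matrix similar to \<open>A\<close>. Its characteristic polynomial leaves 0 as the
  only eigenvalue.\<close>

lemma nilp_jordan_ex:
  fixes A :: "'a :: field mat"
  assumes A: "A \<in> carrier_mat j j" and cl: "in_class nilp_class A"
  shows "\<exists>lam. is_partition lam \<and> sum_list lam = j \<and> similar_mat A (nilp_jordan lam)"
proof -
  from nilp_class_triangularization[OF assms] obtain T where T: "strictly_upper j T" "similar_mat A T" by blast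
  have Tc: "T \<in> carrier_mat j j" "upper_triangular T" using T(1) by (auto simp: strictly_upper_def)
  from triangular_to_jnf_vector[OF Tc] obtain n_as where jnf: "jordan_nf T n_as" by blast
  have pos: "0 < n" if "(n,a) \<in> set n_as" for n a
    using jnf that unfolding jordan_nf_def by force
  have ev: "a = 0" if na: "(n,a) \<in> set n_as" for n a
  proof -
    \<comment> \<open>Both expressions for the characteristic polynomial are evaluated at
      \<open>a\<close>: a block of positive size makes the product vanish, so
      \<open>a ^ j = 0\<close>.\<close>
    have "[:0, 1:] ^ j = (\<Prod>(n, a)\<leftarrow>n_as. [:- a, 1:] ^ n)"
      using jordan_nf_char_poly[OF jnf] strictly_upper_char_poly[OF T(1)] by simp
    moreover have "[:- a, 1:] ^ n \<in> set (map (\<lambda>(n,a). [:- a, 1:] ^ n) n_as)" using na by force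
    then obtain ps qs where "map (\<lambda>(n,a). [:- a, 1:] ^ n) n_as = ps @ [:- a, 1:] ^ n # qs" by (meson split_list)
    then have "(\<Prod>(n, a)\<leftarrow>n_as. [:- a, 1:] ^ n) = [:- a, 1:] ^ n * (prod_list ps * prod_list qs)" by simp
    ultimately have "poly ([:0, 1:] ^ j) a = poly ([:- a, 1:] ^ n * (prod_list ps * prod_list qs)) a" by simp
    then have "a ^ j = 0" using pos[OF na] by (simp add: poly_power)
    then show "a = 0" by simp
  qed
  define lam where "lam = rev (sort (map fst n_as))"
  have "map (\<lambda>n. (n, 0)) (map fst n_as) = n_as"
    unfolding map_map by (rule map_idI) (use ev in auto)
  then have m: "mset n_as = mset (map (\<lambda>n. (n, 0)) lam)"
    unfolding lam_def by (metis mset_map mset_rev mset_sort)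
  have "similar_mat (jordan_matrix n_as) (nilp_jordan lam)"
    unfolding nilp_jordan_def by (rule jordan_matrix_mset_cong[OF m])
  then have sim: "similar_mat A (nilp_jordan lam)"
    using similar_mat_trans[OF T(2)] jnf similar_mat_trans unfolding jordan_nf_def by blast
  have "is_partition lam"
    unfolding is_partition_def lam_def using pos by (auto simp: sorted_wrt_rev)
  moreover have "sum_list lam = j"
    using similar_matD[OF sim] A nilp_jordan_carrier[of lam, where 'a='a] by (metis carrier_matD(1) insert_subset)
  ultimately show ?thesis using sim by blast
qed

text \<open>The matrices \<open>nilp_jordan lam\<close> represent each nilpotent conjugacy class
  exactly once, so partitions under equality are matched with orbits under conjugation.\<close>

lemma c_count_nilp:
  "c_count j (nilp_class :: 'a :: {field,finite} poly set) = partition_count j"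
proof -
  let ?X = "{lam. is_partition lam \<and> sum_list lam = j}"
  let ?Y = "carrier_mat j j \<inter> class_mats nilp_class :: 'a mat set"
  let ?R = "\<lambda>A B :: 'a mat. \<exists>P\<in>GL j. P * A = B * P"
  have R: "?R A B \<longleftrightarrow> similar_mat B A" if "A \<in> ?Y" "B \<in> ?Y" for A B
    using similar_mat_iff_GL[of A j B] that by blast
  have sim: "equiv_on ?Y (\<lambda>A B. similar_mat B A)"
    by (rule equiv_onI) (auto intro: similar_mat_refl similar_mat_sym similar_mat_trans)
  have eq: "equiv_on ?Y ?R"
    by (rule equiv_onI) (use R equiv_onD[OF sim] in metis)+
  have "norb (=) ?X = norb ?R ?Y"
  proof (rule norb_transfer[OF eq, where f = nilp_jordan])
    show "nilp_jordan lam \<in> ?Y" if "lam \<in> ?X" for lam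
      using that nilp_jordan_carrier[of lam, where 'a='a] nilp_jordan_in_class by (auto simp: class_mats_def)
    note mem = this
    show "lam = mu \<longleftrightarrow> ?R (nilp_jordan lam) (nilp_jordan mu)" if "lam \<in> ?X" "mu \<in> ?X" for lam mu
      using nilp_jordan_inj[of mu lam, where 'a='a] that R[OF mem mem] similar_mat_refl[OF nilp_jordan_carrier] by auto
    show "\<exists>lam\<in>?X. ?R (nilp_jordan lam) A" if A: "A \<in> ?Y" for A
    proof -
      from A nilp_jordan_ex[of A j] obtain lam where "lam \<in> ?X" "similar_mat A (nilp_jordan lam)"
        by (auto simp: class_mats_def)
      then show ?thesis using R[OF mem A] by blast
    qed
  qed
  moreover have "norb (=) ?X = card ((\<lambda>lam. {lam}) ` ?X)"
    unfolding norb_def by (intro arg_cong[of _ _ card] image_cong) auto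
  moreover have "\<dots> = card ?X" by (rule card_image) (auto intro: inj_onI)
  ultimately show ?thesis
    unfolding c_count_def conj_orbits_eq_norb partition_count_def GL_def by simp
qed

theorem mainTheorem1:
  fixes S :: "'a :: {field, finite} poly set" and k m :: nat
  assumes "0 < k" and "0 < m"
  shows "(kappa (k + m) [k] S
           = (\<Sum>j = 0..k. c_count (k - j) S * (\<Sum>lam \<in> partitions_bounded j m. kappa m lam S))) \<and>
         (rho TYPE('a) [k, m]
           = (\<Sum>j = 0..k. partition_count (k - j) * (\<Sum>lam \<in> partitions_bounded j m. nu TYPE('a) m lam)))"
proof
  show "kappa (k + m) [k] S
      = (\<Sum>j = 0..k. c_count (k - j) S * (\<Sum>lam \<in> partitions_bounded j m. kappa m lam S))"
    by (rule kappa_eq_partition_sum)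
  have nu: "nu TYPE('a) n lam = kappa n lam (nilp_class :: 'a poly set)" for n lam
    by (simp add: nu_def rho_def kappa_def Nblk_eq)
  \<comment> \<open>\<open>[k, m]\<close> is \<open>delta (k + m) [k]\<close>, so the left side is
    the instance of the first identity at the nilpotent class.\<close>
  have "rho TYPE('a) [k, m] = nu TYPE('a) (k + m) [k]"
    by (simp add: nu_def delta_def)
  then show "rho TYPE('a) [k, m]
      = (\<Sum>j = 0..k. partition_count (k - j) * (\<Sum>lam \<in> partitions_bounded j m. nu TYPE('a) m lam))"
    unfolding nu kappa_eq_partition_sum c_count_nilp by simp
qed

end
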